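(* Let $L>0$, $Y\in(0,L)$, $\lambda_1\ge 0$, and let $\{t_i\}_{i\ge1}$ be a sequence of times with $t_1=0$, $t_{i+1}>t_i$, for which there are $\bar T_1,\bar T_2>0$ such that $t_{2k}-t_{2k-1}=\bar T_1$ and $t_{2k+1}-t_{2k}=\bar T_2$ for all $k\in\{1,2,\dots\}$. Put $I_1:=\bigcup_{k\ge1}[t_{2k-1},t_{2k})$ and $I_2:=\bigcup_{k\ge1}[t_{2k},t_{2k+1})$. Consider $$u_t=-uu_x-\lambda_1u_{xx}-u_{xxxx},\qquad x\in[0,L],$$ under $(u_x(L),u_x(Y),u_x(0))=(0,0,0)$ and $(u(0),u(Y),u(L))=(u_1,u_2,u_3)$, with the feedback $u_2=0$ at all times, $(u_1,u_3)=(\kappa_1(V_1,w_{xxx}(0)),0)$ on $I_1$, and $(u_1,u_3)=(0,\kappa_3(V_2,v_{xxx}(L)))$ on $I_2$, where $w$ and $v$ are the restrictions of $u$ to $[0,Y]$ and $[Y,L]$, and $V_1,V_2,\kappa_1,\kappa_3$ (depending on design parameters $\alpha_1,\alpha_2>0$) and $\delta_2$ are defined in the context. If $$\alpha_1>\frac{2\delta_2\bar T_2}{\bar T_1}\quad\text{and}\quad\alpha_2>\frac{2\delta_2\bar T_1}{\bar T_2},$$ then the trivial solution of the closed-loop system is $\mathcal L^2$-globally exponentially stable ($\mathcal L^2$-GES): there exist $\gamma,\kappa>0$ such that every solution $u$ of the closed-loop system satisfies $\|u(t_o+t)\|\le\kappa e^{-\gamma t}\|u(t_o)\|$ for all $(t_o,t)\in\mathbb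 R_{\ge0}\times\mathbb R_{\ge0}$ (with $t_o,t_o+t$ in the domain of $u$), where $\|\cdot\|$ is the norm of $L^2(0,L)$.
   Context: Sensing scenario: $u([0,Y],t)$ is available to the controller for $t\in I_1$ and $u([Y,L],t)$ is available for $t\in I_2$. Solutions. A pair $((w,v),\{u_i\}_{i=1}^3)$, with $w:[0,Y]\times D\to\mathbb R$, $v:[Y,L]\times D\to\mathbb R$, $u_i:D\to\mathbb R$ (common time domain $D$), is a solution pair of the split system if $(w(\cdot,t),v(\cdot,t))\in H^4(0,Y)\times H^4(Y,L)$; $(w(x,\cdot),v(x,\cdot))$ is locally absolutely continuous; the boundary conditions $w(Y)=v(Y)=u_2$, $w_x(Y)=v_x(Y)=0$, $w_x(0)=0$, $v_x(L)=0$, $w(0)=u_1$, $v(L)=u_3$ hold; and $w_t=-ww_x-\lambda_1w_{xx}-w_{xxxx}$ for almost all $(x,t)\in[0,Y]\times D$, $v_t=-vv_x-\lambda_1v_{xx}-v_{xxxx}$ for almost all $(x,t)\in[Y,L]\times D$. A solution $u$ of the equation on $[0,L]$ is a function equal to $w$ on $[0,Y]\times D$ and to $v$ on $[Y,L]\times D$ for such a pair. $V_1:=\frac12\int_0^Yw(x)^2dx$ and $V_2:=\frac12\int_Y^Lv(x)^2dx$ (functions of time). Constants. For an interval $[a,b]$, let $\delta_o$ be the smallest $\delta\in\mathbb R$ such that $z_{xxxx}+3\lambda_1z_{xx}=\delta z$ on $[a,b]$ has a nontrivial solution $z$ with $z(a)=z(b)=z_x(a)=z_x(b)=0$. Fix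 $\delta\in\mathbb R$ not larger than the value of $\delta_o$ for $[a,b]=[0,Y]$ and not larger than the value of $\delta_o$ for $[a,b]=[Y,L]$. Put $\delta_1:=(|\delta|-2\delta)/3$ and $\delta_2:=(4|\delta|-2\delta)/3$. For an interval $[a,b]$ and $p,q\in\mathbb R$ let $\chi(x):=p-2(q-p)\left(\frac{x-a}{b-a}\right)^3+3(q-p)\left(\frac{x-a}{b-a}\right)^2$, and $C_1(p,q):=2\int_a^b\chi_{xx}^2dx$, $C_2(p,q):=\int_a^b\chi^2dx$, $C_3(p,q):=2\int_a^b\chi_x^2dx$; these are quadratic forms in $(p,q)$. Denote them $C_{wi}$ when $[a,b]=[0,Y]$ and $C_{vi}$ when $[a,b]=[Y,L]$. Let $a_{wi},b_{vi}$ be the constants with $C_{wi}(p,0)=a_{wi}p^2$ and $C_{vi}(0,q)=b_{vi}q^2$, $i=1,2,3$. Controllers. Let $l_1(V_1):=V_1^2/3+(a_{w1}+\delta_2a_{w2}+\lambda_1a_{w3})V_1+(\alpha_1+2\delta_1)$ and let $k_1=k_1(V_1)$ satisfy $k_1^3+3(a_{w1}+\delta_2a_{w2}+\lambda_1a_{w3}+1)k_1^2+3l_1(V_1)^2\le-3(\alpha_1+2\delta_1)V_1$. Then $\kappa_1(V_1,\zeta):=-\mathrm{sign}(\zeta)V_1$ if $|\zeta|\ge l_1(V_1)$, and $\kappa_1(V_1,\zeta):=k_1(V_1)$ otherwise. Let $l_3(V_2):=V_2^2/3+(b_{v1}+\delta_2b_{v2}+\lambda_1b_{v3})V_2+(\alpha_2+2\delta_1)$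 and let $k_3=k_3(V_2)$ satisfy $k_3^3+3(b_{v1}+\delta_2b_{v2}+\lambda_1b_{v3}+1)k_3^2+3l_3(V_2)^2\le-3(\alpha_2+2\delta_1)V_2$. Then $\kappa_3(V_2,\zeta):=\mathrm{sign}(\zeta)V_2$ if $|\zeta|\ge l_3(V_2)$, and $\kappa_3(V_2,\zeta):=-k_3(V_2)$ otherwise.
   Formalization: Solutions are additionally required to be locally absolutely continuous in time as maps t ↦ w(·,t), v(·,t) into L²; with absolute continuity only at each fixed x, a solution that is zero until some time and then issues from a derivative of a Dirac mass violates the bound. *)

theory Defs
  imports "HOL-Analysis.Analysis"
begin

section \<open>Function spaces\<close>

definition L2_on :: "real \<Rightarrow> real \<Rightarrow> (real \<Rightarrow> real) \<Rightarrow> bool" where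
  "L2_on a b f \<longleftrightarrow> f \<in> borel_measurable (lebesgue_on {a..b}) \<and>
     integrable (lebesgue_on {a..b}) (\<lambda>x. (f x)\<^sup>2)"

definition L2_norm_on :: "real \<Rightarrow> real \<Rightarrow> (real \<Rightarrow> real) \<Rightarrow> real" where
  "L2_norm_on a b f = sqrt (integral {a..b} (\<lambda>x. (f x)\<^sup>2))"

text \<open>Weak derivatives on \<open>(a, b)\<close> are tested against the compactly supported
  \<open>C\<^sup>1\<close> functions, as in Brezis' book.\<close>

definition weak_derivative_on :: "real \<Rightarrow> real \<Rightarrow> (real \<Rightarrow> real) \<Rightarrow> (real \<Rightarrow> real) \<Rightarrow> bool" where
  "weak_derivative_on a b f g \<longleftrightarrow>
     (\<forall>\<phi> \<phi>'. (\<forall>x. (\<phi> has_real_derivative \<phi>' x) (at x)) \<and> continuous_on UNIV \<phi>' \<and>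
             (\<exists>c d. a < c \<and> c \<le> d \<and> d < b \<and> (\<forall>x. x \<notin> {c..d} \<longrightarrow> \<phi> x = 0)) \<longrightarrow>
        integral {a..b} (\<lambda>x. f x * \<phi>' x) = - integral {a..b} (\<lambda>x. g x * \<phi> x))"

fun Sobolev_H :: "nat \<Rightarrow> real \<Rightarrow> real \<Rightarrow> (real \<Rightarrow> real) \<Rightarrow> bool" where
  "Sobolev_H 0 a b f \<longleftrightarrow> L2_on a b f"
| "Sobolev_H (Suc m) a b f \<longleftrightarrow>
     L2_on a b f \<and> (\<exists>g. weak_derivative_on a b f g \<and> Sobolev_H m a b g)"

text \<open>Absolute continuity on compact subintervals of \<open>D\<close>, for maps into a space with
  distance \<open>d\<close>: for \<open>n\<close> non-overlapping intervals \<open>[r i, s i]\<close> of small total length the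
  total increment is small.\<close>

definition locally_AC :: "('a \<Rightarrow> 'a \<Rightarrow> real) \<Rightarrow> real set \<Rightarrow> (real \<Rightarrow> 'a) \<Rightarrow> bool" where
  "locally_AC d D f \<longleftrightarrow>
     (\<forall>\<alpha> \<beta>. \<alpha> \<le> \<beta> \<and> {\<alpha>..\<beta>} \<subseteq> D \<longrightarrow>
       (\<forall>\<epsilon>>0. \<exists>\<eta>>0. \<forall>(n::nat) r s.
          (\<forall>i<n. \<alpha> \<le> r i \<and> r i \<le> s i \<and> s i \<le> \<beta>) \<and>
          (\<forall>i<n. \<forall>j<n. i \<noteq> j \<longrightarrow> {r i<..<s i} \<inter> {r j<..<s j} = {}) \<and>
          (\<Sum>i<n. s i - r i) < \<eta> \<longrightarrow>
          (\<Sum>i<n. d (f (r i)) (f (s i))) < \<epsilon>))"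

text \<open>Spatial derivative, one-sided at the end points of \<open>[a, b]\<close>.\<close>

definition Dx :: "real \<Rightarrow> real \<Rightarrow> (real \<Rightarrow> real) \<Rightarrow> real \<Rightarrow> real" where
  "Dx a b f x = vector_derivative f (at x within {a..b})"


section \<open>Solutions of the split system\<close>

text \<open>\<open>KS_on lam a b D w p q\<close>: \<open>w\<close> solves the equation on \<open>[a, b] \<times> D\<close> with
  \<open>w(a) = p\<close>, \<open>w(b) = q\<close> and \<open>w\<^sub>x(a) = w\<^sub>x(b) = 0\<close>.

  Elements of \<open>H\<^sup>4\<close> are represented by continuous functions, so the traces are those of a
  \<open>C\<^sup>3\<close> function, and \<open>(Dx a b ^^ 4)\<close> is the almost everywhere derivative of the absolutely
  continuous \<open>w\<^sub>x\<^sub>x\<^sub>x\<close>.  Like the equation itself, regularity and boundary conditions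
  are required for almost all times (the feedback inputs jump, and a trajectory that is
  \<open>H\<^sup>4\<close> with the new boundary value at each jump would be too much to ask), and time
  regularity for almost all points; functions that satisfy them everywhere are included.

  Absolute continuity in time is also required of \<open>t \<mapsto> w(\<cdot>,t)\<close> as a map into \<open>L\<^sup>2\<close>.
  Pointwise absolute continuity alone admits spurious solutions: \<open>w = 0\<close> for \<open>t \<le> s\<close>,
  continued after \<open>s\<close> by the odd (about the midpoint) solution with datum \<open>\<delta>'\<close> there and
  zero boundary values, is absolutely continuous in time at each point, but its \<open>L\<^sup>2\<close> norm
  is unbounded as \<open>t\<close> decreases to \<open>s\<close>.\<close>

definition KS_on ::
  "real \<Rightarrow> real \<Rightarrow> real \<Rightarrow> real set \<Rightarrow> (real \<Rightarrow> real \<Rightarrow> real) \<Rightarrow> (real \<Rightarrow> real) \<Rightarrow> (real \<Rightarrow> real) \<Rightarrow> bool"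
where
  "KS_on lam a b D w p q \<longleftrightarrow>
     (AE t in lebesgue_on D.
        Sobolev_H 4 a b (\<lambda>x. w x t) \<and> continuous_on {a..b} (\<lambda>x. w x t) \<and>
        w a t = p t \<and> w b t = q t \<and>
        Dx a b (\<lambda>x. w x t) a = 0 \<and> Dx a b (\<lambda>x. w x t) b = 0) \<and>
     (AE x in lebesgue_on {a..b}. locally_AC dist D (w x)) \<and>
     (\<forall>t\<in>D. L2_on a b (\<lambda>x. w x t)) \<and>
     locally_AC (\<lambda>f g. L2_norm_on a b (\<lambda>x. f x - g x)) D (\<lambda>t x. w x t) \<and>
     (AE (x, t) in lebesgue_on ({a..b} \<times> D).
        ((\<lambda>s. w x s) has_real_derivative
           (- w x t * Dx a b (\<lambda>y. w y t) x
            - lam * (Dx a b ^^ 2) (\<lambda>y. w y t) x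
            - (Dx a b ^^ 4) (\<lambda>y. w y t) x)) (at t within D))"

definition split_solution ::
  "real \<Rightarrow> real \<Rightarrow> real \<Rightarrow> real set \<Rightarrow> (real \<Rightarrow> real \<Rightarrow> real) \<Rightarrow> (real \<Rightarrow> real \<Rightarrow> real) \<Rightarrow>
   (real \<Rightarrow> real) \<Rightarrow> (real \<Rightarrow> real) \<Rightarrow> (real \<Rightarrow> real) \<Rightarrow> bool"
where
  "split_solution lam Y L D w v u1 u2 u3 \<longleftrightarrow>
     is_interval D \<and> D \<subseteq> {0..} \<and> KS_on lam 0 Y D w u1 u2 \<and> KS_on lam Y L D v u2 u3"

definition energy :: "real \<Rightarrow> real \<Rightarrow> (real \<Rightarrow> real \<Rightarrow> real) \<Rightarrow> real \<Rightarrow> real" where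
  "energy a b w t = 1 / 2 * integral {a..b} (\<lambda>x. (w x t)\<^sup>2)"


section \<open>Constants\<close>

definition clamped_eigenvalue :: "real \<Rightarrow> real \<Rightarrow> real \<Rightarrow> real \<Rightarrow> bool" where
  "clamped_eigenvalue lam a b \<delta> \<longleftrightarrow>
     (\<exists>z z1 z2 z3. (\<forall>x\<in>{a..b}.
          (z has_real_derivative z1 x) (at x within {a..b}) \<and>
          (z1 has_real_derivative z2 x) (at x within {a..b}) \<and>
          (z2 has_real_derivative z3 x) (at x within {a..b}) \<and>
          (z3 has_real_derivative (\<delta> * z x - 3 * lam * z2 x)) (at x within {a..b})) \<and>
        z a = 0 \<and> z b = 0 \<and> z1 a = 0 \<and> z1 b = 0 \<and> (\<exists>x\<in>{a..b}. z x \<noteq> 0))"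

definition delta_o :: "real \<Rightarrow> real \<Rightarrow> real \<Rightarrow> real" where
  "delta_o lam a b = (LEAST \<delta>. clamped_eigenvalue lam a b \<delta>)"

definition delta1 :: "real \<Rightarrow> real" where
  "delta1 \<delta> = (\<bar>\<delta>\<bar> - 2 * \<delta>) / 3"

definition delta2 :: "real \<Rightarrow> real" where
  "delta2 \<delta> = (4 * \<bar>\<delta>\<bar> - 2 * \<delta>) / 3"

definition chi :: "real \<Rightarrow> real \<Rightarrow> real \<Rightarrow> real \<Rightarrow> real \<Rightarrow> real" where
  "chi a b p q x = p - 2 * (q - p) * ((x - a) / (b - a)) ^ 3 + 3 * (q - p) * ((x - a) / (b - a))\<^sup>2"

definition C1 :: "real \<Rightarrow> real \<Rightarrow> real \<Rightarrow> real \<Rightarrow> real" where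
  "C1 a b p q = 2 * integral {a..b} (\<lambda>x. (deriv (deriv (chi a b p q)) x)\<^sup>2)"

definition C2 :: "real \<Rightarrow> real \<Rightarrow> real \<Rightarrow> real \<Rightarrow> real" where
  "C2 a b p q = integral {a..b} (\<lambda>x. (chi a b p q x)\<^sup>2)"

definition C3 :: "real \<Rightarrow> real \<Rightarrow> real \<Rightarrow> real \<Rightarrow> real" where
  "C3 a b p q = 2 * integral {a..b} (\<lambda>x. (deriv (chi a b p q) x)\<^sup>2)"

definition left_coeff :: "(real \<Rightarrow> real \<Rightarrow> real) \<Rightarrow> real" where
  "left_coeff C = (THE c. \<forall>p. C p 0 = c * p\<^sup>2)"

definition right_coeff :: "(real \<Rightarrow> real \<Rightarrow> real) \<Rightarrow> real" where
  "right_coeff C = (THE c. \<forall>q. C 0 q = c * q\<^sup>2)"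

text \<open>\<open>a\<^sub>w\<^sub>1 + \<delta>\<^sub>2 a\<^sub>w\<^sub>2 + \<lambda>\<^sub>1 a\<^sub>w\<^sub>3\<close> and \<open>b\<^sub>v\<^sub>1 + \<delta>\<^sub>2 b\<^sub>v\<^sub>2 + \<lambda>\<^sub>1 b\<^sub>v\<^sub>3\<close>.\<close>

definition gain_w :: "real \<Rightarrow> real \<Rightarrow> real \<Rightarrow> real" where
  "gain_w lam Y \<delta> = left_coeff (C1 0 Y) + delta2 \<delta> * left_coeff (C2 0 Y)
     + lam * left_coeff (C3 0 Y)"

definition gain_v :: "real \<Rightarrow> real \<Rightarrow> real \<Rightarrow> real \<Rightarrow> real" where
  "gain_v lam Y L \<delta> = right_coeff (C1 Y L) + delta2 \<delta> * right_coeff (C2 Y L)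
     + lam * right_coeff (C3 Y L)"


section \<open>Controllers and closed loop\<close>

definition l1 :: "real \<Rightarrow> real \<Rightarrow> real \<Rightarrow> real \<Rightarrow> real \<Rightarrow> real" where
  "l1 lam Y \<delta> \<alpha>1 V = V\<^sup>2 / 3 + gain_w lam Y \<delta> * V + (\<alpha>1 + 2 * delta1 \<delta>)"

definition l3 :: "real \<Rightarrow> real \<Rightarrow> real \<Rightarrow> real \<Rightarrow> real \<Rightarrow> real \<Rightarrow> real" where
  "l3 lam Y L \<delta> \<alpha>2 V = V\<^sup>2 / 3 + gain_v lam Y L \<delta> * V + (\<alpha>2 + 2 * delta1 \<delta>)"

text \<open>In \<open>kappa1\<close> and \<open>kappa3\<close> the first two arguments are the threshold and the fallback gain,
  as functions of the energy.\<close>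

definition kappa1 :: "(real \<Rightarrow> real) \<Rightarrow> (real \<Rightarrow> real) \<Rightarrow> real \<Rightarrow> real \<Rightarrow> real" where
  "kappa1 l k V \<zeta> = (if \<bar>\<zeta>\<bar> \<ge> l V then - sgn \<zeta> * V else k V)"

definition kappa3 :: "(real \<Rightarrow> real) \<Rightarrow> (real \<Rightarrow> real) \<Rightarrow> real \<Rightarrow> real \<Rightarrow> real" where
  "kappa3 l k V \<zeta> = (if \<bar>\<zeta>\<bar> \<ge> l V then sgn \<zeta> * V else - k V)"

definition I1 :: "(nat \<Rightarrow> real) \<Rightarrow> real set" where
  "I1 \<tau> = (\<Union>k\<in>{1..}. {\<tau> (2 * k - 1)..<\<tau> (2 * k)})"

definition I2 :: "(nat \<Rightarrow> real) \<Rightarrow> real set" where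
  "I2 \<tau> = (\<Union>k\<in>{1..}. {\<tau> (2 * k)..<\<tau> (2 * k + 1)})"

definition closed_loop_solution ::
  "real \<Rightarrow> real \<Rightarrow> real \<Rightarrow> (nat \<Rightarrow> real) \<Rightarrow> (real \<Rightarrow> real \<Rightarrow> real) \<Rightarrow> (real \<Rightarrow> real \<Rightarrow> real) \<Rightarrow>
   real set \<Rightarrow> (real \<Rightarrow> real \<Rightarrow> real) \<Rightarrow> bool"
where
  "closed_loop_solution lam Y L \<tau> \<kappa>1 \<kappa>3 D u \<longleftrightarrow>
     (\<exists>w v u1 u2 u3. split_solution lam Y L D w v u1 u2 u3 \<and>
        (\<forall>t\<in>D. (\<forall>x\<in>{0..Y}. u x t = w x t) \<and> (\<forall>x\<in>{Y..L}. u x t = v x t)) \<and>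
        (\<forall>t\<in>D. u2 t = 0) \<and>
        (\<forall>t\<in>D \<inter> I1 \<tau>.
           u1 t = \<kappa>1 (energy 0 Y w t) ((Dx 0 Y ^^ 3) (\<lambda>x. w x t) 0) \<and> u3 t = 0) \<and>
        (\<forall>t\<in>D \<inter> I2 \<tau>.
           u1 t = 0 \<and> u3 t = \<kappa>3 (energy Y L v t) ((Dx Y L ^^ 3) (\<lambda>x. v x t) L)))"

end

theory Submission
  imports Defs
begin

text \<open>Because \<open>u(Y) = 0\<close> at all times, the two halves of the interval evolve independently, and it is
  enough to follow the energies \<open>V\<^sub>1\<close>, \<open>V\<^sub>2\<close> separately.  On an interval \<open>[a, b]\<close> with boundary values
  \<open>p\<close>, \<open>q\<close> and vanishing slopes at the ends, multiplying the equation by \<open>w\<close> and integrating by parts gives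
  \<open>V' = (p^3 - q^3)/3 + p w\<^sub>x\<^sub>x\<^sub>x(a) - q w\<^sub>x\<^sub>x\<^sub>x(b) + \<lambda> \<integral> w\<^sub>x^2 - \<integral> w\<^sub>x\<^sub>x^2\<close>.
  Subtracting the cubic \<open>chi\<close> that carries the boundary data leaves a clamped function, for which the
  variational characterisation of the least clamped eigenvalue (\<open>delta_o_Rayleigh\<close>) bounds the last two
  terms by \<open>2 \<delta>\<^sub>1 V\<close> plus a quadratic form in \<open>(p, q)\<close> (\<open>lifted_dissipation_bound\<close>).  While a half is
  observed, its feedback turns this into \<open>V' \<le> - \<alpha> V\<close> (\<open>feedback_decay\<close>); while it is not, its
  boundary data vanish and \<open>V' \<le> 2 \<delta>\<^sub>2 V\<close>.  The conditions on \<open>\<alpha>\<^sub>1\<close> and \<open>\<alpha>\<^sub>2\<close> say that the exponent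
  accumulated over one period of the schedule is negative, and what is accumulated within a period only
  affects the overshoot constant.

  Three points need real analysis.  First, the least clamped eigenvalue has to exist and to be the minimum
  of the Rayleigh quotient.  Instead of a compactness argument, the Green function is used as a reproducing
  kernel: if \<open>\<delta>\<close> is no eigenvalue and the quadratic form is nonnegative, then the form controls
  point values, hence is coercive (\<open>clamped_form_coercive\<close>), so \<open>\<delta>\<close> could be increased.

  Second, the integrations by parts act on a function in \<open>H\<^sup>4\<close> given by weak derivatives.  The lemma of
  du Bois-Reymond makes it a \<open>C\<^sup>3\<close> function whose third derivative is an indefinite integral
  (\<open>Sobolev_H4_classical\<close>).  Lebesgue differentiation, from the lemma of Henstock and the Vitali covering
  theorem, and the fundamental theorem of calculus for absolutely continuous functions, by a gauge argument,
  do the rest.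

  Third, the equation holds at almost every point \<open>(x, t)\<close> only.  An absolutely continuous curve in \<open>L\<^sup>2\<close>
  has finite speed at almost every time (\<open>AC_metric_speed_finite\<close>).  At such a time the difference quotients
  of \<open>w\<close> are bounded in \<open>L\<^sup>2\<close> and converge at almost every \<open>x\<close>, hence converge weakly, which is enough
  to differentiate the energy (\<open>energy_has_derivative\<close>).\<close>

section \<open>The least clamped eigenvalue\<close>

text \<open>The derivatives are carried along as arguments, so that one-sided derivatives at the end points are
  fixed by the predicate and no derivative operator has to be evaluated there.\<close>

definition clamped :: "real \<Rightarrow> real \<Rightarrow> (real \<Rightarrow> real) \<Rightarrow> (real \<Rightarrow> real) \<Rightarrow> (real \<Rightarrow> real) \<Rightarrow> bool" where
  "clamped a b z z1 z2 \<longleftrightarrow>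
     (\<forall>x\<in>{a..b}. (z has_real_derivative z1 x) (at x within {a..b}) \<and>
                  (z1 has_real_derivative z2 x) (at x within {a..b})) \<and>
     continuous_on {a..b} z2 \<and> z a = 0 \<and> z b = 0 \<and> z1 a = 0 \<and> z1 b = 0"

lemma clamped_continuous:
  assumes "clamped a b z z1 z2"
  shows "continuous_on {a..b} z" "continuous_on {a..b} z1" "continuous_on {a..b} z2"
  using assms unfolding clamped_def
  by (meson DERIV_continuous_on)+

lemma clamped_lincomb:
  assumes "clamped a b z z1 z2" "clamped a b y y1 y2"
  shows "clamped a b (\<lambda>x. z x + r * y x) (\<lambda>x. z1 x + r * y1 x) (\<lambda>x. z2 x + r * y2 x)"
  using assms unfolding clamped_def
  by (auto intro!: derivative_eq_intros continuous_intros)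

text \<open>The weak form of \<open>z\<^sub>x\<^sub>x\<^sub>x\<^sub>x + 3 \<lambda> z\<^sub>x\<^sub>x - \<delta> z\<close>, tested with \<open>y\<close>.\<close>

definition clamped_form ::
  "real \<Rightarrow> real \<Rightarrow> real \<Rightarrow> real \<Rightarrow> (real \<Rightarrow> real) \<Rightarrow> (real \<Rightarrow> real) \<Rightarrow> (real \<Rightarrow> real) \<Rightarrow>
   (real \<Rightarrow> real) \<Rightarrow> (real \<Rightarrow> real) \<Rightarrow> (real \<Rightarrow> real) \<Rightarrow> real" where
  "clamped_form lam \<delta> a b z z1 z2 y y1 y2 =
     integral {a..b} (\<lambda>x. z2 x * y2 x - 3 * lam * (z1 x * y1 x) - \<delta> * (z x * y x))"

lemma clamped_form_quadratic:
  assumes "clamped a b z z1 z2" "clamped a b y y1 y2"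
  shows "clamped_form lam \<delta> a b (\<lambda>x. z x + r * y x) (\<lambda>x. z1 x + r * y1 x) (\<lambda>x. z2 x + r * y2 x)
           (\<lambda>x. z x + r * y x) (\<lambda>x. z1 x + r * y1 x) (\<lambda>x. z2 x + r * y2 x)
         = clamped_form lam \<delta> a b z z1 z2 z z1 z2 + 2 * r * clamped_form lam \<delta> a b y y1 y2 z z1 z2
           + r\<^sup>2 * clamped_form lam \<delta> a b y y1 y2 y y1 y2"
proof -
  note c = clamped_continuous[OF assms(1)] clamped_continuous[OF assms(2)]
  have i: "(\<lambda>x. f2 x * g2 x - 3 * lam * (f1 x * g1 x) - \<delta> * (f x * g x)) integrable_on {a..b}"
    if "continuous_on {a..b} f" "continuous_on {a..b} f1" "continuous_on {a..b} f2"
       "continuous_on {a..b} g" "continuous_on {a..b} g1" "continuous_on {a..b} g2" for f f1 f2 g g1 g2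
    using that by (intro integrable_continuous_real continuous_intros)
  show ?thesis
    unfolding clamped_form_def
    apply (subst integral_mult_right[symmetric])
    apply (subst integral_mult_right[symmetric])
    apply (subst integral_add[symmetric])
    apply (intro i c)
    apply (intro integrable_on_mult_right i c)
    apply (subst integral_add[symmetric])
    apply (intro integrable_add integrable_on_mult_right i c)
    apply (intro integrable_on_mult_right i c)
    apply (rule integral_cong)
    apply (simp add: algebra_simps power2_eq_square)
    done
qed

lemma clamped_form_shift:
  assumes "clamped a b z z1 z2"
  shows "clamped_form lam \<delta> a b z z1 z2 z z1 z2 =
     clamped_form lam 0 a b z z1 z2 z z1 z2 - \<delta> * integral {a..b} (\<lambda>x. (z x)\<^sup>2)"
proof -
  note c = clamped_continuous[OF assms]
  have "integral {a..b} (\<lambda>x. (z2 x * z2 x - 3 * lam * (z1 x * z1 x)) - \<delta> * (z x)\<^sup>2)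
     = integral {a..b} (\<lambda>x. z2 x * z2 x - 3 * lam * (z1 x * z1 x)) - integral {a..b} (\<lambda>x. \<delta> * (z x)\<^sup>2)"
    by (intro integral_diff integrable_continuous_real continuous_intros c)
  then show ?thesis unfolding clamped_form_def by (simp add: power2_eq_square)
qed

text \<open>Integrating by parts twice against a solution of the eigenvalue equation leaves boundary terms only.
  The interval is arbitrary because a Green function solves the equation only on either side of its pole.\<close>

lemma clamped_ode_weak_form:
  fixes c d :: real
  assumes "c \<le> d"
    and "\<And>x. x \<in> {c..d} \<Longrightarrow> (h has_real_derivative h1 x) (at x within {c..d})"
    and "\<And>x. x \<in> {c..d} \<Longrightarrow> (h1 has_real_derivative h2 x) (at x within {c..d})"
    and "\<And>x. x \<in> {c..d} \<Longrightarrow> (h2 has_real_derivative h3 x) (at x within {c..d})"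
    and "\<And>x. x \<in> {c..d} \<Longrightarrow> (h3 has_real_derivative \<delta> * h x - 3 * lam * h2 x) (at x within {c..d})"
    and "\<And>x. x \<in> {c..d} \<Longrightarrow> (y has_real_derivative y1 x) (at x within {c..d})"
    and "\<And>x. x \<in> {c..d} \<Longrightarrow> (y1 has_real_derivative y2 x) (at x within {c..d})"
  defines "H \<equiv> \<lambda>x. h2 x * y1 x - h3 x * y x - 3 * lam * (h1 x * y x)"
  shows "((\<lambda>x. h2 x * y2 x - 3 * lam * (h1 x * y1 x) - \<delta> * (h x * y x)) has_integral H d - H c) {c..d}"
proof (rule fundamental_theorem_of_calculus[OF assms(1)])
  fix x assume x: "x \<in> {c..d}"
  show "(H has_vector_derivative h2 x * y2 x - 3 * lam * (h1 x * y1 x) - \<delta> * (h x * y x)) (at x within {c..d})"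
    unfolding H_def has_real_derivative_iff_has_vector_derivative[symmetric]
    by (rule derivative_eq_intros assms(2-7)[OF x] refl)+ (simp add: algebra_simps)
qed

text \<open>The derivatives at \<open>0\<close> of the solution of \<open>k\<^sub>x\<^sub>x\<^sub>x\<^sub>x + 3 \<lambda> k\<^sub>x\<^sub>x = \<delta> k\<close> whose only nonzero
  datum is \<open>k\<^sub>x\<^sub>x\<^sub>x(0) = 1\<close>.\<close>

fun clamped_coeff :: "real \<Rightarrow> real \<Rightarrow> nat \<Rightarrow> real" where
  "clamped_coeff lam \<delta> 0 = 0"
| "clamped_coeff lam \<delta> (Suc 0) = 0"
| "clamped_coeff lam \<delta> (Suc (Suc 0)) = 0"
| "clamped_coeff lam \<delta> (Suc (Suc (Suc 0))) = 1"
| "clamped_coeff lam \<delta> (Suc (Suc (Suc (Suc n)))) =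
     \<delta> * clamped_coeff lam \<delta> n - 3 * lam * clamped_coeff lam \<delta> (Suc (Suc n))"

lemma clamped_coeff_bound:
  "\<bar>clamped_coeff lam \<delta> n\<bar> \<le> (1 + \<bar>\<delta>\<bar> + 3 * \<bar>lam\<bar>) ^ n"
proof (induction lam \<delta> n rule: clamped_coeff.induct)
  case (4 lam \<delta>)
  have "1 \<le> (1 + \<bar>\<delta>\<bar> + 3 * \<bar>lam\<bar>) ^ Suc (Suc (Suc 0))"
    by (rule one_le_power) simp
  then show ?case by simp
next
  case (5 lam \<delta> n)
  let ?M = "1 + \<bar>\<delta>\<bar> + 3 * \<bar>lam\<bar>"
  have "\<bar>clamped_coeff lam \<delta> (Suc (Suc (Suc (Suc n))))\<bar>
     \<le> \<bar>\<delta>\<bar> * \<bar>clamped_coeff lam \<delta> n\<bar> + 3 * \<bar>lam\<bar> * \<bar>clamped_coeff lam \<delta> (Suc (Suc n))\<bar>"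
    using abs_triangle_ineq4[of "\<delta> * clamped_coeff lam \<delta> n" "3 * lam * clamped_coeff lam \<delta> (Suc (Suc n))"]
    by (simp add: abs_mult)
  also have "\<dots> \<le> \<bar>\<delta>\<bar> * ?M ^ n + 3 * \<bar>lam\<bar> * ?M ^ Suc (Suc n)"
    using 5 by (intro add_mono mult_left_mono) auto
  also have "\<dots> \<le> \<bar>\<delta>\<bar> * ?M ^ Suc (Suc (Suc n)) + 3 * \<bar>lam\<bar> * ?M ^ Suc (Suc (Suc n))"
    by (intro add_mono mult_left_mono power_increasing) simp_all
  also have "\<dots> \<le> ?M * ?M ^ Suc (Suc (Suc n))"
    unfolding distrib_right[symmetric] by (intro mult_right_mono) simp_all
  finally show ?case by (simp only: power_Suc)
qed simp_all

text \<open>The coefficients grow at most geometrically, so the exponential series built from them converges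
  everywhere, and differentiating it shifts the coefficient sequence.\<close>

lemma clamped_ode_fundamental_solution:
  obtains k k1 k2 k3 :: "real \<Rightarrow> real" where
    "\<And>x. (k has_real_derivative k1 x) (at x)" "\<And>x. (k1 has_real_derivative k2 x) (at x)"
    "\<And>x. (k2 has_real_derivative k3 x) (at x)"
    "\<And>x. (k3 has_real_derivative \<delta> * k x - 3 * lam * k2 x) (at x)"
    "k 0 = 0" "k1 0 = 0" "k2 0 = 0" "k3 0 = 1"
proof -
  define C where "C = clamped_coeff lam \<delta>"
  define M where "M = 1 + \<bar>\<delta>\<bar> + 3 * \<bar>lam\<bar>"
  define K where "K j x = (\<Sum>n. (C (n + j) / fact n) * x ^ n)" for j and x :: real
  have sm: "summable (\<lambda>n. (C (n + j) / fact n) * x ^ n)" for j x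
  proof (rule summable_comparison_test')
    have "summable (\<lambda>n. (M * \<bar>x\<bar>) ^ n /\<^sub>R fact n)"
      by (rule summable_exp_generic)
    then show "summable (\<lambda>n. M ^ j * ((M * \<bar>x\<bar>) ^ n /\<^sub>R fact n))" by (rule summable_mult)
    fix n :: nat
    have "\<bar>C (n + j)\<bar> \<le> M ^ (n + j)" unfolding C_def M_def by (rule clamped_coeff_bound)
    then have "\<bar>C (n + j)\<bar> * \<bar>x\<bar> ^ n / fact n \<le> M ^ (n + j) * \<bar>x\<bar> ^ n / fact n"
      by (intro divide_right_mono mult_right_mono) auto
    moreover have "norm (C (n + j) / fact n * x ^ n) = \<bar>C (n + j)\<bar> * \<bar>x\<bar> ^ n / fact n"
      by (simp add: abs_mult power_abs)
    moreover have "M ^ (n + j) * \<bar>x\<bar> ^ n / fact n = M ^ j * ((M * \<bar>x\<bar>) ^ n /\<^sub>R fact n)"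
      by (simp add: power_add power_mult_distrib divide_inverse ac_simps)
    ultimately show "norm (C (n + j) / fact n * x ^ n) \<le> M ^ j * ((M * \<bar>x\<bar>) ^ n /\<^sub>R fact n)"
      by simp
  qed
  have d: "(K j has_real_derivative K (Suc j) x) (at x)" for j x
  proof -
    have "((\<lambda>x. \<Sum>n. (C (n + j) / fact n) * x ^ n) has_real_derivative
        (\<Sum>n. diffs (\<lambda>n. C (n + j) / fact n) n * x ^ n)) (at x)"
      by (rule termdiffs_strong_converges_everywhere[where c = "\<lambda>n. C (n + j) / fact n", OF sm])
    moreover have "diffs (\<lambda>n. C (n + j) / fact n) n = C (n + Suc j) / fact n" for n
      by (simp add: diffs_def fact_Suc del: of_nat_Suc)
    ultimately show ?thesis unfolding K_def[abs_def] by simp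
  qed
  have K0: "K j 0 = C j" for j
    unfolding K_def using powser_zero[of "\<lambda>n. C (n + j) / fact n"] by simp
  have s: "(\<lambda>n. (C (n + j) / fact n) * x ^ n) sums K j x" for j x
    unfolding K_def by (rule summable_sums[OF sm])
  have rec: "K (Suc (Suc (Suc (Suc 0)))) x = \<delta> * K 0 x - 3 * lam * K (Suc (Suc 0)) x" for x
  proof (rule sums_unique2[OF s])
    have "C (n + Suc (Suc (Suc (Suc 0)))) / fact n * x ^ n =
       \<delta> * (C (n + 0) / fact n * x ^ n) - 3 * lam * (C (n + Suc (Suc 0)) / fact n * x ^ n)" for n
      by (simp add: C_def diff_divide_distrib left_diff_distrib)
    then show "(\<lambda>n. C (n + Suc (Suc (Suc (Suc 0)))) / fact n * x ^ n) sums
        (\<delta> * K 0 x - 3 * lam * K (Suc (Suc 0)) x)"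
      by (simp only:) (intro sums_diff sums_mult s)
  qed
  show ?thesis
  proof (rule that)
    show "(K 0 has_real_derivative K (Suc 0) x) (at x)" for x by (rule d)
    show "(K (Suc 0) has_real_derivative K (Suc (Suc 0)) x) (at x)" for x by (rule d)
    show "(K (Suc (Suc 0)) has_real_derivative K (Suc (Suc (Suc 0))) x) (at x)" for x by (rule d)
    show "(K (Suc (Suc (Suc 0))) has_real_derivative \<delta> * K 0 x - 3 * lam * K (Suc (Suc 0)) x) (at x)" for x
      using d[of "Suc (Suc (Suc 0))" x] unfolding rec .
  qed (simp_all add: K0 C_def)
qed

text \<open>Cutting a function off at \<open>s\<close> costs nothing as long as it vanishes there to first order.  The
  fundamental solution vanishes to second order, so its truncation is still twice differentiable.\<close>

lemma has_real_derivative_truncate: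
  fixes k k1 :: "real \<Rightarrow> real"
  assumes "\<And>x. (k has_real_derivative k1 x) (at x)" "k 0 = 0" "k1 0 = 0"
  shows "((\<lambda>x. if x \<le> s then 0 else k (x - s)) has_real_derivative (if x \<le> s then 0 else k1 (x - s))) (at x)"
proof -
  have d: "((\<lambda>x. k (x - s)) has_vector_derivative k1 (x - s)) (at x within T)" for x T
  proof -
    have "((\<lambda>x. k (x - s)) has_real_derivative k1 (x - s) * 1) (at x)"
      by (rule DERIV_chain2[OF assms(1)]) (auto intro!: derivative_eq_intros)
    then show ?thesis
      by (simp add: has_field_derivative_at_within has_real_derivative_iff_has_vector_derivative[symmetric])
  qed
  have "((\<lambda>x. if x \<in> {..s} then 0 else k (x - s)) has_vector_derivative
          (if x \<in> {..s} then 0 else k1 (x - s))) (at x within UNIV)"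
    by (rule has_vector_derivative_If_within_closures[where T = "{s<..}" and f = "\<lambda>_. 0" and
          f' = "\<lambda>_. 0" and g = "\<lambda>x. k (x - s)" and g' = "\<lambda>x. k1 (x - s)"])
       (use assms(2,3) d in \<open>auto simp: not_le\<close>)
  then show ?thesis
    by (simp add: has_real_derivative_iff_has_vector_derivative)
qed

lemma has_real_derivative_zero_on_interval:
  fixes f :: "real \<Rightarrow> real"
  assumes "a < b" "x \<in> {a..b}" "\<And>y. y \<in> {a..b} \<Longrightarrow> f y = 0"
    and "(f has_real_derivative D) (at x within {a..b})"
  shows "D = 0"
proof -
  have "((\<lambda>_. 0) has_real_derivative D) (at x within {a..b})"
    by (rule has_field_derivative_transform_within[OF assms(4) zero_less_one assms(2)]) (use assms(3) in auto)
  then have "((\<lambda>_. 0) has_vector_derivative D) (at x within {a..b})"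
    by (simp add: has_real_derivative_iff_has_vector_derivative)
  moreover have "((\<lambda>_. 0 :: real) has_vector_derivative 0) (at x within {a..b})" by simp
  ultimately show ?thesis
    using vector_derivative_unique_within_closed_interval[of a b x "\<lambda>_. 0::real" D 0] assms(1,2)
    by simp
qed

text \<open>The function \<open>g\<close> is the Green function with pole \<open>s\<close>: the truncated fundamental solution, which
  satisfies the conditions at \<open>a\<close>, plus the combination of the two solutions \<open>k\<close> and \<open>k\<^sub>x\<close>, both of which
  vanish to first order at \<open>a\<close>, that restores the conditions at \<open>b\<close>.  The linear system for the two
  coefficients is singular exactly if some such combination is itself clamped, that is, an eigenfunction.
  The jump of the third derivative at \<open>s\<close> evaluates the test function there.  The bound \<open>M\<close> does not
  depend on \<open>s\<close> because the coefficients are continuous in \<open>s\<close>.\<close>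

lemma clamped_reproducing_kernel:
  assumes "a < b" and noev: "\<not> clamped_eigenvalue lam a b \<delta>"
  obtains M where "M > 0"
    "\<And>s. s \<in> {a<..<b} \<Longrightarrow> \<exists>g g1 g2. clamped a b g g1 g2 \<and> g s \<le> M \<and>
        (\<forall>z z1 z2. clamped a b z z1 z2 \<longrightarrow> clamped_form lam \<delta> a b g g1 g2 z z1 z2 = z s)"
proof -
  obtain k k1 k2 k3 :: "real \<Rightarrow> real" where
    k: "\<And>x. (k has_real_derivative k1 x) (at x)" and
    k1: "\<And>x. (k1 has_real_derivative k2 x) (at x)" and
    k2: "\<And>x. (k2 has_real_derivative k3 x) (at x)" and
    k3: "\<And>x. (k3 has_real_derivative \<delta> * k x - 3 * lam * k2 x) (at x)" and
    k0: "k 0 = 0" "k1 0 = 0" "k2 0 = 0" "k3 0 = 1"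
    using clamped_ode_fundamental_solution[of \<delta> lam] by blast
  have sh: "((\<lambda>x. f (x - c)) has_real_derivative f' (x - c)) (at x within S)"
    if "\<And>x. (f has_real_derivative f' x) (at x)" for f f' :: "real \<Rightarrow> real" and x c S
  proof -
    have "((\<lambda>x. f (x - c)) has_real_derivative f' (x - c) * 1) (at x)"
      by (rule DERIV_chain2[OF that]) (auto intro!: derivative_eq_intros)
    then show ?thesis by (simp add: has_field_derivative_at_within)
  qed
  note K = sh[OF k] sh[OF k1] sh[OF k2] sh[of k3 "\<lambda>x. \<delta> * k x - 3 * lam * k2 x", OF k3]
  have cont: "continuous_on S k" "continuous_on S k1" "continuous_on S k2" "continuous_on S k3" for S
    by (meson DERIV_continuous_on has_field_derivative_at_within k k1 k2 k3)+
  define l where "l = b - a"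
  \<comment> \<open>Determinant of the conditions at \<open>b\<close> for the solutions \<open>k\<close> and \<open>k\<^sub>x\<close> shifted to \<open>a\<close>.\<close>
  define W where "W = k l * k2 l - (k1 l)\<^sup>2"
  have W: "W \<noteq> 0"
  proof
    assume W0: "W = 0"
    obtain c1 c2 where c: "c1 * k l + c2 * k1 l = 0" "c1 * k1 l + c2 * k2 l = 0" "c1 \<noteq> 0 \<or> c2 \<noteq> 0"
    proof (cases "k l = 0 \<and> k1 l = 0")
      case True then show ?thesis by (intro that[of 1 0]) auto
    next
      case False then show ?thesis using W0 unfolding W_def
        by (intro that[of "- k1 l" "k l"]) (auto simp: power2_eq_square algebra_simps)
    qed
    define z where "z x = c1 * k (x - a) + c2 * k1 (x - a)" for x
    define z1 where "z1 x = c1 * k1 (x - a) + c2 * k2 (x - a)" for x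
    define z2 where "z2 x = c1 * k2 (x - a) + c2 * k3 (x - a)" for x
    define z3 where "z3 x = c1 * k3 (x - a) + c2 * (\<delta> * k (x - a) - 3 * lam * k2 (x - a))" for x
    have d: "(z has_real_derivative z1 x) (at x within {a..b})"
            "(z1 has_real_derivative z2 x) (at x within {a..b})"
            "(z2 has_real_derivative z3 x) (at x within {a..b})"
            "(z3 has_real_derivative (\<delta> * z x - 3 * lam * z2 x)) (at x within {a..b})" for x
      unfolding z_def z1_def z2_def z3_def
      by ((rule derivative_eq_intros K refl)+, (simp add: algebra_simps)?)+
    have bc: "z a = 0" "z b = 0" "z1 a = 0" "z1 b = 0"
      using c k0 by (auto simp: z_def z1_def l_def)
    have "\<exists>x\<in>{a..b}. z x \<noteq> 0"
    proof (rule ccontr)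
      assume "\<not> ?thesis"
      then have z0: "z x = 0" if "x \<in> {a..b}" for x using that by blast
      have z10: "z1 x = 0" if "x \<in> {a..b}" for x
        using has_real_derivative_zero_on_interval[OF assms(1) that z0 d(1)] .
      have z20: "z2 x = 0" if "x \<in> {a..b}" for x
        using has_real_derivative_zero_on_interval[OF assms(1) that z10 d(2)] .
      have "z3 x = 0" if "x \<in> {a..b}" for x
        using has_real_derivative_zero_on_interval[OF assms(1) that z20 d(3)] .
      then have "z2 a = 0" "z3 a = 0" using z20 assms(1) by auto
      then have "c2 = 0" "c1 = 0" using k0 by (auto simp: z2_def z3_def)
      then show False using c(3) by simp
    qed
    then have "clamped_eigenvalue lam a b \<delta>"
      unfolding clamped_eigenvalue_def using d bc by blast
    then show False using noev by simp
  qed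
  \<comment> \<open>Cramer's rule.\<close>
  define c1 where "c1 s = (k1 (b - s) * k1 l - k (b - s) * k2 l) / W" for s
  define c2 where "c2 s = (k (b - s) * k1 l - k1 (b - s) * k l) / W" for s
  have c: "k (b - s) + c1 s * k l + c2 s * k1 l = 0" "k1 (b - s) + c1 s * k1 l + c2 s * k2 l = 0" for s
    using W by (simp_all add: c1_def c2_def field_simps)
       (simp_all add: W_def power2_eq_square algebra_simps)
  \<comment> \<open>The value \<open>g s\<close>: the truncated part vanishes at its pole.\<close>
  define m where "m s = c1 s * k (s - a) + c2 s * k1 (s - a)" for s
  have "continuous_on {a..b} m"
    unfolding m_def c1_def c2_def
    by (intro continuous_intros continuous_on_compose2[OF cont(1)] continuous_on_compose2[OF cont(2)])
       (use W in auto)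
  then have "\<exists>s0\<in>{a..b}. \<forall>s\<in>{a..b}. m s \<le> m s0"
    using assms(1) by (intro continuous_attains_sup) auto
  then obtain s0 where s0: "\<And>s. s \<in> {a..b} \<Longrightarrow> m s \<le> m s0" by blast
  show ?thesis
  proof (rule that[of "max 1 (m s0)"])
    fix s assume s: "s \<in> {a<..<b}"
    define p where "p f x = (if x \<le> s then 0 else f (x - s))" for f :: "real \<Rightarrow> real" and x
    define g where "g x = p k x + c1 s * k (x - a) + c2 s * k1 (x - a)" for x
    define g1 where "g1 x = p k1 x + c1 s * k1 (x - a) + c2 s * k2 (x - a)" for x
    define g2 where "g2 x = p k2 x + c1 s * k2 (x - a) + c2 s * k3 (x - a)" for x
    have pd: "(p k has_real_derivative p k1 x) (at x within S)" "(p k1 has_real_derivative p k2 x) (at x within S)" for x S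
      unfolding p_def[abs_def]
      by (rule has_field_derivative_at_within,
          rule has_real_derivative_truncate[OF k k0(1,2)] has_real_derivative_truncate[OF k1 k0(2,3)])+
    have pc: "continuous_on {a..b} (p k2)"
    proof -
      have "p k2 = (\<lambda>x. k2 (max 0 (x - s)))" unfolding p_def using k0 by (auto simp: max_def)
      then show ?thesis
        by (simp add: continuous_on_compose2[OF cont(3)[of UNIV]] continuous_intros)
    qed
    have gc: "clamped a b g g1 g2"
      unfolding clamped_def
    proof (intro conjI ballI)
      fix x
      show "(g has_real_derivative g1 x) (at x within {a..b})" "(g1 has_real_derivative g2 x) (at x within {a..b})"
        unfolding g_def g1_def g2_def by ((rule derivative_eq_intros pd K refl)+, simp)+
      show "continuous_on {a..b} g2" unfolding g2_def
        by (intro continuous_intros pc continuous_on_compose2[OF cont(3)[of UNIV]]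
             continuous_on_compose2[OF cont(4)[of UNIV]]) auto
      show "g a = 0" "g1 a = 0" using s k0 by (auto simp: g_def g1_def p_def)
      show "g b = 0" "g1 b = 0" using s c[of s] by (auto simp: g_def g1_def p_def l_def)
    qed
    have "clamped_form lam \<delta> a b g g1 g2 z z1 z2 = z s" if z: "clamped a b z z1 z2" for z z1 z2
    proof -
      define E where "E h h1 h2 x = h2 x * z2 x - 3 * lam * (h1 x * z1 x) - \<delta> * (h x * z x)"
        for h h1 h2 :: "real \<Rightarrow> real" and x
      have zd: "(z has_real_derivative z1 x) (at x within {c..d})"
               "(z1 has_real_derivative z2 x) (at x within {c..d})" if "x \<in> {c..d}" "{c..d} \<subseteq> {a..b}" for x c d
        using z that unfolding clamped_def by (meson DERIV_subset subsetD)+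
      have bc: "z a = 0" "z b = 0" "z1 a = 0" "z1 b = 0" using z unfolding clamped_def by auto
      have i1: "(E (\<lambda>x. k (x - a)) (\<lambda>x. k1 (x - a)) (\<lambda>x. k2 (x - a)) has_integral 0) {a..b}"
        using clamped_ode_weak_form[where c = a and d = b and y = z and ?y1.0 = z1 and ?y2.0 = z2, OF _ K(1) K(2) K(3) K(4)]
          assms(1) zd bc unfolding E_def by simp
      have i2: "(E (\<lambda>x. k1 (x - a)) (\<lambda>x. k2 (x - a)) (\<lambda>x. k3 (x - a)) has_integral 0) {a..b}"
      proof -
        have "((\<lambda>x. \<delta> * k (x - a) - 3 * lam * k2 (x - a)) has_real_derivative
            \<delta> * k1 (x - a) - 3 * lam * k3 (x - a)) (at x within S)" for x S
          by (rule derivative_eq_intros K refl)+ simp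
        from clamped_ode_weak_form[where c = a and d = b and y = z and ?y1.0 = z1 and ?y2.0 = z2, OF _ K(2) K(3) K(4) this]
        show ?thesis using assms(1) zd bc unfolding E_def by simp
      qed
      have "(E (\<lambda>x. k (x - s)) (\<lambda>x. k1 (x - s)) (\<lambda>x. k2 (x - s)) has_integral z s) {s..b}"
        using clamped_ode_weak_form[where c = s and d = b and y = z and ?y1.0 = z1 and ?y2.0 = z2,
            OF _ K(1)[where c = s] K(2)[where c = s] K(3)[where c = s] K(4)[where c = s]]
          s zd bc k0 unfolding E_def by simp
      then have "(E (p k) (p k1) (p k2) has_integral z s) {s..b}"
        by (rule has_integral_eq[rotated]) (auto simp: E_def p_def k0)
      moreover have "(E (p k) (p k1) (p k2) has_integral 0) {a..s}"
        by (rule has_integral_is_0) (auto simp: E_def p_def)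
      ultimately have i3: "(E (p k) (p k1) (p k2) has_integral z s) {a..b}"
        using has_integral_combine[of a s b "E (p k) (p k1) (p k2)" 0 "z s"] s by simp
      have "E g g1 g2 = (\<lambda>x. E (p k) (p k1) (p k2) x + c1 s * E (\<lambda>x. k (x - a)) (\<lambda>x. k1 (x - a)) (\<lambda>x. k2 (x - a)) x
           + c2 s * E (\<lambda>x. k1 (x - a)) (\<lambda>x. k2 (x - a)) (\<lambda>x. k3 (x - a)) x)"
        by (rule ext) (simp add: E_def g_def g1_def g2_def algebra_simps)
      then have "(E g g1 g2 has_integral z s + c1 s * 0 + c2 s * 0) {a..b}"
        by (simp only:) (intro has_integral_add has_integral_mult_right i1 i2 i3)
      then have "integral {a..b} (E g g1 g2) = z s" by (simp add: integral_unique)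
      then show ?thesis unfolding clamped_form_def E_def .
    qed
    moreover have "g s \<le> max 1 (m s0)"
    proof -
      have "g s = m s" by (simp add: g_def m_def p_def)
      then show ?thesis using s0[of s] s by auto
    qed
    ultimately show "\<exists>g g1 g2. clamped a b g g1 g2 \<and> g s \<le> max 1 (m s0) \<and>
        (\<forall>z z1 z2. clamped a b z z1 z2 \<longrightarrow> clamped_form lam \<delta> a b g g1 g2 z z1 z2 = z s)"
      using gc by blast
  qed simp
qed

text \<open>A nonnegative form with a reproducing kernel bounds point values, by the Cauchy-Schwarz argument: the
  form is nonnegative on \<open>z - r g\<close> for all \<open>r\<close>.  Integrating \<open>z(s)\<^sup>2 \<le> M Q(z)\<close> over \<open>s\<close> gives coercivity
  in \<open>L\<^sup>2\<close>.\<close>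

lemma clamped_form_coercive:
  assumes "a < b" "\<not> clamped_eigenvalue lam a b \<delta>"
    and nonneg: "\<And>z z1 z2. clamped a b z z1 z2 \<Longrightarrow> 0 \<le> clamped_form lam \<delta> a b z z1 z2 z z1 z2"
  obtains c where "c > 0" "\<And>z z1 z2. clamped a b z z1 z2 \<Longrightarrow>
     c * integral {a..b} (\<lambda>x. (z x)\<^sup>2) \<le> clamped_form lam \<delta> a b z z1 z2 z z1 z2"
proof -
  obtain M where M: "M > 0" and
    rep: "\<And>s. s \<in> {a<..<b} \<Longrightarrow> \<exists>g g1 g2. clamped a b g g1 g2 \<and> g s \<le> M \<and>
        (\<forall>z z1 z2. clamped a b z z1 z2 \<longrightarrow> clamped_form lam \<delta> a b g g1 g2 z z1 z2 = z s)"
    using clamped_reproducing_kernel[OF assms(1,2)] by blast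
  show ?thesis
  proof (rule that[of "1 / (M * (b - a))"])
    show "1 / (M * (b - a)) > 0" using M assms(1) by simp
    fix z z1 z2 assume z: "clamped a b z z1 z2"
    let ?Q = "clamped_form lam \<delta> a b z z1 z2 z z1 z2"
    have pt: "(z s)\<^sup>2 \<le> M * ?Q" if s: "s \<in> {a..b}" for s
    proof (cases "s \<in> {a<..<b}")
      case True
      then obtain g g1 g2 where g: "clamped a b g g1 g2" "g s \<le> M"
        and r: "\<And>z z1 z2. clamped a b z z1 z2 \<Longrightarrow> clamped_form lam \<delta> a b g g1 g2 z z1 z2 = z s"
        using rep[OF True] by blast
      \<comment> \<open>The minimiser of \<open>Q + 2 r z(s) + r\<^sup>2 M\<close>.\<close>
      let ?r = "- (z s / M)"
      have "0 \<le> ?Q + 2 * ?r * z s + ?r\<^sup>2 * g s"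
        using nonneg[OF clamped_lincomb[OF z g(1), of ?r]]
        unfolding clamped_form_quadratic[OF z g(1)] r[OF z] r[OF g(1)] .
      also have "\<dots> \<le> ?Q + 2 * ?r * z s + ?r\<^sup>2 * M"
        using g(2) by (intro add_left_mono mult_left_mono) auto
      finally have "0 \<le> ?Q - (z s)\<^sup>2 / M"
        using M by (simp add: power2_eq_square field_simps)
      then show ?thesis using M by (simp add: field_simps)
    next
      case False
      then have "z s = 0" using s z unfolding clamped_def by force
      then show ?thesis using M nonneg[OF z] by simp
    qed
    have "integral {a..b} (\<lambda>x. (z x)\<^sup>2) \<le> integral {a..b} (\<lambda>x. M * ?Q)"
      by (intro integral_le integrable_continuous_real continuous_intros clamped_continuous[OF z] pt)
    also have "\<dots> = M * (b - a) * ?Q" using assms(1) by simp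
    finally show "1 / (M * (b - a)) * integral {a..b} (\<lambda>x. (z x)\<^sup>2) \<le> ?Q"
      using M assms(1) by (simp add: field_simps)
  qed
qed

lemma clamped_square_integral_pos:
  assumes "a < b" "clamped a b z z1 z2" "x \<in> {a..b}" "z x \<noteq> 0"
  shows "0 < integral {a..b} (\<lambda>x. (z x)\<^sup>2)"
proof -
  have c: "continuous_on {a..b} (\<lambda>x. (z x)\<^sup>2)"
    by (intro continuous_intros clamped_continuous[OF assms(2)])
  have "integral {a..b} (\<lambda>x. (z x)\<^sup>2) \<noteq> 0"
    using integral_eq_0_iff[OF c assms(1)] assms(3,4) by auto
  moreover have "0 \<le> integral {a..b} (\<lambda>x. (z x)\<^sup>2)"
    by (intro integral_nonneg integrable_continuous_real c) auto
  ultimately show ?thesis by simp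
qed

lemma clamped_eigenfunction_form:
  assumes "a < b" "clamped_eigenvalue lam a b \<delta>"
  obtains z z1 z2 where "clamped a b z z1 z2" "0 < integral {a..b} (\<lambda>x. (z x)\<^sup>2)"
    "clamped_form lam \<delta> a b z z1 z2 z z1 z2 = 0"
proof -
  obtain z z1 z2 z3 where d: "\<And>x. x \<in> {a..b} \<Longrightarrow> (z has_real_derivative z1 x) (at x within {a..b})"
          "\<And>x. x \<in> {a..b} \<Longrightarrow> (z1 has_real_derivative z2 x) (at x within {a..b})"
          "\<And>x. x \<in> {a..b} \<Longrightarrow> (z2 has_real_derivative z3 x) (at x within {a..b})"
          "\<And>x. x \<in> {a..b} \<Longrightarrow> (z3 has_real_derivative (\<delta> * z x - 3 * lam * z2 x)) (at x within {a..b})"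
     and bc: "z a = 0" "z b = 0" "z1 a = 0" "z1 b = 0" and nz: "\<exists>x\<in>{a..b}. z x \<noteq> 0"
    using assms(2) unfolding clamped_eigenvalue_def by blast
  have c: "clamped a b z z1 z2"
    unfolding clamped_def using d bc DERIV_continuous_on[OF d(3)] by auto
  show ?thesis
  proof (rule that[OF c])
    show "0 < integral {a..b} (\<lambda>x. (z x)\<^sup>2)"
      using clamped_square_integral_pos[OF assms(1) c] nz by blast
    show "clamped_form lam \<delta> a b z z1 z2 z z1 z2 = 0"
      using clamped_ode_weak_form[OF less_imp_le[OF assms(1)] d d(1,2)] bc
      unfolding clamped_form_def by (simp add: integral_unique)
  qed
qed

text \<open>A nonzero clamped function bounds the values of \<open>\<delta>\<close> that are admissible in the Rayleigh inequality.\<close>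

lemma clamped_nontrivial:
  assumes "a < b"
  obtains z z1 z2 where "clamped a b z z1 z2" "0 < integral {a..b} (\<lambda>x. (z x)\<^sup>2)"
proof -
  define z where "z x = (x - a)\<^sup>2 * (x - b)\<^sup>2" for x
  define z1 where "z1 x = 2 * (x - a) * (x - b)\<^sup>2 + 2 * (x - a)\<^sup>2 * (x - b)" for x
  define z2 where "z2 x = 2 * (x - b)\<^sup>2 + 8 * (x - a) * (x - b) + 2 * (x - a)\<^sup>2" for x
  have c: "clamped a b z z1 z2"
    unfolding clamped_def
  proof (intro conjI ballI)
    fix x
    show "(z has_real_derivative z1 x) (at x within {a..b})" "(z1 has_real_derivative z2 x) (at x within {a..b})"
      unfolding z_def z1_def z2_def
      by (auto intro!: derivative_eq_intros simp: power2_eq_square algebra_simps)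
    show "continuous_on {a..b} z2" unfolding z2_def by (intro continuous_intros)
  qed (auto simp: z_def z1_def)
  have "z ((a + b) / 2) \<noteq> 0" using assms by (simp add: z_def)
  then have "0 < integral {a..b} (\<lambda>x. (z x)\<^sup>2)"
    using clamped_square_integral_pos[OF assms c, of "(a + b) / 2"] assms by auto
  then show ?thesis using c that by blast
qed

text \<open>Let \<open>S\<close> be the set of all \<open>\<delta>\<close> for which the inequality holds.  It is bounded above and contains its
  supremum.  The supremum is an eigenvalue, since otherwise coercivity would put a larger number into \<open>S\<close>.
  No smaller number is an eigenvalue, since an eigenfunction annihilates its own form.  So the least
  eigenvalue exists and equals \<open>Sup S\<close>.\<close>

theorem delta_o_Rayleigh:
  assumes "a < b" "lam \<ge> 0" "\<delta> \<le> delta_o lam a b" "clamped a b z z1 z2"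
  shows "\<delta> * integral {a..b} (\<lambda>x. (z x)\<^sup>2) \<le>
           integral {a..b} (\<lambda>x. (z2 x)\<^sup>2) - 3 * lam * integral {a..b} (\<lambda>x. (z1 x)\<^sup>2)"
proof -
  define S where "S = {d. \<forall>z z1 z2. clamped a b z z1 z2 \<longrightarrow>
     d * integral {a..b} (\<lambda>x. (z x)\<^sup>2) \<le> clamped_form lam 0 a b z z1 z2 z z1 z2}"
  have S_I: "d \<in> S" if "\<And>z z1 z2. clamped a b z z1 z2 \<Longrightarrow>
     d * integral {a..b} (\<lambda>x. (z x)\<^sup>2) \<le> clamped_form lam 0 a b z z1 z2 z z1 z2" for d
    using that unfolding S_def by blast
  have S_D: "d * integral {a..b} (\<lambda>x. (z x)\<^sup>2) \<le> clamped_form lam 0 a b z z1 z2 z z1 z2"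
    if "d \<in> S" "clamped a b z z1 z2" for d z z1 z2
    using that unfolding S_def by blast
  have z2n: "0 \<le> integral {a..b} (\<lambda>x. (z x)\<^sup>2)" if "clamped a b z z1 z2" for z z1 z2
    by (intro integral_nonneg integrable_continuous_real continuous_intros clamped_continuous[OF that]) auto
  \<comment> \<open>Since \<open>\<integral> z\<^sub>x\<^sup>2 = - \<integral> z z\<^sub>x\<^sub>x\<close>, the inequality for this value says that the integral of
    \<open>(z\<^sub>x\<^sub>x + 3 \<lambda> z / 2)\<^sup>2\<close> is nonnegative.\<close>
  have "- (9 * lam\<^sup>2 / 4) \<in> S"
  proof (rule S_I)
    fix z z1 z2 assume z: "clamped a b z z1 z2"
    note c = clamped_continuous[OF z]
    have "((\<lambda>x. z1 x * z1 x + z x * z2 x) has_integral z b * z1 b - z a * z1 a) {a..b}"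
    proof (rule fundamental_theorem_of_calculus)
      show "((\<lambda>x. z x * z1 x) has_vector_derivative z1 x * z1 x + z x * z2 x) (at x within {a..b})"
        if "x \<in> {a..b}" for x
        using z that unfolding clamped_def has_real_derivative_iff_has_vector_derivative[symmetric]
        by (auto intro!: derivative_eq_intros)
    qed (use assms(1) in simp)
    then have 0: "((\<lambda>x. z1 x * z1 x + z x * z2 x) has_integral 0) {a..b}"
      using z by (simp add: clamped_def)
    have "((\<lambda>x. (z2 x * z2 x - 3 * lam * (z1 x * z1 x) + 9 * lam\<^sup>2 / 4 * (z x)\<^sup>2) + 3 * lam * (z1 x * z1 x + z x * z2 x))
       has_integral (integral {a..b} (\<lambda>x. z2 x * z2 x - 3 * lam * (z1 x * z1 x)) +
          9 * lam\<^sup>2 / 4 * integral {a..b} (\<lambda>x. (z x)\<^sup>2)) + 3 * lam * 0) {a..b}"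
      by (intro has_integral_add has_integral_mult_right 0 integrable_integral
            integrable_continuous_real continuous_intros c)
    moreover have "(z2 x * z2 x - 3 * lam * (z1 x * z1 x) + 9 * lam\<^sup>2 / 4 * (z x)\<^sup>2) + 3 * lam * (z1 x * z1 x + z x * z2 x)
       = (z2 x + 3 * lam / 2 * z x)\<^sup>2" for x
      by (simp add: power2_eq_square algebra_simps)
    ultimately have "0 \<le> integral {a..b} (\<lambda>x. z2 x * z2 x - 3 * lam * (z1 x * z1 x)) +
          9 * lam\<^sup>2 / 4 * integral {a..b} (\<lambda>x. (z x)\<^sup>2)"
      by (simp only:) (drule has_integral_nonneg, auto)
    then show "- (9 * lam\<^sup>2 / 4) * integral {a..b} (\<lambda>x. (z x)\<^sup>2) \<le> clamped_form lam 0 a b z z1 z2 z z1 z2"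
      by (simp add: clamped_form_def)
  qed
  then have ne: "S \<noteq> {}" by blast
  have bdd: "bdd_above S"
  proof -
    obtain z z1 z2 where z: "clamped a b z z1 z2" "0 < integral {a..b} (\<lambda>x. (z x)\<^sup>2)"
      using clamped_nontrivial[OF assms(1)] by blast
    show ?thesis
      by (rule bdd_aboveI[of _ "clamped_form lam 0 a b z z1 z2 z z1 z2 / integral {a..b} (\<lambda>x. (z x)\<^sup>2)"])
         (use z in \<open>auto simp: S_def field_simps\<close>)
  qed
  have SupS: "Sup S \<in> S"
  proof (rule S_I)
    fix z z1 z2 assume z: "clamped a b z z1 z2"
    show "Sup S * integral {a..b} (\<lambda>x. (z x)\<^sup>2) \<le> clamped_form lam 0 a b z z1 z2 z z1 z2"
    proof (cases "integral {a..b} (\<lambda>x. (z x)\<^sup>2) = 0")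
      case True
      from ne obtain d where "d \<in> S" by blast
      then have "d * integral {a..b} (\<lambda>x. (z x)\<^sup>2) \<le> clamped_form lam 0 a b z z1 z2 z z1 z2"
        using z unfolding S_def by blast
      then show ?thesis using True by simp
    next
      case False
      then have p: "0 < integral {a..b} (\<lambda>x. (z x)\<^sup>2)" using z2n[OF z] by simp
      have "Sup S \<le> clamped_form lam 0 a b z z1 z2 z z1 z2 / integral {a..b} (\<lambda>x. (z x)\<^sup>2)"
        by (rule cSup_least[OF ne]) (use z p in \<open>auto simp: S_def field_simps\<close>)
      then show ?thesis using p by (simp add: field_simps)
    qed
  qed
  have "delta_o lam a b = Sup S"
    unfolding delta_o_def
  proof (rule Least_equality)
    show "clamped_eigenvalue lam a b (Sup S)"
    proof (rule ccontr)
      assume "\<not> ?thesis"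
      moreover have "0 \<le> clamped_form lam (Sup S) a b z z1 z2 z z1 z2" if "clamped a b z z1 z2" for z z1 z2
        using S_D[OF SupS that] unfolding clamped_form_shift[OF that, of lam "Sup S"] by simp
      ultimately obtain c where c: "c > 0" "\<And>z z1 z2. clamped a b z z1 z2 \<Longrightarrow>
           c * integral {a..b} (\<lambda>x. (z x)\<^sup>2) \<le> clamped_form lam (Sup S) a b z z1 z2 z z1 z2"
        using clamped_form_coercive[OF assms(1)] by blast
      have "Sup S + c \<in> S"
      proof (rule S_I)
        fix z z1 z2 assume z: "clamped a b z z1 z2"
        show "(Sup S + c) * integral {a..b} (\<lambda>x. (z x)\<^sup>2) \<le> clamped_form lam 0 a b z z1 z2 z z1 z2"
          using c(2)[OF z] unfolding clamped_form_shift[OF z, of lam "Sup S"]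
          by (simp add: algebra_simps)
      qed
      then have "Sup S + c \<le> Sup S" using bdd by (rule cSup_upper)
      then show False using c(1) by simp
    qed
    fix d assume "clamped_eigenvalue lam a b d"
    then obtain z z1 z2 where z: "clamped a b z z1 z2" "0 < integral {a..b} (\<lambda>x. (z x)\<^sup>2)"
      "clamped_form lam d a b z z1 z2 z z1 z2 = 0"
      using clamped_eigenfunction_form[OF assms(1)] by blast
    have "Sup S * integral {a..b} (\<lambda>x. (z x)\<^sup>2) \<le> clamped_form lam 0 a b z z1 z2 z z1 z2"
      by (rule S_D[OF SupS z(1)])
    also have "\<dots> = d * integral {a..b} (\<lambda>x. (z x)\<^sup>2)"
      using z(3) unfolding clamped_form_shift[OF z(1), of lam d] by simp
    finally show "Sup S \<le> d" using z(2) by simp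
  qed
  with assms(3) have "\<delta> * integral {a..b} (\<lambda>x. (z x)\<^sup>2) \<le> Sup S * integral {a..b} (\<lambda>x. (z x)\<^sup>2)"
    using z2n[OF assms(4)] by (intro mult_right_mono) auto
  also have "\<dots> \<le> clamped_form lam 0 a b z z1 z2 z z1 z2"
    by (rule S_D[OF SupS assms(4)])
  also have "\<dots> = integral {a..b} (\<lambda>x. (z2 x)\<^sup>2) - 3 * lam * integral {a..b} (\<lambda>x. (z1 x)\<^sup>2)"
  proof -
    note c = clamped_continuous[OF assms(4)]
    have "integral {a..b} (\<lambda>x. (z2 x)\<^sup>2 - 3 * lam * (z1 x)\<^sup>2) =
       integral {a..b} (\<lambda>x. (z2 x)\<^sup>2) - integral {a..b} (\<lambda>x. 3 * lam * (z1 x)\<^sup>2)"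
      by (intro integral_diff integrable_continuous_real continuous_intros c)
    then show ?thesis by (simp add: clamped_form_def power2_eq_square)
  qed
  finally show ?thesis .
qed

section \<open>Differentiation almost everywhere on the line\<close>

text \<open>If disjoint intervals of \<open>P\<close> have total length at most \<open>B\<close>, and \<open>P\<close> contains arbitrarily short intervals
  around each point of \<open>E\<close>, then the outer measure of \<open>E\<close> is at most \<open>B\<close>.  Applied to intervals on which
  some approximation fails, this turns a bound on sums of errors into a statement about almost every point.\<close>

lemma Vitali_interval_cover:
  fixes E :: "real set" and P :: "(real \<times> real) set"
  assumes cover: "\<And>x d. x \<in> E \<Longrightarrow> d > 0 \<Longrightarrow> \<exists>u v. (u, v) \<in> P \<and> u < v \<and> u \<le> x \<and> x \<le> v \<and> v - u < d"
    and bound: "\<And>F. finite F \<Longrightarrow> F \<subseteq> P \<Longrightarrow> (\<And>u v. (u, v) \<in> F \<Longrightarrow> u < v) \<Longrightarrow>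
        pairwise (\<lambda>p q. disjnt {fst p..snd p} {fst q..snd q}) F \<Longrightarrow> (\<Sum>p\<in>F. snd p - fst p) \<le> B"
  obtains T where "E \<subseteq> T" "T \<in> lmeasurable" "measure lebesgue T \<le> B"
proof -
  define K where "K = {p \<in> P. fst p < snd p}"
  define a where "a p = (fst p + snd p) / 2" for p :: "real \<times> real"
  define r where "r p = (snd p - fst p) / 2" for p :: "real \<times> real"
  have cb: "cball (a p) (r p) = {fst p..snd p}" for p
    by (simp add: cball_eq_atLeastAtMost a_def r_def field_simps)
  obtain C where C: "countable C" "C \<subseteq> K"
     "pairwise (\<lambda>i j. disjnt (cball (a i) (r i)) (cball (a j) (r j))) C"
     "negligible (E - (\<Union>i \<in> C. cball (a i) (r i)))"
  proof (rule Vitali_covering_theorem_cballs[of K r E a])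
    show "0 < r i" if "i \<in> K" for i using that by (auto simp: K_def r_def)
    fix x d :: real assume "x \<in> E" "0 < d"
    then obtain u v where "(u, v) \<in> P" "u < v" "u \<le> x" "x \<le> v" "v - u < d" using cover by blast
    then show "\<exists>i. i \<in> K \<and> x \<in> cball (a i) (r i) \<and> r i < d"
      unfolding cb by (intro exI[of _ "(u, v)"]) (auto simp: K_def r_def)
  qed (rule that)
  have fin_bound: "measure lebesgue (\<Union>p\<in>F. {fst p..snd p}) \<le> B" if F: "F \<subseteq> C" "finite F" for F
  proof -
    have "measure lebesgue (\<Union>p\<in>F. {fst p..snd p}) \<le> (\<Sum>p\<in>F. measure lebesgue {fst p..snd p})"
      by (rule measure_UNION_le[OF F(2)]) simp
    also have "\<dots> = (\<Sum>p\<in>F. snd p - fst p)"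
    proof (rule sum.cong)
      fix p assume "p \<in> F"
      then have "fst p < snd p" using F C(2) by (auto simp: K_def)
      then show "measure lebesgue {fst p..snd p} = snd p - fst p" by simp
    qed simp
    also have "\<dots> \<le> B"
    proof (rule bound)
      show "pairwise (\<lambda>p q. disjnt {fst p..snd p} {fst q..snd q}) F"
        using pairwise_subset[OF C(3) F(1)] by (simp add: cb)
    qed (use F C(2) in \<open>auto simp: K_def\<close>)
    finally show ?thesis .
  qed
  have "{fst p..snd p} \<in> lmeasurable" for p :: "real \<times> real" by simp
  note U = fmeasurable_UN_bound[OF C(1) this fin_bound] measure_UN_bound[OF C(1) this fin_bound]
  let ?U = "\<Union>p\<in>C. {fst p..snd p}"
  let ?N = "E - ?U"
  have N: "?N \<in> null_sets lebesgue" using C(4) by (simp add: negligible_iff_null_sets cb)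
  show ?thesis
  proof (rule that[of "?U \<union> ?N"])
    show "?U \<union> ?N \<in> lmeasurable" using U N by (intro fmeasurable.Un) (auto intro: fmeasurableI_null_sets)
    show "measure lebesgue (?U \<union> ?N) \<le> B"
      using U N by (subst measure_Un_null_set) (auto simp: fmeasurableD)
  qed auto
qed

text \<open>Families indexed by a finite set, so that tagged divisions and Vitali families can be used as they are.\<close>

lemma locally_AC_finite_family:
  assumes "locally_AC d D f" "\<alpha> \<le> \<beta>" "{\<alpha>..\<beta>} \<subseteq> D" "\<epsilon> > 0"
  shows "\<exists>\<eta>>0. \<forall>(P::'i set) r s. finite P \<longrightarrow> (\<forall>p\<in>P. \<alpha> \<le> r p \<and> r p \<le> s p \<and> s p \<le> \<beta>) \<longrightarrow>
       (\<forall>p\<in>P. \<forall>q\<in>P. p \<noteq> q \<longrightarrow> {r p<..<s p} \<inter> {r q<..<s q} = {}) \<longrightarrow>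
       (\<Sum>p\<in>P. s p - r p) < \<eta> \<longrightarrow> (\<Sum>p\<in>P. d (f (r p)) (f (s p))) < \<epsilon>"
proof -
  obtain \<eta> where \<eta>: "\<eta> > 0" and H: "\<And>(n::nat) r s.
          (\<forall>i<n. \<alpha> \<le> r i \<and> r i \<le> s i \<and> s i \<le> \<beta>) \<and>
          (\<forall>i<n. \<forall>j<n. i \<noteq> j \<longrightarrow> {r i<..<s i} \<inter> {r j<..<s j} = {}) \<and>
          (\<Sum>i<n. s i - r i) < \<eta> \<Longrightarrow>
          (\<Sum>i<n. d (f (r i)) (f (s i))) < \<epsilon>"
    using assms(1)[unfolded locally_AC_def, THEN spec, THEN spec, THEN mp, OF conjI[OF assms(2,3)],
        THEN spec, THEN mp, OF assms(4)]
    by (elim exE conjE) (rule that, assumption, blast)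
  show ?thesis
  proof (intro exI[of _ \<eta>] conjI \<eta> allI impI)
    fix P :: "'i set" and r s
    assume P: "finite P" "\<forall>p\<in>P. \<alpha> \<le> r p \<and> r p \<le> s p \<and> s p \<le> \<beta>"
       "\<forall>p\<in>P. \<forall>q\<in>P. p \<noteq> q \<longrightarrow> {r p<..<s p} \<inter> {r q<..<s q} = {}"
       "(\<Sum>p\<in>P. s p - r p) < \<eta>"
    obtain h where h: "bij_betw h {0..<card P} P"
      using ex_bij_betw_nat_finite[OF P(1)] by blast
    then have h': "bij_betw h {..<card P} P" by (simp add: atLeast0LessThan)
    have mem: "h i \<in> P" if "i < card P" for i using h' that by (auto dest: bij_betw_apply)
    have inj: "h i \<noteq> h j" if "i < card P" "j < card P" "i \<noteq> j" for i j
      using h' that unfolding bij_betw_def inj_on_def by auto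
    have "(\<Sum>i<card P. d (f (r (h i))) (f (s (h i)))) < \<epsilon>"
    proof (rule H, intro conjI allI impI)
      show "(\<Sum>i<card P. s (h i) - r (h i)) < \<eta>"
        using P(4) sum.reindex_bij_betw[OF h', of "\<lambda>p. s p - r p"] by simp
    qed (use P(2,3) mem inj in auto)
    then show "(\<Sum>p\<in>P. d (f (r p)) (f (s p))) < \<epsilon>"
      using sum.reindex_bij_betw[OF h', of "\<lambda>p. d (f (r p)) (f (s p))"] by simp
  qed
qed

lemma tagged_division_interval_endpoints:
  fixes p :: "(real \<times> real set) set"
  assumes p: "p tagged_division_of {\<alpha>..\<beta>}" and xK: "xK \<in> p"
  shows "\<alpha> \<le> Inf (snd xK)" "Inf (snd xK) \<le> fst xK" "fst xK \<le> Sup (snd xK)" "Sup (snd xK) \<le> \<beta>"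
    "snd xK = {Inf (snd xK)..Sup (snd xK)}" "measure lborel (snd xK) = Sup (snd xK) - Inf (snd xK)"
    "interior (snd xK) = {Inf (snd xK)<..<Sup (snd xK)}"
proof -
  obtain x K where xKe: "xK = (x, K)" by (cases xK)
  have *: "x \<in> K" "K \<subseteq> {\<alpha>..\<beta>}" "\<exists>a b. K = cbox a b"
    using tagged_division_ofD(2-4)[OF p] xK xKe by blast+
  then obtain u v where K: "K = {u..v}" by auto
  have "u \<le> v" using * K by auto
  then have "Inf K = u" "Sup K = v" "interior K = {u<..<v}" using K by (simp_all add: interior_atLeastAtMost_real)
  then show "\<alpha> \<le> Inf (snd xK)" "Inf (snd xK) \<le> fst xK" "fst xK \<le> Sup (snd xK)" "Sup (snd xK) \<le> \<beta>"
    "snd xK = {Inf (snd xK)..Sup (snd xK)}" "measure lborel (snd xK) = Sup (snd xK) - Inf (snd xK)"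
    "interior (snd xK) = {Inf (snd xK)<..<Sup (snd xK)}"
    using * K xKe \<open>u \<le> v\<close> by auto
qed

text \<open>The gauge argument: at points outside \<open>N\<close> the gauge enforces the linear approximation by the derivative.
  Intervals tagged in \<open>N\<close> have small total length, because the indicator function of \<open>N\<close> has integral zero,
  and so absolute continuity makes the increments of \<open>f\<close> over them small.\<close>

theorem fundamental_theorem_of_calculus_AC:
  fixes f f' :: "real \<Rightarrow> real"
  assumes ab: "\<alpha> \<le> \<beta>" and AC: "locally_AC dist {\<alpha>..\<beta>} f" and N: "negligible N"
    and der: "\<And>x. x \<in> {\<alpha>..\<beta>} - N \<Longrightarrow> (f has_real_derivative f' x) (at x within {\<alpha>..\<beta>})"
  shows "(f' has_integral f \<beta> - f \<alpha>) {\<alpha>..\<beta>}"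
proof -
  define g where "g x = (if x \<in> N then 0 else f' x)" for x
  have "(g has_integral f \<beta> - f \<alpha>) {\<alpha>..\<beta>}"
    unfolding has_integral_real
  proof (intro allI impI)
    fix e :: real assume e: "e > 0"
    obtain \<eta> where \<eta>: "\<eta> > 0" and H: "\<forall>(P::(real \<times> real set) set) r s. finite P \<longrightarrow>
       (\<forall>p\<in>P. \<alpha> \<le> r p \<and> r p \<le> s p \<and> s p \<le> \<beta>) \<longrightarrow>
       (\<forall>p\<in>P. \<forall>q\<in>P. p \<noteq> q \<longrightarrow> {r p<..<s p} \<inter> {r q<..<s q} = {}) \<longrightarrow>
       (\<Sum>p\<in>P. s p - r p) < \<eta> \<longrightarrow> (\<Sum>p\<in>P. dist (f (r p)) (f (s p))) < e / 2"
      using locally_AC_finite_family[OF AC ab order_refl half_gt_zero[OF e]] by (elim exE conjE)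
    have "(indicator N has_integral (0::real)) {\<alpha>..\<beta>}"
      using N by (metis box_real(2) negligible_def)
    from this[unfolded has_integral_real, THEN spec, THEN mp, OF \<eta>]
    obtain \<gamma>1 where \<gamma>1: "gauge \<gamma>1" "\<forall>p. p tagged_division_of {\<alpha>..\<beta>} \<and> \<gamma>1 fine p \<longrightarrow>
        norm ((\<Sum>(x, k)\<in>p. measure lborel k *\<^sub>R (indicator N x :: real)) - 0) < \<eta>"
      by (elim exE conjE)
    \<comment> \<open>The summand \<open>1\<close> keeps the denominator positive when the interval is a point.\<close>
    define c where "c = e / (2 * (\<beta> - \<alpha> + 1))"
    have c: "c > 0" using e ab by (simp add: c_def)
    have "\<exists>d>0. \<forall>y\<in>{\<alpha>..\<beta>}. \<bar>y - x\<bar> < d \<longrightarrow> \<bar>f y - f x - f' x * (y - x)\<bar> \<le> c * \<bar>y - x\<bar>"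
      if x: "x \<in> {\<alpha>..\<beta>} - N" for x
    proof -
      have "(f has_derivative (*) (f' x)) (at x within {\<alpha>..\<beta>})"
        using der[OF x] by (simp add: has_field_derivative_def)
      then show ?thesis
        unfolding has_derivative_within_alt using c x by (auto simp: dist_real_def)
    qed
    then obtain d where d: "\<And>x. x \<in> {\<alpha>..\<beta>} - N \<Longrightarrow> d x > 0"
      "\<And>x y. x \<in> {\<alpha>..\<beta>} - N \<Longrightarrow> y \<in> {\<alpha>..\<beta>} \<Longrightarrow> \<bar>y - x\<bar> < d x \<Longrightarrow> \<bar>f y - f x - f' x * (y - x)\<bar> \<le> c * \<bar>y - x\<bar>"
      by metis
    define \<gamma>2 where "\<gamma>2 x = (if x \<in> {\<alpha>..\<beta>} - N then ball x (d x) else ball x 1)" for x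
    have "gauge \<gamma>2" using d(1) by (auto simp: gauge_def \<gamma>2_def)
    then have g: "gauge (\<lambda>x. \<gamma>1 x \<inter> \<gamma>2 x)" using \<gamma>1(1) by (rule gauge_Int[rotated])
    show "\<exists>\<gamma>. gauge \<gamma> \<and> (\<forall>p. p tagged_division_of {\<alpha>..\<beta>} \<and> \<gamma> fine p \<longrightarrow>
        norm ((\<Sum>(x, k)\<in>p. measure lborel k *\<^sub>R g x) - (f \<beta> - f \<alpha>)) < e)"
    proof (intro exI[of _ "\<lambda>x. \<gamma>1 x \<inter> \<gamma>2 x"] conjI g allI impI, elim conjE)
      fix p assume p: "p tagged_division_of {\<alpha>..\<beta>}" and fine: "(\<lambda>x. \<gamma>1 x \<inter> \<gamma>2 x) fine p"
      then have f1: "\<gamma>1 fine p" and f2: "\<gamma>2 fine p" by (auto simp: fine_Int)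
      note F = tagged_division_interval_endpoints[OF p]
      have fin: "finite p" using p by blast
      define lo where "lo xk = Inf (snd xk)" for xk :: "real \<times> real set"
      define hi where "hi xk = Sup (snd xk)" for xk :: "real \<times> real set"
      define PN where "PN = {xk \<in> p. fst xk \<in> N}"
      have "(\<Sum>xk\<in>p. measure lborel (snd xk) * indicator N (fst xk)) = (\<Sum>xk\<in>PN. hi xk - lo xk)"
        unfolding PN_def hi_def lo_def using F(6) fin
        by (intro sum.mono_neutral_cong_right) (auto simp: indicator_def)
      then have small: "(\<Sum>xk\<in>PN. hi xk - lo xk) < \<eta>"
        using \<gamma>1(2)[rule_format, OF conjI[OF p f1]] by (simp add: case_prod_unfold)
      have N_part: "(\<Sum>xk\<in>PN. dist (f (lo xk)) (f (hi xk))) < e / 2"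
      proof (rule H[rule_format, OF _ _ _ small])
        show "finite PN" unfolding PN_def using fin by simp
        show "\<alpha> \<le> lo q \<and> lo q \<le> hi q \<and> hi q \<le> \<beta>" if "q \<in> PN" for q
          using F(1-4)[of q] that unfolding PN_def lo_def hi_def by auto
        show "{lo q<..<hi q} \<inter> {lo q'<..<hi q'} = {}" if "q \<in> PN" "q' \<in> PN" "q \<noteq> q'" for q q'
          using F(7)[of q] F(7)[of q'] that tagged_division_ofD(5)[OF p, of "fst q" "snd q" "fst q'" "snd q'"]
          unfolding PN_def lo_def hi_def by (auto simp: prod_eq_iff)
      qed
      have tele: "(\<Sum>xk\<in>p. f (hi xk) - f (lo xk)) = f \<beta> - f \<alpha>"
        using additive_tagged_division_1[OF ab p, of f] by (simp add: case_prod_unfold hi_def lo_def)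
      have pt: "\<bar>measure lborel (snd xk) * g (fst xk) - (f (hi xk) - f (lo xk))\<bar>
          \<le> c * measure lborel (snd xk) + (if xk \<in> PN then dist (f (lo xk)) (f (hi xk)) else 0)" if xk: "xk \<in> p" for xk
      proof (cases "xk \<in> PN")
        case True
        then show ?thesis using c F(2,3,6)[OF xk] by (auto simp: PN_def g_def dist_real_def abs_minus_commute)
      next
        case False
        let ?x = "fst xk"
        have x: "?x \<in> {\<alpha>..\<beta>} - N" using False xk F(1-4)[OF xk] by (auto simp: PN_def)
        have sub: "snd xk \<subseteq> ball ?x (d ?x)"
          using fineD[OF f2, of ?x "snd xk"] xk x by (simp add: \<gamma>2_def)
        have eq: "snd xk = {lo xk..hi xk}" using F(5)[OF xk] unfolding lo_def hi_def .
        have "lo xk \<le> ?x" "?x \<le> hi xk" using F(2,3)[OF xk] unfolding lo_def hi_def by simp_all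
        then have "lo xk \<in> snd xk" "hi xk \<in> snd xk" unfolding eq by simp_all
        then have "\<bar>lo xk - ?x\<bar> < d ?x" "\<bar>hi xk - ?x\<bar> < d ?x"
          using sub by (auto simp: dist_real_def subset_eq)
        moreover have "lo xk \<in> {\<alpha>..\<beta>}" "hi xk \<in> {\<alpha>..\<beta>}" using F(1-4)[OF xk] unfolding lo_def hi_def by auto
        ultimately have 1: "\<bar>f (lo xk) - f ?x - f' ?x * (lo xk - ?x)\<bar> \<le> c * \<bar>lo xk - ?x\<bar>"
            and 2: "\<bar>f (hi xk) - f ?x - f' ?x * (hi xk - ?x)\<bar> \<le> c * \<bar>hi xk - ?x\<bar>"
          using d(2)[OF x] by blast+
        have "c * \<bar>lo xk - ?x\<bar> + c * \<bar>hi xk - ?x\<bar> = c * measure lborel (snd xk)"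
          using F(2,3)[OF xk] unfolding F(6)[OF xk] lo_def hi_def by (simp add: algebra_simps)
        moreover have "measure lborel (snd xk) * g ?x - (f (hi xk) - f (lo xk)) =
           (f (lo xk) - f ?x - f' ?x * (lo xk - ?x)) - (f (hi xk) - f ?x - f' ?x * (hi xk - ?x))"
          using x unfolding F(6)[OF xk] lo_def hi_def by (simp add: g_def algebra_simps)
        ultimately show ?thesis using 1 2 False by simp
      qed
      have "norm ((\<Sum>(x, k)\<in>p. measure lborel k *\<^sub>R g x) - (f \<beta> - f \<alpha>))
          = \<bar>\<Sum>xk\<in>p. measure lborel (snd xk) * g (fst xk) - (f (hi xk) - f (lo xk))\<bar>"
        unfolding tele[symmetric] sum_subtractf by (simp add: case_prod_unfold)
      also have "\<dots> \<le> (\<Sum>xk\<in>p. c * measure lborel (snd xk) + (if xk \<in> PN then dist (f (lo xk)) (f (hi xk)) else 0))"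
        by (rule order_trans[OF sum_abs sum_mono]) (rule pt)
      also have "\<dots> = c * (\<Sum>xk\<in>p. measure lborel (snd xk)) + (\<Sum>xk\<in>PN. dist (f (lo xk)) (f (hi xk)))"
      proof -
        have "(\<Sum>xk\<in>p. if xk \<in> PN then dist (f (lo xk)) (f (hi xk)) else 0) = (\<Sum>xk\<in>PN. dist (f (lo xk)) (f (hi xk)))"
          using fin by (intro sum.mono_neutral_cong_right) (auto simp: PN_def)
        then show ?thesis by (simp add: sum.distrib sum_distrib_left)
      qed
      also have "(\<Sum>xk\<in>p. measure lborel (snd xk)) = \<beta> - \<alpha>"
        using additive_content_tagged_division[of p \<alpha> \<beta>] p ab by (simp add: case_prod_unfold)
      also have "c * (\<beta> - \<alpha>) \<le> e / 2"
        using e ab by (simp add: c_def field_simps)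
      finally show "norm ((\<Sum>(x, k)\<in>p. measure lborel k *\<^sub>R g x) - (f \<beta> - f \<alpha>)) < e"
        using N_part by simp
    qed
  qed
  then show ?thesis
    by (rule has_integral_spike[OF N, rotated]) (auto simp: g_def)
qed

text \<open>By the lemma of Henstock, \<open>G(v) - G(u)\<close> and \<open>g(x) (v - u)\<close> differ by little in total over disjoint short
  intervals.  Hence intervals on which they differ by more than \<open>(v - u) / (k + 1)\<close> have small total length,
  and the points \<open>E k\<close> around which such intervals shrink form a null set by Vitali's theorem.\<close>

theorem lebesgue_differentiation_real:
  fixes g :: "real \<Rightarrow> real"
  assumes g: "g integrable_on {a..b}"
  shows "negligible {x \<in> {a..b}. \<not> ((\<lambda>x. integral {a..x} g) has_real_derivative g x) (at x within {a..b})}"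
proof -
  define G where "G x = integral {a..x} g" for x
  define E where "E k = {x \<in> {a..b}. \<forall>\<delta>>0. \<exists>y\<in>{a..b}. y \<noteq> x \<and> \<bar>y - x\<bar> < \<delta> \<and>
      \<bar>y - x\<bar> / real (Suc k) < \<bar>G y - G x - g x * (y - x)\<bar>}" for k
  have Gdiff: "integral {u..v} g = G v - G u" if "a \<le> u" "u \<le> v" "v \<le> b" for u v
  proof -
    have "integral {a..u} g + integral {u..v} g = integral {a..v} g"
      using that by (intro Henstock_Kurzweil_Integration.integral_combine integrable_on_subinterval[OF g]) auto
    then show ?thesis by (simp add: G_def)
  qed
  have "negligible (E k)" for k
    unfolding negligible_outer_le
  proof (intro allI impI)
    fix e :: real assume e: "e > 0"
    have g': "g integrable_on cbox a b" using g by simp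
    have e': "e / real (Suc k) > 0" using e by simp
    obtain \<gamma> where \<gamma>: "gauge \<gamma>" and
      H: "\<forall>p. p tagged_partial_division_of (cbox a b) \<longrightarrow> \<gamma> fine p \<longrightarrow>
             sum (\<lambda>(x,k). norm (measure lborel k *\<^sub>R g x - integral k g)) p < e / real (Suc k)"
    proof (rule Henstock_lemma[OF g' e'])
      fix \<gamma> assume 1: "gauge \<gamma>" and
        2: "\<And>p. \<lbrakk>p tagged_partial_division_of (cbox a b); \<gamma> fine p\<rbrakk> \<Longrightarrow>
             sum (\<lambda>(x,k). norm (measure lborel k *\<^sub>R g x - integral k g)) p < e / real (Suc k)"
      show thesis by (rule that[OF 1]) (intro allI impI, rule 2)
    qed
    define Q where "Q u v x \<longleftrightarrow> x \<in> {u..v} \<and> {u..v} \<subseteq> {a..b} \<and> {u..v} \<subseteq> \<gamma> x \<and>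
        (v - u) / real (Suc k) < \<bar>G v - G u - g x * (v - u)\<bar>" for u v x
    define P where "P = {(u, v). \<exists>x. Q u v x}"
    obtain T where "E k \<subseteq> T" "T \<in> lmeasurable" "measure lebesgue T \<le> e"
    proof (rule Vitali_interval_cover[of "E k" P e])
      fix x d :: real assume x: "x \<in> E k" and d: "d > 0"
      have "open (\<gamma> x)" "x \<in> \<gamma> x" using \<gamma> by (auto simp: gauge_def)
      then obtain \<rho> where \<rho>: "\<rho> > 0" "ball x \<rho> \<subseteq> \<gamma> x" by (meson open_contains_ball)
      have "min d \<rho> > 0" using d \<rho> by simp
      then obtain y where y: "y \<in> {a..b}" "y \<noteq> x" "\<bar>y - x\<bar> < min d \<rho>"
          "\<bar>y - x\<bar> / real (Suc k) < \<bar>G y - G x - g x * (y - x)\<bar>"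
        using x unfolding E_def by blast
      have xab: "x \<in> {a..b}" using x by (auto simp: E_def)
      have sub: "{min x y..max x y} \<subseteq> \<gamma> x"
        using \<rho>(2) y(3) by (auto simp: subset_eq dist_real_def)
      have "max x y - min x y = \<bar>y - x\<bar>" by auto
      moreover have "\<bar>G (max x y) - G (min x y) - g x * (max x y - min x y)\<bar> = \<bar>G y - G x - g x * (y - x)\<bar>"
        by (cases "x \<le> y") (auto simp: max_def min_def algebra_simps)
      ultimately have "Q (min x y) (max x y) x"
        unfolding Q_def using sub y(4) xab y(1) by auto
      then show "\<exists>u v. (u, v) \<in> P \<and> u < v \<and> u \<le> x \<and> x \<le> v \<and> v - u < d"
        using y(2,3) by (intro exI[of _ "min x y"] exI[of _ "max x y"]) (auto simp: P_def)
    next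
      fix F assume F: "finite F" "F \<subseteq> P" "\<And>u v. (u, v) \<in> F \<Longrightarrow> u < v"
        "pairwise (\<lambda>p q. disjnt {fst p..snd p} {fst q..snd q}) F"
      define X where "X p = (SOME x. Q (fst p) (snd p) x)" for p
      have X: "Q (fst p) (snd p) (X p)" if "p \<in> F" for p
      proof -
        have "p \<in> P" using F(2) that by blast
        then have "\<exists>x. Q (fst p) (snd p) x" by (simp add: P_def case_prod_unfold)
        then show ?thesis unfolding X_def by (rule someI_ex)
      qed
      define t where "t p = (X p, {fst p..snd p})" for p
      have lt: "fst p < snd p" if "p \<in> F" for p using F(3)[of "fst p" "snd p"] that by simp
      have dis: "{fst p..snd p} \<inter> {fst q..snd q} = {}" if "p \<in> F" "q \<in> F" "p \<noteq> q" for p q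
        using F(4) that unfolding pairwise_def disjnt_def by blast
      have inj: "inj_on t F"
      proof (rule inj_onI, rule ccontr)
        fix p q assume pq: "p \<in> F" "q \<in> F" "t p = t q" "p \<noteq> q"
        have "{fst p..snd p} = {fst q..snd q}" using pq(3) unfolding t_def by blast
        then have "{fst p..snd p} = {}" using dis[OF pq(1,2,4)] by blast
        then show False using lt[OF pq(1)] by simp
      qed
      have "t ` F tagged_partial_division_of cbox a b"
        unfolding tagged_partial_division_of_def
      proof (intro conjI allI impI)
        show "finite (t ` F)" using F(1) by simp
        fix x K assume "(x, K) \<in> t ` F"
        then obtain p where p: "p \<in> F" "x = X p" "K = {fst p..snd p}" by (auto simp: t_def)
        show "x \<in> K" "K \<subseteq> cbox a b" using X[OF p(1)] p by (auto simp: Q_def)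
        show "\<exists>a b. K = cbox a b" using p(3) by (metis box_real(2))
      next
        fix x1 K1 x2 K2 assume *: "(x1, K1) \<in> t ` F \<and> (x2, K2) \<in> t ` F \<and> (x1, K1) \<noteq> (x2, K2)"
        then obtain p q where "p \<in> F" "(x1, K1) = t p" "q \<in> F" "(x2, K2) = t q" by blast
        then have "K1 \<inter> K2 = {}" using * dis[of p q] by (auto simp: t_def)
        then show "interior K1 \<inter> interior K2 = {}" using interior_subset by blast
      qed
      moreover have "\<gamma> fine (t ` F)" using X by (auto simp: fine_def t_def Q_def)
      ultimately have "sum (\<lambda>(x,k). norm (measure lborel k *\<^sub>R g x - integral k g)) (t ` F) < e / real (Suc k)"
        by (rule H[rule_format])
      then have "(\<Sum>p\<in>F. norm (measure lborel {fst p..snd p} *\<^sub>R g (X p) - integral {fst p..snd p} g)) < e / real (Suc k)"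
        using inj by (subst (asm) sum.reindex) (simp_all add: t_def)
      moreover have "(\<Sum>p\<in>F. (snd p - fst p) / real (Suc k)) \<le>
         (\<Sum>p\<in>F. norm (measure lborel {fst p..snd p} *\<^sub>R g (X p) - integral {fst p..snd p} g))"
      proof (rule sum_mono)
        fix p assume p: "p \<in> F"
        have "{fst p..snd p} \<subseteq> {a..b}" using X[OF p] by (auto simp: Q_def)
        then have "integral {fst p..snd p} g = G (snd p) - G (fst p)"
          using lt[OF p] by (intro Gdiff) auto
        moreover have "measure lborel {fst p..snd p} = snd p - fst p" using lt[OF p] by simp
        ultimately show "(snd p - fst p) / real (Suc k) \<le>
            norm (measure lborel {fst p..snd p} *\<^sub>R g (X p) - integral {fst p..snd p} g)"
          using X[OF p] by (simp only: Q_def real_norm_def real_scaleR_def) (simp add: abs_minus_commute mult.commute)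
      qed
      ultimately have "(\<Sum>p\<in>F. snd p - fst p) / real (Suc k) < e / real (Suc k)"
        by (simp only: sum_divide_distrib)
      then show "(\<Sum>p\<in>F. snd p - fst p) \<le> e" by (simp add: divide_less_cancel)
    qed
    then show "\<exists>T. E k \<subseteq> T \<and> T \<in> lmeasurable \<and> measure lebesgue T \<le> e" by blast
  qed
  then have N: "negligible (\<Union>k. E k)" by (rule negligible_Union_nat)
  have "(G has_real_derivative g x) (at x within {a..b})" if x: "x \<in> {a..b}" "x \<notin> (\<Union>k. E k)" for x
    unfolding has_field_derivative_def has_derivative_within_alt
  proof (intro conjI allI impI)
    show "bounded_linear ((*) (g x))" by (rule bounded_linear_mult_right)
    fix e :: real assume "0 < e"
    then obtain k where k: "inverse (real (Suc k)) < e" using reals_Archimedean by blast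
    have "x \<notin> E k" using x by blast
    then have "\<not> (\<forall>\<delta>>0. \<exists>y\<in>{a..b}. y \<noteq> x \<and> \<bar>y - x\<bar> < \<delta> \<and>
        \<bar>y - x\<bar> / real (Suc k) < \<bar>G y - G x - g x * (y - x)\<bar>)"
      using x(1) unfolding E_def by blast
    then obtain \<delta> where \<delta>: "\<delta> > 0" "\<And>y. y \<in> {a..b} \<Longrightarrow> y \<noteq> x \<Longrightarrow> \<bar>y - x\<bar> < \<delta> \<Longrightarrow>
         \<bar>G y - G x - g x * (y - x)\<bar> \<le> \<bar>y - x\<bar> / real (Suc k)"
      by (meson not_less)
    show "\<exists>d>0. \<forall>y\<in>{a..b}. norm (y - x) < d \<longrightarrow> norm (G y - G x - g x * (y - x)) \<le> e * norm (y - x)"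
    proof (intro exI[of _ \<delta>] conjI \<delta>(1) ballI impI)
      fix y assume y: "y \<in> {a..b}" "norm (y - x) < \<delta>"
      show "norm (G y - G x - g x * (y - x)) \<le> e * norm (y - x)"
      proof (cases "y = x")
        case False
        have "\<bar>G y - G x - g x * (y - x)\<bar> \<le> inverse (real (Suc k)) * \<bar>y - x\<bar>"
          using \<delta>(2)[OF y(1) False] y(2) by (simp add: divide_inverse mult.commute)
        also have "\<dots> \<le> e * \<bar>y - x\<bar>" using k by (intro mult_right_mono) auto
        finally show ?thesis by simp
      qed simp
    qed
  qed
  then show ?thesis
    unfolding G_def[symmetric] by (intro negligible_subset[OF N]) blast
qed

text \<open>On an interval shorter than the \<open>\<eta>\<close> that belongs to \<open>1\<close> in the definition of absolute continuity, disjoint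
  intervals over which the speed exceeds \<open>1 / e\<close> have total length at most \<open>e\<close>.  Finite speed is much weaker
  than differentiability in \<open>L\<^sup>2\<close>, but it suffices for the energy.\<close>

theorem AC_metric_speed_finite:
  assumes AC: "locally_AC d D f" and sub: "{\<alpha>..\<beta>} \<subseteq> D" and sym: "\<And>x y. d x y = d y x"
    and refl0: "\<And>x. d x x = 0"
  shows "negligible {t \<in> {\<alpha><..<\<beta>}. \<not> (\<exists>M. \<exists>\<delta>>0. \<forall>s. \<bar>s - t\<bar> < \<delta> \<longrightarrow> d (f s) (f t) \<le> M * \<bar>s - t\<bar>)}"
    (is "negligible ?E")
proof (cases "\<alpha> < \<beta>")
  case True
  then have le: "\<alpha> \<le> \<beta>" by simp
  obtain \<eta> where \<eta>: "\<eta> > 0" and H: "\<forall>(P::(real \<times> real) set) r s. finite P \<longrightarrow>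
       (\<forall>p\<in>P. \<alpha> \<le> r p \<and> r p \<le> s p \<and> s p \<le> \<beta>) \<longrightarrow>
       (\<forall>p\<in>P. \<forall>q\<in>P. p \<noteq> q \<longrightarrow> {r p<..<s p} \<inter> {r q<..<s q} = {}) \<longrightarrow>
       (\<Sum>p\<in>P. s p - r p) < \<eta> \<longrightarrow> (\<Sum>p\<in>P. d (f (r p)) (f (s p))) < 1"
    using locally_AC_finite_family[OF AC le sub zero_less_one] by (elim exE conjE)
  \<comment> \<open>A ball of radius \<open>\<eta> / 3\<close> has length less than \<open>\<eta>\<close>, so every disjoint family in it is short enough.\<close>
  have loc: "negligible (?E \<inter> ball c (\<eta> / 3))" for c
    unfolding negligible_outer_le
  proof (intro allI impI)
    fix e :: real assume e: "e > 0"
    define P where "P = {(u, v). \<alpha> \<le> u \<and> v \<le> \<beta> \<and> {u..v} \<subseteq> ball c (\<eta> / 3) \<and> (v - u) / e < d (f u) (f v)}"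
    obtain T where "?E \<inter> ball c (\<eta> / 3) \<subseteq> T" "T \<in> lmeasurable" "measure lebesgue T \<le> e"
    proof (rule Vitali_interval_cover[of "?E \<inter> ball c (\<eta> / 3)" P e])
      fix x \<rho> :: real assume x: "x \<in> ?E \<inter> ball c (\<eta> / 3)" and \<rho>: "\<rho> > 0"
      have "open ({\<alpha><..<\<beta>} \<inter> ball c (\<eta> / 3))" "x \<in> {\<alpha><..<\<beta>} \<inter> ball c (\<eta> / 3)" using x by auto
      then obtain \<sigma> where \<sigma>: "\<sigma> > 0" "ball x \<sigma> \<subseteq> {\<alpha><..<\<beta>} \<inter> ball c (\<eta> / 3)" by (meson open_contains_ball)
      have "min \<rho> \<sigma> > 0" using \<rho> \<sigma> by simp
      then obtain y where y: "\<bar>y - x\<bar> < min \<rho> \<sigma>" "1 / e * \<bar>y - x\<bar> < d (f y) (f x)"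
      proof -
        have "\<not> (\<forall>s. \<bar>s - x\<bar> < min \<rho> \<sigma> \<longrightarrow> d (f s) (f x) \<le> 1 / e * \<bar>s - x\<bar>)"
        proof
          assume "\<forall>s. \<bar>s - x\<bar> < min \<rho> \<sigma> \<longrightarrow> d (f s) (f x) \<le> 1 / e * \<bar>s - x\<bar>"
          with \<open>min \<rho> \<sigma> > 0\<close> have "\<exists>M. \<exists>\<delta>>0. \<forall>s. \<bar>s - x\<bar> < \<delta> \<longrightarrow> d (f s) (f x) \<le> M * \<bar>s - x\<bar>"
            by (intro exI[of _ "1 / e"] exI[of _ "min \<rho> \<sigma>"] conjI)
          then show False using x by blast
        qed
        then show ?thesis using that by (simp only: not_all not_imp not_le) blast
      qed
      have z: "{min x y..max x y} \<subseteq> ball x \<sigma>" using y(1) by (auto simp: subset_eq dist_real_def)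
      have ne: "y \<noteq> x"
      proof
        assume "y = x"
        then have "0 < d (f x) (f x)" using y(2) by simp
        then show False by (simp add: refl0)
      qed
      have "(max x y - min x y) / e < d (f (min x y)) (f (max x y))"
        using y(2) sym[of "f x" "f y"] by (cases "x \<le> y") (auto simp: max_def min_def)
      moreover have "min x y \<in> ball x \<sigma>" "max x y \<in> ball x \<sigma>"
        by (rule subsetD[OF z], simp)+
      ultimately have "(min x y, max x y) \<in> P"
        using \<sigma>(2) z unfolding P_def by auto
      then show "\<exists>u v. (u, v) \<in> P \<and> u < v \<and> u \<le> x \<and> x \<le> v \<and> v - u < \<rho>"
        using y(1) ne by (intro exI[of _ "min x y"] exI[of _ "max x y"]) auto
    next
      fix F assume F: "finite F" "F \<subseteq> P" "\<And>u v. (u, v) \<in> F \<Longrightarrow> u < v"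
        "pairwise (\<lambda>p q. disjnt {fst p..snd p} {fst q..snd q}) F"
      have lt: "fst p < snd p" if "p \<in> F" for p using F(3)[of "fst p" "snd p"] that by simp
      have dis: "{fst p..snd p} \<inter> {fst q..snd q} = {}" if "p \<in> F" "q \<in> F" "p \<noteq> q" for p q
        using F(4) that unfolding pairwise_def disjnt_def by blast
      have sum_le: "(\<Sum>p\<in>F. snd p - fst p) \<le> 2 * (\<eta> / 3)"
      proof -
        have "(\<Sum>p\<in>F. snd p - fst p) = (\<Sum>p\<in>F. measure lebesgue {fst p..snd p})"
          by (rule sum.cong) (use lt in \<open>auto simp: less_imp_le\<close>)
        also have "\<dots> = measure lebesgue (\<Union>p\<in>F. {fst p..snd p})"
          by (rule measure_UNION'[symmetric, OF F(1) _ F(4)]) simp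
        also have "\<dots> \<le> measure lebesgue (ball c (\<eta> / 3))"
        proof (rule measure_mono_fmeasurable)
          show "(\<Union>p\<in>F. {fst p..snd p}) \<subseteq> ball c (\<eta> / 3)"
            using F(2) unfolding P_def by fastforce
          show "(\<Union>p\<in>F. {fst p..snd p}) \<in> sets lebesgue" by (intro sets.finite_UN F(1)) simp
        qed simp
        also have "\<dots> = 2 * (\<eta> / 3)" using \<eta> by (simp add: ball_eq_greaterThanLessThan)
        finally show ?thesis .
      qed
      have "(\<Sum>p\<in>F. d (f (fst p)) (f (snd p))) < 1"
      proof (rule H[rule_format, of F fst snd])
        show "(\<Sum>p\<in>F. snd p - fst p) < \<eta>" using sum_le \<eta> by simp
        show "{fst p<..<snd p} \<inter> {fst q<..<snd q} = {}" if "p \<in> F" "q \<in> F" "p \<noteq> q" for p q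
          using dis[OF that] by (auto simp: disjoint_iff)
      qed (use F(1,2) lt in \<open>auto simp: P_def less_imp_le\<close>)
      moreover have "(\<Sum>p\<in>F. (snd p - fst p) / e) \<le> (\<Sum>p\<in>F. d (f (fst p)) (f (snd p)))"
        by (rule sum_mono) (use F(2) in \<open>auto simp: P_def\<close>)
      ultimately have "(\<Sum>p\<in>F. snd p - fst p) / e \<le> 1" by (simp add: sum_divide_distrib)
      then show "(\<Sum>p\<in>F. snd p - fst p) \<le> e" using e by (simp add: field_simps)
    qed
    then show "\<exists>T. ?E \<inter> ball c (\<eta> / 3) \<subseteq> T \<and> T \<in> lmeasurable \<and> measure lebesgue T \<le> e" by blast
  qed
  show ?thesis
  proof (rule locally_negligible_alt[THEN iffD2], rule ballI)
    fix t assume t: "t \<in> ?E"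
    have "t \<in> ball t (\<eta> / 3)" using \<eta> by simp
    with t have "t \<in> ?E \<inter> ball t (\<eta> / 3)" by (rule IntI)
    then show "\<exists>U. openin (top_of_set ?E) U \<and> t \<in> U \<and> negligible U"
      by (intro exI[of _ "?E \<inter> ball t (\<eta> / 3)"] conjI openin_open_Int[OF open_ball] loc)
  qed
qed simp

section \<open>Square integrable functions on an interval\<close>

lemma AE_lebesgue_on_iff_negligible:
  fixes S :: "'a::euclidean_space set"
  assumes "S \<in> sets lebesgue"
  shows "(AE x in lebesgue_on S. P x) \<longleftrightarrow> negligible {x \<in> S. \<not> P x}"
proof -
  have "(AE x in lebesgue_on S. P x) \<longleftrightarrow> (AE x in lebesgue. x \<in> S \<longrightarrow> P x)"
    using assms by (intro AE_restrict_space_iff) simp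
  also have "\<dots> \<longleftrightarrow> (\<exists>N. negligible N \<and> {x. \<not> (x \<in> S \<longrightarrow> P x)} \<subseteq> N)"
    by (rule eventually_ae_filter_negligible)
  also have "\<dots> \<longleftrightarrow> negligible {x \<in> S. \<not> P x}"
    by (metis (mono_tags, lifting) Collect_cong negligible_subset order_refl not_imp)
  finally show ?thesis .
qed

lemma L2_on_integrable_square: "L2_on a b f \<Longrightarrow> integrable (lebesgue_on {a..b}) (\<lambda>x. (f x)\<^sup>2)"
  and L2_on_measurable: "L2_on a b f \<Longrightarrow> f \<in> borel_measurable (lebesgue_on {a..b})"
  by (simp_all add: L2_on_def)

lemma L2_on_integrable_mult:
  assumes "L2_on a b f" "L2_on a b g"
  shows "integrable (lebesgue_on {a..b}) (\<lambda>x. f x * g x)"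
proof (rule Bochner_Integration.integrable_bound)
  show "integrable (lebesgue_on {a..b}) (\<lambda>x. (f x)\<^sup>2 + (g x)\<^sup>2)"
    using assms by (intro Bochner_Integration.integrable_add L2_on_integrable_square)
  show "(\<lambda>x. f x * g x) \<in> borel_measurable (lebesgue_on {a..b})"
    using assms by (intro borel_measurable_times L2_on_measurable)
  have "\<bar>f x * g x\<bar> \<le> (f x)\<^sup>2 + (g x)\<^sup>2" for x
  proof -
    have "2 * (\<bar>f x\<bar> * \<bar>g x\<bar>) \<le> (f x)\<^sup>2 + (g x)\<^sup>2"
      using sum_squares_bound[of "\<bar>f x\<bar>" "\<bar>g x\<bar>"] by (simp add: mult.assoc)
    moreover have "0 \<le> \<bar>f x\<bar> * \<bar>g x\<bar>" by simp
    ultimately show ?thesis unfolding abs_mult by linarith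
  qed
  then show "AE x in lebesgue_on {a..b}. norm (f x * g x) \<le> norm ((f x)\<^sup>2 + (g x)\<^sup>2)" by simp
qed

lemma L2_on_lincomb:
  assumes "L2_on a b f" "L2_on a b g"
  shows "L2_on a b (\<lambda>x. f x + r * g x)"
  unfolding L2_on_def
proof
  show "(\<lambda>x. f x + r * g x) \<in> borel_measurable (lebesgue_on {a..b})"
    using assms by (intro borel_measurable_add borel_measurable_times borel_measurable_const L2_on_measurable)
  have "integrable (lebesgue_on {a..b}) (\<lambda>x. (f x)\<^sup>2 + 2 * r * (f x * g x) + r\<^sup>2 * (g x)\<^sup>2)"
    using assms by (intro Bochner_Integration.integrable_add integrable_mult_right L2_on_integrable_square L2_on_integrable_mult)
  then show "integrable (lebesgue_on {a..b}) (\<lambda>x. (f x + r * g x)\<^sup>2)"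
    by (simp add: power2_eq_square algebra_simps)
qed

lemma L2_on_diff:
  assumes "L2_on a b f" "L2_on a b g"
  shows "L2_on a b (\<lambda>x. f x - g x)"
  using L2_on_lincomb[OF assms, of "-1"] by simp

lemma L2_on_continuous:
  assumes "continuous_on {a..b} f"
  shows "L2_on a b f"
  unfolding L2_on_def
proof
  show "f \<in> borel_measurable (lebesgue_on {a..b})"
    using assms by (intro continuous_imp_measurable_on_sets_lebesgue) auto
  have "continuous_on {a..b} (\<lambda>x. (f x)\<^sup>2)" using assms by (intro continuous_intros)
  then show "integrable (lebesgue_on {a..b}) (\<lambda>x. (f x)\<^sup>2)"
    by (intro continuous_imp_integrable_real)
qed

lemma L2_on_integrable: "L2_on a b f \<Longrightarrow> integrable (lebesgue_on {a..b}) f"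
  using L2_on_integrable_mult[of a b f "\<lambda>_. 1"] L2_on_continuous[of a b "\<lambda>_. 1"] by simp

lemma integrable_imp_has_integral:
  fixes f :: "real \<Rightarrow> real"
  shows "integrable (lebesgue_on {a..b}) f \<Longrightarrow> (f has_integral (integral\<^sup>L (lebesgue_on {a..b}) f)) {a..b}"
  by (rule has_integral_integral_lebesgue_on) auto

lemma integral_eq_lebesgue:
  fixes f :: "real \<Rightarrow> real"
  shows "integrable (lebesgue_on {a..b}) f \<Longrightarrow> integral {a..b} f = integral\<^sup>L (lebesgue_on {a..b}) f"
  by (rule lebesgue_integral_eq_integral[symmetric]) auto

lemma integrable_imp_integrable_on:
  fixes f :: "real \<Rightarrow> real"
  shows "integrable (lebesgue_on {a..b}) f \<Longrightarrow> f integrable_on {a..b}"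
  by (rule integrable_on_lebesgue_on) auto

lemma L2_norm_on_square:
  assumes "L2_on a b f"
  shows "(L2_norm_on a b f)\<^sup>2 = integral {a..b} (\<lambda>x. (f x)\<^sup>2)" "0 \<le> L2_norm_on a b f"
proof -
  have "0 \<le> integral {a..b} (\<lambda>x. (f x)\<^sup>2)"
    by (intro integral_nonneg integrable_imp_integrable_on L2_on_integrable_square assms) auto
  then show "(L2_norm_on a b f)\<^sup>2 = integral {a..b} (\<lambda>x. (f x)\<^sup>2)" "0 \<le> L2_norm_on a b f"
    by (simp_all add: L2_norm_on_def)
qed

lemma L2_norm_on_minus_commute:
  "L2_norm_on a b (\<lambda>x. f x - g x) = L2_norm_on a b (\<lambda>x. g x - f x)"
  by (simp add: L2_norm_on_def power2_commute)

lemma integral_square_lincomb: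
  assumes "L2_on a b f" "L2_on a b g"
  shows "integral {a..b} (\<lambda>x. (f x + r * g x)\<^sup>2) = integral {a..b} (\<lambda>x. (f x)\<^sup>2)
     + 2 * r * integral {a..b} (\<lambda>x. f x * g x) + r\<^sup>2 * integral {a..b} (\<lambda>x. (g x)\<^sup>2)"
proof -
  note i = L2_on_integrable_square[OF assms(1), THEN integrable_imp_integrable_on, THEN integrable_integral]
    L2_on_integrable_square[OF assms(2), THEN integrable_imp_integrable_on, THEN integrable_integral]
    L2_on_integrable_mult[OF assms, THEN integrable_imp_integrable_on, THEN integrable_integral]
  have "((\<lambda>x. (f x)\<^sup>2 + 2 * r * (f x * g x) + r\<^sup>2 * (g x)\<^sup>2) has_integral
     integral {a..b} (\<lambda>x. (f x)\<^sup>2) + 2 * r * integral {a..b} (\<lambda>x. f x * g x) + r\<^sup>2 * integral {a..b} (\<lambda>x. (g x)\<^sup>2)) {a..b}"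
    by (intro has_integral_add has_integral_mult_right i)
  then have "integral {a..b} (\<lambda>x. (f x)\<^sup>2 + 2 * r * (f x * g x) + r\<^sup>2 * (g x)\<^sup>2) =
     integral {a..b} (\<lambda>x. (f x)\<^sup>2) + 2 * r * integral {a..b} (\<lambda>x. f x * g x) + r\<^sup>2 * integral {a..b} (\<lambda>x. (g x)\<^sup>2)"
    by (rule integral_unique)
  moreover have "(f x)\<^sup>2 + 2 * r * (f x * g x) + r\<^sup>2 * (g x)\<^sup>2 = (f x + r * g x)\<^sup>2" for x
    by (simp add: power2_eq_square algebra_simps)
  ultimately show ?thesis by simp
qed

lemma L2_Cauchy_Schwarz:
  assumes f: "L2_on a b f" and g: "L2_on a b g"
  shows "\<bar>integral {a..b} (\<lambda>x. f x * g x)\<bar> \<le> L2_norm_on a b f * L2_norm_on a b g"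
proof -
  let ?A = "integral {a..b} (\<lambda>x. (f x)\<^sup>2)" and ?B = "integral {a..b} (\<lambda>x. f x * g x)" and ?C = "integral {a..b} (\<lambda>x. (g x)\<^sup>2)"
  have q: "0 \<le> ?A + 2 * r * ?B + r\<^sup>2 * ?C" for r
    unfolding integral_square_lincomb[OF f g, symmetric]
    by (intro integral_nonneg integrable_imp_integrable_on L2_on_integrable_square L2_on_lincomb f g) auto
  have AC: "0 \<le> ?A" "0 \<le> ?C" using L2_norm_on_square[OF f] L2_norm_on_square[OF g] by (metis zero_le_power2)+
  have "?B\<^sup>2 \<le> ?A * ?C"
  proof (cases "?C = 0")
    case True
    have "?B = 0"
    proof (rule ccontr)
      assume "?B \<noteq> 0"
      then have "2 * (- (?A + 1) / (2 * ?B)) * ?B = - (?A + 1)" by simp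
      then have "0 \<le> ?A + - (?A + 1)" using q[of "- (?A + 1) / (2 * ?B)"] unfolding True by (simp only:)
      then show False by simp
    qed
    then show ?thesis using True by simp
  next
    case False
    then have "0 \<le> ?C * (?A + 2 * (- ?B / ?C) * ?B + (- ?B / ?C)\<^sup>2 * ?C)"
      using AC(2) q[of "- ?B / ?C"] by (intro mult_nonneg_nonneg)
    also have "\<dots> = ?A * ?C - ?B\<^sup>2" using False by (simp add: field_simps power2_eq_square)
    finally show ?thesis by simp
  qed
  then have "?B\<^sup>2 \<le> (L2_norm_on a b f * L2_norm_on a b g)\<^sup>2"
    by (simp add: power_mult_distrib L2_norm_on_square f g)
  then show ?thesis
    using L2_norm_on_square(2)[OF f] L2_norm_on_square(2)[OF g] by (metis abs_le_square_iff abs_of_nonneg mult_nonneg_nonneg)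
qed

lemma L2_norm_on_triangle:
  assumes f: "L2_on a b f" and g: "L2_on a b g"
  shows "L2_norm_on a b f \<le> L2_norm_on a b g + L2_norm_on a b (\<lambda>x. f x - g x)"
proof -
  have h: "L2_on a b (\<lambda>x. f x - g x)" by (rule L2_on_diff[OF f g])
  have "(L2_norm_on a b f)\<^sup>2 = integral {a..b} (\<lambda>x. (g x + 1 * (f x - g x))\<^sup>2)"
    by (simp add: L2_norm_on_square f)
  also have "\<dots> = (L2_norm_on a b g)\<^sup>2 + 2 * integral {a..b} (\<lambda>x. g x * (f x - g x)) + (L2_norm_on a b (\<lambda>x. f x - g x))\<^sup>2"
    unfolding integral_square_lincomb[OF g h] by (simp add: L2_norm_on_square g h)
  also have "\<dots> \<le> (L2_norm_on a b g)\<^sup>2 + 2 * (L2_norm_on a b g * L2_norm_on a b (\<lambda>x. f x - g x)) + (L2_norm_on a b (\<lambda>x. f x - g x))\<^sup>2"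
    using L2_Cauchy_Schwarz[OF g h] by simp
  also have "\<dots> = (L2_norm_on a b g + L2_norm_on a b (\<lambda>x. f x - g x))\<^sup>2"
    by (simp add: power2_sum)
  finally show ?thesis
    using L2_norm_on_square(2)[OF g] L2_norm_on_square(2)[OF h] by (rule power2_le_imp_le[OF _ add_nonneg_nonneg])
qed

section \<open>Absolute continuity and integration by parts\<close>

text \<open>Transfers absolute continuity from a curve in \<open>L\<^sup>2\<close> to its energy, and to products.\<close>

lemma locally_AC_comparison:
  assumes AC: "locally_AC d D f" and D: "{\<alpha>..\<beta>} \<subseteq> D"
    and B0: "0 \<le> B"
    and B: "\<And>r s. \<alpha> \<le> r \<Longrightarrow> r \<le> s \<Longrightarrow> s \<le> \<beta> \<Longrightarrow> dist (h r) (h s) \<le> B * d (f r) (f s) + B * (s - r)"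
  shows "locally_AC dist {\<alpha>..\<beta>} h"
  unfolding locally_AC_def
proof (intro allI impI, elim conjE)
  fix \<alpha>' \<beta>' \<epsilon> :: real assume le: "\<alpha>' \<le> \<beta>'" and sub: "{\<alpha>'..\<beta>'} \<subseteq> {\<alpha>..\<beta>}" and \<epsilon>: "0 < \<epsilon>"
  define C where "C = B + 1"
  have C: "C > 0" using B0 by (simp add: C_def)
  have ab: "\<alpha> \<le> \<alpha>'" "\<beta>' \<le> \<beta>" using le sub by auto
  have "\<epsilon> / (2 * C) > 0" using \<epsilon> C by simp
  from locally_AC_finite_family[OF AC le order_trans[OF sub D] this, where 'i = nat]
  obtain \<eta> where \<eta>: "\<eta> > 0" and H: "\<forall>(P::nat set) r s. finite P \<longrightarrow>
       (\<forall>p\<in>P. \<alpha>' \<le> r p \<and> r p \<le> s p \<and> s p \<le> \<beta>') \<longrightarrow>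
       (\<forall>p\<in>P. \<forall>q\<in>P. p \<noteq> q \<longrightarrow> {r p<..<s p} \<inter> {r q<..<s q} = {}) \<longrightarrow>
       (\<Sum>p\<in>P. s p - r p) < \<eta> \<longrightarrow> (\<Sum>p\<in>P. d (f (r p)) (f (s p))) < \<epsilon> / (2 * C)"
    by (elim exE conjE)
  define e where "e = min \<eta> (\<epsilon> / (2 * C))"
  show "\<exists>\<eta>>0. \<forall>(n::nat) r s.
          (\<forall>i<n. \<alpha>' \<le> r i \<and> r i \<le> s i \<and> s i \<le> \<beta>') \<and>
          (\<forall>i<n. \<forall>j<n. i \<noteq> j \<longrightarrow> {r i<..<s i} \<inter> {r j<..<s j} = {}) \<and>
          (\<Sum>i<n. s i - r i) < \<eta> \<longrightarrow>
          (\<Sum>i<n. dist (h (r i)) (h (s i))) < \<epsilon>"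
  proof (intro exI[of _ e] conjI allI impI, goal_cases)
    case 1 show ?case using \<eta> \<epsilon> C by (simp add: e_def)
  next
    case (2 n r s)
    then have R: "\<forall>i<n. \<alpha>' \<le> r i \<and> r i \<le> s i \<and> s i \<le> \<beta>'"
      and dj: "\<forall>i<n. \<forall>j<n. i \<noteq> j \<longrightarrow> {r i<..<s i} \<inter> {r j<..<s j} = {}"
      and sm: "(\<Sum>i<n. s i - r i) < e" by blast+
    have sm': "(\<Sum>i<n. s i - r i) < \<eta>" "(\<Sum>i<n. s i - r i) < \<epsilon> / (2 * C)" using sm by (auto simp: e_def)
    have 1: "(\<Sum>i<n. d (f (r i)) (f (s i))) < \<epsilon> / (2 * C)"
      by (rule H[rule_format]) (use R dj sm'(1) in auto)
    have d0: "dist (h (r i)) (h (s i)) \<le> B * (d (f (r i)) (f (s i)) + (s i - r i))" if "i < n" for i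
      using B[of "r i" "s i"] R that ab by (force simp: distrib_left)
    have "(\<Sum>i<n. dist (h (r i)) (h (s i))) \<le> (\<Sum>i<n. B * (d (f (r i)) (f (s i)) + (s i - r i)))"
      by (rule sum_mono) (use d0 in auto)
    also have "\<dots> = B * ((\<Sum>i<n. d (f (r i)) (f (s i))) + (\<Sum>i<n. s i - r i))"
      by (simp only: sum_distrib_left[symmetric] sum.distrib)
    also have "\<dots> \<le> B * (\<epsilon> / (2 * C) + \<epsilon> / (2 * C))"
      using 1 sm'(2) by (intro mult_left_mono add_mono B0) auto
    also have "\<dots> = B * \<epsilon> / C" by simp
    also have "\<dots> < \<epsilon>" using C \<epsilon> by (simp add: C_def field_simps)
    finally show ?case .
  qed
qed

lemma locally_AC_imp_continuous_on:
  fixes h :: "real \<Rightarrow> real"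
  assumes AC: "locally_AC dist {\<alpha>..\<beta>} h"
  shows "continuous_on {\<alpha>..\<beta>} h"
proof (cases "\<alpha> \<le> \<beta>")
  case True
  show ?thesis
    unfolding continuous_on_iff
  proof (intro ballI allI impI)
    fix x e :: real assume x: "x \<in> {\<alpha>..\<beta>}" and e: "e > 0"
    obtain \<eta> where \<eta>: "\<eta> > 0" and H: "\<forall>(P::unit set) r s. finite P \<longrightarrow> (\<forall>p\<in>P. \<alpha> \<le> r p \<and> r p \<le> s p \<and> s p \<le> \<beta>) \<longrightarrow>
       (\<forall>p\<in>P. \<forall>q\<in>P. p \<noteq> q \<longrightarrow> {r p<..<s p} \<inter> {r q<..<s q} = {}) \<longrightarrow>
       (\<Sum>p\<in>P. s p - r p) < \<eta> \<longrightarrow> (\<Sum>p\<in>P. dist (h (r p)) (h (s p))) < e"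
      using locally_AC_finite_family[OF AC True order_refl e] by (elim exE conjE)
    show "\<exists>d>0. \<forall>y\<in>{\<alpha>..\<beta>}. dist y x < d \<longrightarrow> dist (h y) (h x) < e"
    proof (intro exI[of _ \<eta>] conjI \<eta> ballI impI)
      fix y assume y: "y \<in> {\<alpha>..\<beta>}" "dist y x < \<eta>"
      have "dist (h (min x y)) (h (max x y)) < e"
        using H[rule_format, of UNIV "\<lambda>_. min x y" "\<lambda>_. max x y"] x y
        by (auto simp: dist_real_def UNIV_unit)
      then show "dist (h y) (h x) < e" by (cases "x \<le> y") (auto simp: min_def max_def dist_commute)
    qed
  qed
qed simp

lemma continuous_on_interval_bounded:
  fixes f :: "real \<Rightarrow> real"
  assumes "continuous_on {a..b} f"
  obtains B where "B \<ge> 0" "\<And>x. x \<in> {a..b} \<Longrightarrow> \<bar>f x\<bar> \<le> B"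
proof -
  have "bounded (f ` {a..b})" using assms by (intro compact_imp_bounded compact_continuous_image) auto
  then obtain B where "\<And>x. x \<in> {a..b} \<Longrightarrow> \<bar>f x\<bar> \<le> B" unfolding bounded_iff by force
  then show ?thesis by (intro that[of "\<bar>B\<bar>"]) force+
qed

lemma locally_AC_mult_Lipschitz:
  fixes f h :: "real \<Rightarrow> real"
  assumes AC: "locally_AC dist {\<alpha>..\<beta>} f" and C: "0 \<le> C"
    and lip: "\<And>r s. r \<in> {\<alpha>..\<beta>} \<Longrightarrow> s \<in> {\<alpha>..\<beta>} \<Longrightarrow> \<bar>h r - h s\<bar> \<le> C * \<bar>r - s\<bar>"
  shows "locally_AC dist {\<alpha>..\<beta>} (\<lambda>t. f t * h t)"
proof -
  obtain B1 where B1: "B1 \<ge> 0" "\<And>t. t \<in> {\<alpha>..\<beta>} \<Longrightarrow> \<bar>f t\<bar> \<le> B1"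
    using continuous_on_interval_bounded[OF locally_AC_imp_continuous_on[OF AC]] by blast
  define B2 where "B2 = \<bar>h \<alpha>\<bar> + C * \<bar>\<beta> - \<alpha>\<bar>"
  have B2: "0 \<le> B2" using C by (simp add: B2_def)
  have hB: "\<bar>h t\<bar> \<le> B2" if t: "t \<in> {\<alpha>..\<beta>}" for t
  proof -
    have "\<bar>h t - h \<alpha>\<bar> \<le> C * \<bar>t - \<alpha>\<bar>" using t by (intro lip) auto
    also have "\<dots> \<le> C * \<bar>\<beta> - \<alpha>\<bar>" using t C by (intro mult_left_mono) auto
    finally show ?thesis unfolding B2_def by linarith
  qed
  show ?thesis
  proof (rule locally_AC_comparison[OF AC order_refl, of "B2 + B1 * C"])
    show "0 \<le> B2 + B1 * C" using B1 B2 C by simp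
    fix r s assume rs: "\<alpha> \<le> r" "r \<le> s" "s \<le> \<beta>"
    then have m: "r \<in> {\<alpha>..\<beta>}" "s \<in> {\<alpha>..\<beta>}" by auto
    have "f r * h r - f s * h s = (f r - f s) * h r + f s * (h r - h s)" by (simp add: algebra_simps)
    then have "\<bar>f r * h r - f s * h s\<bar> \<le> \<bar>f r - f s\<bar> * \<bar>h r\<bar> + \<bar>f s\<bar> * \<bar>h r - h s\<bar>"
      by (metis abs_mult abs_triangle_ineq)
    also have "\<dots> \<le> \<bar>f r - f s\<bar> * B2 + B1 * (C * \<bar>r - s\<bar>)"
      using B1 hB[OF m(1)] lip[OF m] m by (intro add_mono mult_mono mult_left_mono) auto
    also have "\<dots> \<le> \<bar>f r - f s\<bar> * (B2 + B1 * C) + (B2 + B1 * C) * \<bar>r - s\<bar>"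
    proof -
      have "\<bar>f r - f s\<bar> * B2 \<le> \<bar>f r - f s\<bar> * (B2 + B1 * C)" using B1 C by (intro mult_left_mono) auto
      moreover have "(B1 * C) * \<bar>r - s\<bar> \<le> (B2 + B1 * C) * \<bar>r - s\<bar>" using B2 by (intro mult_right_mono) auto
      ultimately show ?thesis by (simp add: mult.assoc)
    qed
    finally show "dist (f r * h r) (f s * h s) \<le> (B2 + B1 * C) * dist (f r) (f s) + (B2 + B1 * C) * (s - r)"
      using rs by (simp add: dist_real_def mult.commute)
  qed
qed

lemma L2_on_subinterval_integrable:
  assumes g: "L2_on a b g" and "a \<le> u" "v \<le> b"
  shows "g integrable_on {u..v}" "(\<lambda>x. (g x)\<^sup>2) integrable_on {u..v}"
  using integrable_imp_integrable_on[OF L2_on_integrable[OF g]]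
    integrable_imp_integrable_on[OF L2_on_integrable_square[OF g]] assms(2,3)
  by (auto elim!: integrable_on_subinterval)

lemma L2_indefinite_integral_diff:
  assumes g: "L2_on a b g" and "a \<le> u" "u \<le> v" "v \<le> b"
  shows "integral {u..v} g = integral {a..v} g - integral {a..u} g"
  using Henstock_Kurzweil_Integration.integral_combine[of a u v g] L2_on_subinterval_integrable(1)[OF g, of a v] assms(2-4)
  by simp

text \<open>For \<open>K > 0\<close> one has \<open>|g| \<le> K + g\<^sup>2 / K\<close>.  The last term contributes at most \<open>\<integral> g\<^sup>2 / K\<close> over any
  disjoint intervals, and the constant contributes \<open>K\<close> times their total length.\<close>

lemma L2_indefinite_integral_AC:
  assumes g: "L2_on a b g"
  shows "locally_AC dist {a..b} (\<lambda>x. c + integral {a..x} g)"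
  unfolding locally_AC_def
proof (intro allI impI, elim conjE)
  fix \<alpha> \<beta> \<epsilon> :: real assume le: "\<alpha> \<le> \<beta>" and sub: "{\<alpha>..\<beta>} \<subseteq> {a..b}" and \<epsilon>: "0 < \<epsilon>"
  have ab: "a \<le> \<alpha>" "\<beta> \<le> b" using le sub by auto
  define I where "I = integral {a..b} (\<lambda>x. (g x)\<^sup>2)"
  have I: "0 \<le> I"
    unfolding I_def using L2_norm_on_square[OF g] by (metis zero_le_power2)
  \<comment> \<open>Makes \<open>I / K < \<epsilon> / 2\<close>; the bound \<open>\<epsilon> / (2 K)\<close> on the total length takes care of the other half.\<close>
  define K where "K = 2 * (I + 1) / \<epsilon>"
  have K: "K > 0" using I \<epsilon> by (simp add: K_def)
  show "\<exists>\<eta>>0. \<forall>(n::nat) r s.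
          (\<forall>i<n. \<alpha> \<le> r i \<and> r i \<le> s i \<and> s i \<le> \<beta>) \<and>
          (\<forall>i<n. \<forall>j<n. i \<noteq> j \<longrightarrow> {r i<..<s i} \<inter> {r j<..<s j} = {}) \<and>
          (\<Sum>i<n. s i - r i) < \<eta> \<longrightarrow>
          (\<Sum>i<n. dist (c + integral {a..r i} g) (c + integral {a..s i} g)) < \<epsilon>"
  proof (intro exI[of _ "\<epsilon> / (2 * K)"] conjI allI impI, goal_cases)
    case 1 show ?case using \<epsilon> K by simp
  next
    case (2 n r s)
    then have R: "\<And>i. i < n \<Longrightarrow> a \<le> r i \<and> r i \<le> s i \<and> s i \<le> b"
      and dj: "\<forall>i<n. \<forall>j<n. i \<noteq> j \<longrightarrow> {r i<..<s i} \<inter> {r j<..<s j} = {}"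
      and sm: "(\<Sum>i<n. s i - r i) < \<epsilon> / (2 * K)" using ab by force+
    have pt: "dist (c + integral {a..r i} g) (c + integral {a..s i} g)
        \<le> K * (s i - r i) + 1 / K * integral {r i..s i} (\<lambda>x. (g x)\<^sup>2)" if i: "i < n" for i
    proof -
      have ii: "g integrable_on {r i..s i}" "(\<lambda>x. (g x)\<^sup>2) integrable_on {r i..s i}"
        using L2_on_subinterval_integrable[OF g] R[OF i] by auto
      have "dist (c + integral {a..r i} g) (c + integral {a..s i} g) = norm (integral {r i..s i} g)"
        using L2_indefinite_integral_diff[OF g, of "r i" "s i"] R[OF i] by (simp add: dist_real_def)
      also have "\<dots> \<le> integral {r i..s i} (\<lambda>x. K + 1 / K * (g x)\<^sup>2)"
      proof (rule integral_norm_bound_integral[OF ii(1)])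
        show "(\<lambda>x. K + 1 / K * (g x)\<^sup>2) integrable_on {r i..s i}"
          by (intro integrable_add integrable_on_mult_right ii integrable_const_ivl)
        fix x
        show "norm (g x) \<le> K + 1 / K * (g x)\<^sup>2"
        proof (cases "\<bar>g x\<bar> \<le> K")
          case True
          have "0 \<le> 1 / K * (g x)\<^sup>2" using K by simp
          then show ?thesis using True unfolding real_norm_def by linarith
        next
          case False
          then have "K * \<bar>g x\<bar> \<le> \<bar>g x\<bar> * \<bar>g x\<bar>" by (intro mult_right_mono) auto
          then have "\<bar>g x\<bar> \<le> 1 / K * (g x)\<^sup>2" using K by (simp add: field_simps power2_eq_square)
          then show ?thesis using K by simp
        qed
      qed
      also have "\<dots> = K * (s i - r i) + 1 / K * integral {r i..s i} (\<lambda>x. (g x)\<^sup>2)"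
      proof (rule integral_unique, intro has_integral_add has_integral_mult_right integrable_integral ii)
        show "((\<lambda>x. K) has_integral K * (s i - r i)) {r i..s i}"
          using has_integral_const_real[of K "r i" "s i"] R[OF i] by (simp add: mult.commute)
      qed
      finally show ?thesis .
    qed
    have "((\<lambda>x. (g x)\<^sup>2) has_integral (\<Sum>i<n. integral {r i..s i} (\<lambda>x. (g x)\<^sup>2))) (\<Union>i<n. {r i..s i})"
    proof (rule has_integral_UN)
      show "((\<lambda>x. (g x)\<^sup>2) has_integral integral {r i..s i} (\<lambda>x. (g x)\<^sup>2)) {r i..s i}" if "i \<in> {..<n}" for i
        using L2_on_subinterval_integrable(2)[OF g, of "r i" "s i"] R[of i] that by (simp add: integrable_integral)
      show "pairwise (\<lambda>i i'. negligible ({r i..s i} \<inter> {r i'..s i'})) {..<n}"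
      proof (rule pairwiseI)
        fix i j assume ij: "i \<in> {..<n}" "j \<in> {..<n}" "i \<noteq> j"
        have "{r i<..<s i} \<inter> {r j<..<s j} = {}" using dj ij by blast
        then have "{r i..s i} \<inter> {r j..s j} \<subseteq> {r i, s i, r j, s j}"
          by (auto simp: disjoint_iff)
        then show "negligible ({r i..s i} \<inter> {r j..s j})"
          by (rule negligible_subset[rotated]) (simp add: negligible_finite)
      qed
    qed simp
    moreover have "(\<Union>i<n. {r i..s i}) \<subseteq> {a..b}" using R by fastforce
    ultimately have sq: "(\<Sum>i<n. integral {r i..s i} (\<lambda>x. (g x)\<^sup>2)) \<le> I"
      unfolding I_def using L2_on_subinterval_integrable(2)[OF g order_refl order_refl]
      by (intro has_integral_subset_le) (auto simp: integrable_integral)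
    have "(\<Sum>i<n. dist (c + integral {a..r i} g) (c + integral {a..s i} g)) \<le>
       (\<Sum>i<n. K * (s i - r i) + 1 / K * integral {r i..s i} (\<lambda>x. (g x)\<^sup>2))"
      by (rule sum_mono) (use pt in auto)
    also have "\<dots> = K * (\<Sum>i<n. s i - r i) + 1 / K * (\<Sum>i<n. integral {r i..s i} (\<lambda>x. (g x)\<^sup>2))"
      by (simp only: sum_distrib_left sum.distrib)
    also have "\<dots> < K * (\<epsilon> / (2 * K)) + 1 / K * (I + 1)"
      using sm sq K by (intro add_strict_mono mult_strict_left_mono) auto
    also have "\<dots> = \<epsilon>"
    proof -
      have "I + 1 > 0" using I by simp
      then have "1 / K * (I + 1) = \<epsilon> / 2" using \<epsilon> by (simp add: K_def field_simps)
      moreover have "K * (\<epsilon> / (2 * K)) = \<epsilon> / 2" using K by simp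
      ultimately have "K * (\<epsilon> / (2 * K)) + 1 / K * (I + 1) = \<epsilon> / 2 + \<epsilon> / 2" by (simp only:)
      then show ?thesis by simp
    qed
    finally show ?case .
  qed
qed

lemma L2_indefinite_integral_continuous:
  assumes "L2_on a b g"
  shows "continuous_on {a..b} (\<lambda>x. c + integral {a..x} g)"
  using indefinite_integral_continuous_1[OF L2_on_subinterval_integrable(1)[OF assms order_refl order_refl]]
  by (intro continuous_intros)

text \<open>The product of an indefinite integral with a \<open>C\<^sup>1\<close> function is absolutely continuous, and its derivative
  is known almost everywhere by Lebesgue differentiation.\<close>

lemma L2_integration_by_parts:
  fixes c :: real
  assumes ab: "a \<le> b" and g: "L2_on a b g"
    and \<phi>: "\<And>x. x \<in> {a..b} \<Longrightarrow> (\<phi> has_real_derivative \<phi>' x) (at x within {a..b})"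
    and \<phi>': "continuous_on {a..b} \<phi>'"
  defines "G \<equiv> \<lambda>x. c + integral {a..x} g"
  shows "((\<lambda>x. g x * \<phi> x + G x * \<phi>' x) has_integral G b * \<phi> b - G a * \<phi> a) {a..b}"
proof -
  obtain B where B: "B \<ge> 0" "\<And>x. x \<in> {a..b} \<Longrightarrow> \<bar>\<phi>' x\<bar> \<le> B"
    using continuous_on_interval_bounded[OF \<phi>'] by blast
  have AC: "locally_AC dist {a..b} (\<lambda>x. G x * \<phi> x)"
  proof (rule locally_AC_mult_Lipschitz[OF _ B(1)])
    show "locally_AC dist {a..b} G" unfolding G_def by (rule L2_indefinite_integral_AC[OF g])
    show "\<bar>\<phi> r - \<phi> s\<bar> \<le> B * \<bar>r - s\<bar>" if "r \<in> {a..b}" "s \<in> {a..b}" for r s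
      using field_differentiable_bound[of "{a..b}" \<phi> \<phi>' B r s] \<phi> B(2) that by simp
  qed
  have N: "negligible {x \<in> {a..b}. \<not> ((\<lambda>x. integral {a..x} g) has_real_derivative g x) (at x within {a..b})}"
    by (rule lebesgue_differentiation_real[OF L2_on_subinterval_integrable(1)[OF g order_refl order_refl]])
  show ?thesis
  proof (rule fundamental_theorem_of_calculus_AC[OF ab AC N])
    fix x assume x: "x \<in> {a..b} - {x \<in> {a..b}. \<not> ((\<lambda>x. integral {a..x} g) has_real_derivative g x) (at x within {a..b})}"
    then have "((\<lambda>x. integral {a..x} g) has_real_derivative g x) (at x within {a..b})" by blast
    then have "(G has_real_derivative g x) (at x within {a..b})"
      unfolding G_def by (auto intro!: derivative_eq_intros)
    then show "((\<lambda>x. G x * \<phi> x) has_real_derivative g x * \<phi> x + G x * \<phi>' x) (at x within {a..b})"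
      using \<phi>[of x] x by (auto intro!: derivative_eq_intros)
  qed
qed

section \<open>Weak derivatives and the classical form of \<open>H\<^sup>4\<close> functions\<close>

text \<open>A continuous function of mean zero with compact support is the derivative of a test function, its
  primitive.  The definition of the weak derivative and integration by parts for the indefinite integral of
  \<open>g\<close> then give the same value for \<open>\<integral> f \<psi>\<close>.\<close>

lemma zero_mean_test_function:
  assumes ab: "a < b" and w: "weak_derivative_on a b f g" and f: "L2_on a b f" and g: "L2_on a b g"
    and \<psi>: "continuous_on UNIV \<psi>" and supp: "a < c" "c \<le> d" "d < b" "\<And>x. x \<notin> {c..d} \<Longrightarrow> \<psi> x = 0"
    and mean: "integral {a..b} \<psi> = 0"
  shows "integral {a..b} (\<lambda>x. (f x - integral {a..x} g) * \<psi> x) = 0"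
proof -
  define \<phi> where "\<phi> x = integral {a..x} \<psi>" for x
  have ci: "continuous_on S \<psi>" for S using \<psi> by (rule continuous_on_subset) simp
  have ii: "\<psi> integrable_on {u..v}" for u v by (intro integrable_continuous_real ci)
  have low: "\<phi> x = 0" if "x < c" for x
    unfolding \<phi>_def using supp(4) that by (subst integral_cong[where g = "\<lambda>_. 0"]) auto
  have high: "\<phi> x = \<phi> d" if "x \<ge> d" for x
  proof -
    have "integral {a..d} \<psi> + integral {d..x} \<psi> = integral {a..x} \<psi>"
      using supp that by (intro Henstock_Kurzweil_Integration.integral_combine ii) auto
    moreover have "integral {d..x} \<psi> = integral {d..x} (\<lambda>_. 0)"
      by (rule integral_spike[of "{d}"]) (use supp in auto)
    ultimately show ?thesis by (simp add: \<phi>_def)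
  qed
  have d0: "\<phi> d = 0" using high[of b] mean supp by (simp add: \<phi>_def)
  have zero: "\<phi> x = 0" if "x \<notin> {c..d}" for x using low[of x] high[of x] d0 that by force
  have der: "(\<phi> has_real_derivative \<psi> x) (at x)" for x
  proof (cases "x < c")
    case True
    have "((\<lambda>_. 0) has_real_derivative 0) (at x)" by simp
    then have "(\<phi> has_real_derivative 0) (at x)"
      by (rule has_field_derivative_transform_within_open[of _ _ _ "{..<c}"]) (use True low in auto)
    then show ?thesis using supp(4)[of x] True by simp
  next
    case False
    have "(\<phi> has_real_derivative \<psi> x) (at x within {a..x + 1})"
      unfolding \<phi>_def using False supp by (intro integral_has_real_derivative ci) auto
    then show ?thesis using False supp by (simp add: at_within_Icc_at)
  qed
  have \<phi>c: "continuous_on {a..b} \<phi>" using der by (meson DERIV_continuous_on has_field_derivative_at_within)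
  have 1: "integral {a..b} (\<lambda>x. f x * \<psi> x) = - integral {a..b} (\<lambda>x. g x * \<phi> x)"
    using w[unfolded weak_derivative_on_def, THEN spec[of _ \<phi>], THEN spec[of _ \<psi>], THEN mp] der \<psi> supp(1-3) zero
    by blast
  define G where "G x = 0 + integral {a..x} g" for x
  have "((\<lambda>x. g x * \<phi> x + G x * \<psi> x) has_integral G b * \<phi> b - G a * \<phi> a) {a..b}"
    unfolding G_def
    by (rule L2_integration_by_parts[OF less_imp_le[OF ab] g]) (use der ci in \<open>auto intro: has_field_derivative_at_within\<close>)
  then have 2: "integral {a..b} (\<lambda>x. g x * \<phi> x + G x * \<psi> x) = 0"
    using zero[of a] zero[of b] supp by (simp add: integral_unique)
  have Gc: "continuous_on {a..b} G" unfolding G_def by (rule L2_indefinite_integral_continuous[OF g])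
  note I1 = integrable_imp_integrable_on[OF L2_on_integrable_mult[OF g L2_on_continuous[OF \<phi>c]]]
  note I2 = integrable_imp_integrable_on[OF L2_on_integrable_mult[OF L2_on_continuous[OF Gc] L2_on_continuous[OF ci]]]
  note I3 = integrable_imp_integrable_on[OF L2_on_integrable_mult[OF f L2_on_continuous[OF ci]]]
  have "integral {a..b} (\<lambda>x. f x * \<psi> x - G x * \<psi> x) = integral {a..b} (\<lambda>x. f x * \<psi> x) - integral {a..b} (\<lambda>x. G x * \<psi> x)"
    by (rule Henstock_Kurzweil_Integration.integral_diff[OF I3 I2])
  also have "\<dots> = - integral {a..b} (\<lambda>x. g x * \<phi> x + G x * \<psi> x)"
    unfolding 1 Henstock_Kurzweil_Integration.integral_add[OF I1 I2] by simp
  finally show ?thesis using 2 by (simp add: G_def left_diff_distrib)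
qed

lemma AE_zero_if_interval_integrals_zero:
  fixes k :: "real \<Rightarrow> real"
  assumes k: "k integrable_on {a..b}"
    and 0: "\<And>u v. a < u \<Longrightarrow> u < v \<Longrightarrow> v < b \<Longrightarrow> integral {u..v} k = 0"
  shows "AE x in lebesgue_on {a..b}. k x = 0"
proof -
  define K where "K x = integral {a..x} k" for x
  have const: "K u = K v" if "a < u" "u < v" "v < b" for u v
  proof -
    have "K u + integral {u..v} k = K v"
      unfolding K_def using that
      by (intro Henstock_Kurzweil_Integration.integral_combine integrable_on_subinterval[OF k]) auto
    then show ?thesis using 0[OF that] by simp
  qed
  let ?N = "{x \<in> {a..b}. \<not> (K has_real_derivative k x) (at x within {a..b})}"
  have N: "negligible ?N" unfolding K_def by (rule lebesgue_differentiation_real[OF k])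
  have "k x = 0" if x: "x \<in> {a..b}" "x \<notin> ?N" "x \<noteq> a" "x \<noteq> b" for x
  proof -
    have xi: "a < x" "x < b" using x by auto
    have "(K has_real_derivative k x) (at x)"
      using x(1,2) xi by (simp add: at_within_Icc_at)
    moreover have "(K has_real_derivative 0) (at x)"
    proof (rule has_field_derivative_transform_within_open[OF DERIV_const open_greaterThanLessThan])
      show "x \<in> {a<..<b}" using xi by simp
      fix y assume y: "y \<in> {a<..<b}"
      show "K x = K y"
      proof (cases x y rule: linorder_cases)
        case less then show ?thesis using const[of x y] xi y by simp
      next
        case greater then show ?thesis using const[of y x] xi y by simp
      qed simp
    qed
    ultimately show ?thesis by (rule DERIV_unique)
  qed
  then have "{x \<in> {a..b}. k x \<noteq> 0} \<subseteq> ?N \<union> {a, b}" by blast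
  moreover have "negligible (?N \<union> {a, b})" using N by simp
  ultimately have "negligible {x \<in> {a..b}. k x \<noteq> 0}" by (rule negligible_subset[rotated])
  then show ?thesis
    by (subst AE_lebesgue_on_iff_negligible) simp_all
qed

text \<open>The lemma of du Bois-Reymond.  The difference \<open>h\<close> of \<open>f\<close> and the indefinite integral of \<open>g\<close> is orthogonal
  to all continuous functions of mean zero with compact support; subtracting its weighted mean \<open>c\<close> makes it
  orthogonal to all of them.  Bumps that increase to the indicator function of an open interval show that the
  remainder has integral zero over every interval.\<close>

lemma weak_derivative_imp_indefinite_integral:
  assumes ab: "a < b" and w: "weak_derivative_on a b f g" and f: "L2_on a b f" and g: "L2_on a b g"
  obtains c where "AE x in lebesgue_on {a..b}. f x = c + integral {a..x} g"
proof -
  define h where "h x = f x - integral {a..x} g" for x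
  have Gc: "continuous_on {a..b} (\<lambda>x. integral {a..x} g)"
    using L2_indefinite_integral_continuous[OF g, of 0] by simp
  have h: "L2_on a b h" unfolding h_def by (rule L2_on_diff[OF f L2_on_continuous[OF Gc]])
  \<comment> \<open>Trapezoids of height at most \<open>1\<close> on \<open>[u, v]\<close>; they increase to the indicator function of \<open>(u, v)\<close>.\<close>
  define bump where "bump u v n x = min 1 (real n * max 0 (min (x - u) (v - x)))" for u v :: real and n :: nat and x
  have bump_cont: "continuous_on S (bump u v n)" for S u v n
    unfolding bump_def by (intro continuous_intros)
  have bump_supp: "bump u v n x = 0" if "x \<notin> {u..v}" for u v n x
    using that by (auto simp: bump_def max_def min_def)
  have bump_range: "0 \<le> bump u v n x" "bump u v n x \<le> 1" for u v n x by (auto simp: bump_def)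
  define c0 where "c0 = a + (b - a) / 4"
  define d0 where "d0 = b - (b - a) / 4"
  have cd: "a < c0" "c0 < d0" "d0 < b" using ab by (auto simp: c0_def d0_def field_simps)
  define J where "J = integral {a..b} (bump c0 d0 1)"
  have J: "J \<noteq> 0"
  proof
    assume "J = 0"
    then have "\<forall>x\<in>{a..b}. bump c0 d0 1 x = 0"
      unfolding J_def using integral_eq_0_iff[OF bump_cont ab] bump_range(1) by blast
    moreover have "bump c0 d0 1 ((c0 + d0) / 2) \<noteq> 0" using cd by (auto simp: bump_def field_simps min_def max_def)
    moreover have "(c0 + d0) / 2 \<in> {a..b}" using cd by (auto simp: field_simps)
    ultimately show False by blast
  qed
  define c where "c = integral {a..b} (\<lambda>x. h x * bump c0 d0 1 x) / J"
  define k where "k x = h x - c" for x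
  have k: "L2_on a b k" unfolding k_def by (rule L2_on_diff[OF h L2_on_continuous]) simp
  note hint = integrable_imp_integrable_on[OF L2_on_integrable_mult[OF h L2_on_continuous[OF bump_cont]]]
  have kbump: "integral {a..b} (\<lambda>x. k x * bump u v n x) = 0" if uv: "a < u" "u < v" "v < b" for u v n
  proof -
    define m where "m = integral {a..b} (bump u v n)"
    \<comment> \<open>The mean of the bump is cancelled by a multiple of a fixed bump.\<close>
    define \<psi> where "\<psi> x = bump u v n x - m / J * bump c0 d0 1 x" for x
    have bi: "bump u v n integrable_on {a..b}" for u v n by (intro integrable_continuous_real bump_cont)
    have "(\<psi> has_integral m - m / J * J) {a..b}"
      unfolding \<psi>_def m_def J_def
      by (intro has_integral_diff has_integral_mult_right integrable_integral bi)
    then have "integral {a..b} \<psi> = m - m / J * J" by (rule integral_unique)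
    then have "integral {a..b} \<psi> = 0" using J by simp
    moreover have "continuous_on UNIV \<psi>" unfolding \<psi>_def by (intro continuous_intros bump_cont)
    moreover have "\<psi> x = 0" if "x \<notin> {min u c0..max v d0}" for x
    proof -
      have "x \<notin> {u..v}" "x \<notin> {c0..d0}" using that by auto
      then show ?thesis by (simp add: \<psi>_def bump_supp)
    qed
    ultimately have "integral {a..b} (\<lambda>x. h x * \<psi> x) = 0"
      unfolding h_def using uv cd
      by (intro zero_mean_test_function[OF ab w f g, of \<psi> "min u c0" "max v d0"]) auto
    moreover have "integral {a..b} (\<lambda>x. h x * \<psi> x) =
       integral {a..b} (\<lambda>x. h x * bump u v n x - m / J * (h x * bump c0 d0 1 x))"
      by (rule integral_cong) (simp add: \<psi>_def algebra_simps)
    moreover have "\<dots> = integral {a..b} (\<lambda>x. h x * bump u v n x) - m / J * integral {a..b} (\<lambda>x. h x * bump c0 d0 1 x)"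
      by (intro integral_unique has_integral_diff has_integral_mult_right integrable_integral hint)
    moreover have "m / J * integral {a..b} (\<lambda>x. h x * bump c0 d0 1 x) = c * m" using J by (simp add: c_def)
    moreover have "integral {a..b} (\<lambda>x. h x * bump u v n x - c * bump u v n x) =
        integral {a..b} (\<lambda>x. h x * bump u v n x) - c * m"
      unfolding m_def by (intro integral_unique has_integral_diff has_integral_mult_right integrable_integral hint bi)
    ultimately show ?thesis by (simp add: k_def left_diff_distrib)
  qed
  have "AE x in lebesgue_on {a..b}. k x = 0"
  proof (rule AE_zero_if_interval_integrals_zero)
    show "k integrable_on {a..b}" by (rule integrable_imp_integrable_on[OF L2_on_integrable[OF k]])
    fix u v assume uv: "a < u" "u < v" "v < b"
    define K where "K x = (if x \<in> {u<..<v} then k x else 0)" for x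
    have Km: "K \<in> borel_measurable (lebesgue_on {a..b})"
    proof -
      have "{u<..<v} \<inter> {a..b} \<in> sets (lebesgue_on {a..b})" by (auto simp: sets_restrict_space intro!: imageI)
      moreover have "{x \<in> space (lebesgue_on {a..b}). x \<in> {u<..<v}} = {u<..<v} \<inter> {a..b}" by auto
      ultimately show ?thesis
        unfolding K_def by (intro measurable_If L2_on_measurable k borel_measurable_const) simp
    qed
    have lim: "(\<lambda>n. integral\<^sup>L (lebesgue_on {a..b}) (\<lambda>x. k x * bump u v n x)) \<longlonglongrightarrow> integral\<^sup>L (lebesgue_on {a..b}) K"
    proof (rule integral_dominated_convergence)
      show "K \<in> borel_measurable (lebesgue_on {a..b})" by (rule Km)
      show "(\<lambda>x. k x * bump u v n x) \<in> borel_measurable (lebesgue_on {a..b})" for n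
        by (intro borel_measurable_times L2_on_measurable k L2_on_continuous bump_cont)
      show "integrable (lebesgue_on {a..b}) (\<lambda>x. \<bar>k x\<bar>)"
        by (intro Bochner_Integration.integrable_abs L2_on_integrable k)
      have "(\<lambda>n. k x * bump u v n x) \<longlonglongrightarrow> K x" for x
      proof (cases "x \<in> {u<..<v}")
        case True
        define m where "m = min (x - u) (v - x)"
        have m: "m > 0" using True by (simp add: m_def)
        have "eventually (\<lambda>n. bump u v n x = 1) sequentially"
        proof (rule eventually_sequentiallyI[of "nat \<lceil>1 / m\<rceil>"])
          fix n assume "nat \<lceil>1 / m\<rceil> \<le> n"
          then have "1 / m \<le> real n" by linarith
          then have "1 \<le> real n * m" using m by (simp add: field_simps)
          moreover have "max 0 (min (x - u) (v - x)) = m" using m by (simp add: m_def)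
          ultimately show "bump u v n x = 1" unfolding bump_def by simp
        qed
        then have "eventually (\<lambda>n. k x * bump u v n x = K x) sequentially"
          by eventually_elim (use True in \<open>simp add: K_def\<close>)
        then show ?thesis by (rule tendsto_eventually)
      next
        case False
        then have "max 0 (min (x - u) (v - x)) = 0" by auto
        then have "bump u v n x = 0" for n by (simp add: bump_def)
        moreover have "K x = 0" using False unfolding K_def by (rule if_not_P)
        ultimately show ?thesis by simp
      qed
      then show "AE x in lebesgue_on {a..b}. (\<lambda>n. k x * bump u v n x) \<longlonglongrightarrow> K x" by simp
      have "\<bar>k x * bump u v n x\<bar> \<le> \<bar>k x\<bar>" for n x
        using bump_range[of u v n x] by (simp add: abs_mult mult_left_le)
      then show "AE x in lebesgue_on {a..b}. norm (k x * bump u v n x) \<le> \<bar>k x\<bar>" for n by simp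
    qed
    have "integral\<^sup>L (lebesgue_on {a..b}) (\<lambda>x. k x * bump u v n x) = 0" for n
      using kbump[OF uv, of n] integral_eq_lebesgue[OF L2_on_integrable_mult[OF k L2_on_continuous[OF bump_cont]]]
      by simp
    then have K0: "integral\<^sup>L (lebesgue_on {a..b}) K = 0" using lim by (simp add: LIMSEQ_const_iff)
    have "integrable (lebesgue_on {a..b}) K"
      by (rule Bochner_Integration.integrable_bound[OF L2_on_integrable[OF k] Km]) (auto simp: K_def)
    then have "(K has_integral 0) {a..b}" using integrable_imp_has_integral[of a b K] K0 by simp
    then have "(k has_integral 0) {u<..<v}"
      unfolding K_def using uv by (subst (asm) has_integral_restrict) auto
    then show "integral {u..v} k = 0"
      by (metis integral_open_interval_real integral_unique)
  qed
  then have "AE x in lebesgue_on {a..b}. f x = c + integral {a..x} g"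
    by eventually_elim (simp add: k_def h_def)
  then show ?thesis by (rule that)
qed

lemma AE_eq_imp_integral_eq:
  fixes f g :: "real \<Rightarrow> real"
  assumes "AE x in lebesgue_on {a..b}. f x = g x" and "{u..v} \<subseteq> {a..b}"
  shows "integral {u..v} f = integral {u..v} g"
proof -
  have "negligible {x \<in> {a..b}. f x \<noteq> g x}" using assms(1) by (simp add: AE_lebesgue_on_iff_negligible)
  then show ?thesis by (rule integral_spike) (use assms(2) in auto)
qed

lemma AE_eq_continuous_imp_eq:
  fixes f g :: "real \<Rightarrow> real"
  assumes ab: "a < b" and "continuous_on {a..b} f" "continuous_on {a..b} g"
    and AE: "AE x in lebesgue_on {a..b}. f x = g x" and x: "x \<in> {a..b}"
  shows "f x = g x"
proof -
  have c: "continuous_on {a..b} (\<lambda>x. \<bar>f x - g x\<bar>)" using assms(2,3) by (intro continuous_intros)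
  have "AE x in lebesgue_on {a..b}. \<bar>f x - g x\<bar> = 0" using AE by eventually_elim simp
  then have "integral {a..b} (\<lambda>x. \<bar>f x - g x\<bar>) = integral {a..b} (\<lambda>_. 0)"
    by (rule AE_eq_imp_integral_eq) simp
  then show ?thesis using integral_eq_0_iff[OF c ab] x by auto
qed

text \<open>One step of the climb in regularity: a continuous weak derivative is a classical derivative, after
  modification on a null set.\<close>

lemma weak_derivative_continuous_imp_C1:
  assumes ab: "a < b" and w: "weak_derivative_on a b f g" and f: "L2_on a b f" and g: "L2_on a b g"
    and AE: "AE x in lebesgue_on {a..b}. g x = g' x" and g': "continuous_on {a..b} g'"
  obtains F where "\<And>x. x \<in> {a..b} \<Longrightarrow> (F has_real_derivative g' x) (at x within {a..b})"
    "AE x in lebesgue_on {a..b}. f x = F x"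
proof -
  obtain c where c: "AE x in lebesgue_on {a..b}. f x = c + integral {a..x} g"
    by (rule weak_derivative_imp_indefinite_integral[OF ab w f g])
  have eq: "integral {a..x} g = integral {a..x} g'" if "x \<in> {a..b}" for x
    by (rule AE_eq_imp_integral_eq[OF AE]) (use that in auto)
  show ?thesis
  proof (rule that)
    show "((\<lambda>x. c + integral {a..x} g') has_real_derivative g' x) (at x within {a..b})" if "x \<in> {a..b}" for x
      using integral_has_real_derivative[OF g' that] by (auto intro!: derivative_eq_intros)
    show "AE x in lebesgue_on {a..b}. f x = c + integral {a..x} g'"
      using c AE_space by eventually_elim (use eq in auto)
  qed
qed

text \<open>The chain of weak derivatives is read from the last to the first.  Only the last one, \<open>g\<close>, stays an
  element of \<open>L\<^sup>2\<close>; each of the others becomes the derivative of the one before it.  Continuity of \<open>f\<close> selects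
  the representative.\<close>

theorem Sobolev_H4_classical:
  assumes ab: "a < b" and H: "Sobolev_H 4 a b f" and fc: "continuous_on {a..b} f"
  obtains f1 f2 f3 g where "L2_on a b g"
    "\<And>x. x \<in> {a..b} \<Longrightarrow> (f has_real_derivative f1 x) (at x within {a..b})"
    "\<And>x. x \<in> {a..b} \<Longrightarrow> (f1 has_real_derivative f2 x) (at x within {a..b})"
    "\<And>x. x \<in> {a..b} \<Longrightarrow> (f2 has_real_derivative f3 x) (at x within {a..b})"
    "\<And>x. f3 x = f3 a + integral {a..x} g"
proof -
  have "Sobolev_H (Suc (Suc (Suc (Suc 0)))) a b f" 
    using H by (simp add: numeral_nat del: Sobolev_H.simps)
  then obtain g1 g2 g3 g4 where w: "weak_derivative_on a b f g1" "weak_derivative_on a b g1 g2"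
      "weak_derivative_on a b g2 g3" "weak_derivative_on a b g3 g4"
    and L: "L2_on a b f" "L2_on a b g1" "L2_on a b g2" "L2_on a b g3" "L2_on a b g4"
    unfolding Sobolev_H.simps by blast
  obtain c where c: "AE x in lebesgue_on {a..b}. g3 x = c + integral {a..x} g4"
    by (rule weak_derivative_imp_indefinite_integral[OF ab w(4) L(4,5)])
  define f3 where "f3 x = c + integral {a..x} g4" for x
  have c3: "continuous_on {a..b} f3" unfolding f3_def by (rule L2_indefinite_integral_continuous[OF L(5)])
  have "AE x in lebesgue_on {a..b}. g3 x = f3 x" using c by (simp add: f3_def)
  then obtain f2 where f2: "\<And>x. x \<in> {a..b} \<Longrightarrow> (f2 has_real_derivative f3 x) (at x within {a..b})"
     "AE x in lebesgue_on {a..b}. g2 x = f2 x"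
    using weak_derivative_continuous_imp_C1[OF ab w(3) L(3,4) _ c3] by blast
  obtain f1 where f1: "\<And>x. x \<in> {a..b} \<Longrightarrow> (f1 has_real_derivative f2 x) (at x within {a..b})"
     "AE x in lebesgue_on {a..b}. g1 x = f1 x"
    using weak_derivative_continuous_imp_C1[OF ab w(2) L(2,3) f2(2) DERIV_continuous_on[OF f2(1)]] by blast
  obtain F where F: "\<And>x. x \<in> {a..b} \<Longrightarrow> (F has_real_derivative f1 x) (at x within {a..b})"
     "AE x in lebesgue_on {a..b}. f x = F x"
    using weak_derivative_continuous_imp_C1[OF ab w(1) L(1,2) f1(2) DERIV_continuous_on[OF f1(1)]] by blast
  have eq: "f x = F x" if "x \<in> {a..b}" for x
    by (rule AE_eq_continuous_imp_eq[OF ab fc DERIV_continuous_on[OF F(1)] F(2) that])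
  have "(f has_real_derivative f1 x) (at x within {a..b})" if "x \<in> {a..b}" for x
    by (rule has_field_derivative_transform_within[OF F(1)[OF that] zero_less_one that]) (use eq in auto)
  moreover have "f3 x = f3 a + integral {a..x} g4" for x by (simp add: f3_def)
  ultimately show ?thesis using that L(5) f1(1) f2(1) by blast
qed

lemma Dx_eq:
  assumes "a < b" "x \<in> {a..b}" "\<And>y. y \<in> {a..b} \<Longrightarrow> h y = f y"
    "(f has_real_derivative D) (at x within {a..b})"
  shows "Dx a b h x = D"
proof -
  have "(h has_real_derivative D) (at x within {a..b})"
    by (rule has_field_derivative_transform_within[OF assms(4) zero_less_one assms(2)]) (use assms(3) in auto)
  then show ?thesis
    unfolding Dx_def using assms(1,2)
    by (simp add: vector_derivative_within_closed_interval has_real_derivative_iff_has_vector_derivative)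
qed

text \<open>The iterated derivative operator of the equation agrees with the classical derivatives, and in the fourth
  order with the weak derivative at almost every point.\<close>

lemma Dx_classical:
  assumes ab: "a < b" and g: "L2_on a b g"
    and f: "\<And>x. x \<in> {a..b} \<Longrightarrow> (f has_real_derivative f1 x) (at x within {a..b})"
    and f1: "\<And>x. x \<in> {a..b} \<Longrightarrow> (f1 has_real_derivative f2 x) (at x within {a..b})"
    and f2: "\<And>x. x \<in> {a..b} \<Longrightarrow> (f2 has_real_derivative f3 x) (at x within {a..b})"
    and f3: "\<And>x. f3 x = f3 a + integral {a..x} g"
  shows "\<And>x. x \<in> {a..b} \<Longrightarrow> Dx a b f x = f1 x"
    and "\<And>x. x \<in> {a..b} \<Longrightarrow> (Dx a b ^^ 2) f x = f2 x"
    and "\<And>x. x \<in> {a..b} \<Longrightarrow> (Dx a b ^^ 3) f x = f3 x"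
    and "AE x in lebesgue_on {a..b}. (Dx a b ^^ 4) f x = g x"
proof -
  show 1: "Dx a b f x = f1 x" if "x \<in> {a..b}" for x
    by (rule Dx_eq[OF ab that refl f[OF that]])
  show 2: "(Dx a b ^^ 2) f x = f2 x" if "x \<in> {a..b}" for x
    using Dx_eq[OF ab that 1 f1[OF that]] by (simp add: numeral_2_eq_2)
  show 3: "(Dx a b ^^ 3) f x = f3 x" if "x \<in> {a..b}" for x
    using Dx_eq[OF ab that 2 f2[OF that]] by (simp add: numeral_3_eq_3 numeral_2_eq_2)
  let ?N = "{x \<in> {a..b}. \<not> ((\<lambda>x. integral {a..x} g) has_real_derivative g x) (at x within {a..b})}"
  have N: "negligible ?N"
    by (rule lebesgue_differentiation_real[OF L2_on_subinterval_integrable(1)[OF g order_refl order_refl]])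
  have "(Dx a b ^^ 4) f x = g x" if x: "x \<in> {a..b}" "x \<notin> ?N" for x
  proof -
    have "((\<lambda>x. integral {a..x} g) has_real_derivative g x) (at x within {a..b})" using x by blast
    then have "((\<lambda>x. f3 a + integral {a..x} g) has_real_derivative g x) (at x within {a..b})"
      by (auto intro!: derivative_eq_intros)
    then have d: "(f3 has_real_derivative g x) (at x within {a..b})" using f3 by (metis (no_types, lifting) ext)
    have "Dx a b ((Dx a b ^^ 3) f) x = g x" by (rule Dx_eq[OF ab x(1) 3 d])
    moreover have "(Dx a b ^^ 4) f = Dx a b ((Dx a b ^^ 3) f)" by (simp add: eval_nat_numeral)
    ultimately show ?thesis by simp
  qed
  then show "AE x in lebesgue_on {a..b}. (Dx a b ^^ 4) f x = g x"
    by (subst AE_lebesgue_on_iff_negligible) (auto intro!: negligible_subset[OF N])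
qed

section \<open>The time derivative of the energy\<close>

lemma L2_on_cmult: "L2_on a b f \<Longrightarrow> L2_on a b (\<lambda>x. r * f x)"
  using L2_on_lincomb[of a b "\<lambda>_. 0" f r] L2_on_continuous[of a b "\<lambda>_. 0"] by simp

lemma L2_norm_on_cmult: "L2_norm_on a b (\<lambda>x. r * f x) = \<bar>r\<bar> * L2_norm_on a b f"
  by (simp add: L2_norm_on_def power_mult_distrib real_sqrt_mult)

text \<open>From \<open>|r g| \<le> min |r| (K |g|) |g| + r\<^sup>2 / K\<close>: the first term is dominated by \<open>K g\<^sup>2\<close> and tends to zero,
  and the integral of the second is at most \<open>C\<^sup>2 / K\<close>.\<close>

lemma L2_bounded_AE_null_imp_weakly_null:
  assumes g: "L2_on a b g" and r: "\<And>n. L2_on a b (r n)" and C: "\<And>n. L2_norm_on a b (r n) \<le> C"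
    and lim: "AE x in lebesgue_on {a..b}. (\<lambda>n. r n x) \<longlonglongrightarrow> 0"
  shows "(\<lambda>n. integral {a..b} (\<lambda>x. r n x * g x)) \<longlonglongrightarrow> 0"
proof (rule LIMSEQ_I)
  fix \<epsilon> :: real assume \<epsilon>: "0 < \<epsilon>"
  let ?M = "lebesgue_on {a..b}"
  have C0: "0 \<le> C" using C[of 0] L2_norm_on_square(2)[OF r[of 0]] by linarith
  \<comment> \<open>Large enough that \<open>C\<^sup>2 / K < \<epsilon> / 2\<close>.\<close>
  define K where "K = 2 * C\<^sup>2 / \<epsilon> + 1"
  have K: "K > 0" using \<epsilon> by (simp add: K_def add_nonneg_pos)
  have CK: "C\<^sup>2 / K < \<epsilon> / 2" using \<epsilon> K by (simp add: K_def field_simps)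
  define s where "s n x = min \<bar>r n x\<bar> (K * \<bar>g x\<bar>) * \<bar>g x\<bar>" for n x
  have sm: "s n \<in> borel_measurable ?M" for n
    unfolding s_def
    by (intro borel_measurable_times borel_measurable_min borel_measurable_abs borel_measurable_const L2_on_measurable g r)
  have s0: "0 \<le> s n x" for n x using K by (simp add: s_def)
  have sK: "s n x \<le> K * (g x)\<^sup>2" for n x
  proof -
    have "s n x \<le> K * \<bar>g x\<bar> * \<bar>g x\<bar>" unfolding s_def by (intro mult_right_mono) auto
    then show ?thesis by (simp add: power2_eq_square)
  qed
  have Kg: "integrable ?M (\<lambda>x. K * (g x)\<^sup>2)" by (intro integrable_mult_right L2_on_integrable_square g)
  have si: "integrable ?M (s n)" for n
    by (rule Bochner_Integration.integrable_bound[OF Kg sm]) (use s0 sK K in auto)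
  have "(\<lambda>n. integral\<^sup>L ?M (s n)) \<longlonglongrightarrow> integral\<^sup>L ?M (\<lambda>_. 0)"
  proof (rule integral_dominated_convergence[OF _ sm Kg])
    show "AE x in ?M. (\<lambda>n. s n x) \<longlonglongrightarrow> 0"
      using lim
    proof eventually_elim
      fix x assume l: "(\<lambda>n. r n x) \<longlonglongrightarrow> 0"
      have "(\<lambda>n. min \<bar>r n x\<bar> (K * \<bar>g x\<bar>) * \<bar>g x\<bar>) \<longlonglongrightarrow> min \<bar>0\<bar> (K * \<bar>g x\<bar>) * \<bar>g x\<bar>"
        by (intro tendsto_intros l)
      then show "(\<lambda>n. s n x) \<longlonglongrightarrow> 0" using K by (simp add: s_def)
    qed
    show "AE x in ?M. norm (s n x) \<le> K * (g x)\<^sup>2" for n using s0 sK by simp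
  qed simp
  then have "(\<lambda>n. integral\<^sup>L ?M (s n)) \<longlonglongrightarrow> 0" by simp
  then obtain N where N: "\<And>n. n \<ge> N \<Longrightarrow> norm (integral\<^sup>L ?M (s n) - 0) < \<epsilon> / 2"
    using LIMSEQ_D \<epsilon> half_gt_zero by blast
  show "\<exists>no. \<forall>n\<ge>no. norm (integral {a..b} (\<lambda>x. r n x * g x) - 0) < \<epsilon>"
  proof (intro exI[of _ N] allI impI)
    fix n assume n: "n \<ge> N"
    have pt: "norm (r n x * g x) \<le> s n x + 1 / K * (r n x)\<^sup>2" for x
    proof (cases "\<bar>r n x\<bar> \<le> K * \<bar>g x\<bar>")
      case True
      then have "norm (r n x * g x) = s n x" by (simp add: s_def abs_mult)
      moreover have "0 \<le> 1 / K * (r n x)\<^sup>2" using K by simp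
      ultimately show ?thesis by linarith
    next
      case False
      then have "\<bar>r n x\<bar> * (K * \<bar>g x\<bar>) \<le> \<bar>r n x\<bar> * \<bar>r n x\<bar>" by (intro mult_left_mono) auto
      then have "\<bar>r n x\<bar> * \<bar>g x\<bar> \<le> 1 / K * (r n x)\<^sup>2" using K by (simp add: field_simps power2_eq_square)
      then have "norm (r n x * g x) \<le> 1 / K * (r n x)\<^sup>2" by (simp only: real_norm_def abs_mult)
      then show ?thesis using s0[of n x] by linarith
    qed
    have bi: "((\<lambda>x. s n x + 1 / K * (r n x)\<^sup>2) has_integral
       integral\<^sup>L ?M (s n) + 1 / K * integral {a..b} (\<lambda>x. (r n x)\<^sup>2)) {a..b}"
      by (intro has_integral_add has_integral_mult_right integrable_imp_has_integral si integrable_integral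
          integrable_imp_integrable_on L2_on_integrable_square r)
    have "norm (integral {a..b} (\<lambda>x. r n x * g x)) \<le> integral {a..b} (\<lambda>x. s n x + 1 / K * (r n x)\<^sup>2)"
      by (rule integral_norm_bound_integral)
        (use pt bi in \<open>auto intro!: integrable_imp_integrable_on L2_on_integrable_mult r g simp: has_integral_iff\<close>)
    also have "\<dots> = integral\<^sup>L ?M (s n) + 1 / K * integral {a..b} (\<lambda>x. (r n x)\<^sup>2)"
      by (rule integral_unique[OF bi])
    also have "\<dots> \<le> integral\<^sup>L ?M (s n) + 1 / K * C\<^sup>2"
      unfolding L2_norm_on_square(1)[OF r, symmetric]
      using K C L2_norm_on_square(2)[OF r] by (intro add_left_mono mult_left_mono power_mono) auto
    also have "\<dots> < \<epsilon> / 2 + \<epsilon> / 2"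
      using N[OF n] CK by (intro add_strict_mono) auto
    finally show "norm (integral {a..b} (\<lambda>x. r n x * g x) - 0) < \<epsilon>" by simp
  qed
qed

text \<open>With \<open>w(t + h) = w(t) + h q\<close> the difference quotient of the energy is \<open>\<integral> w q + h/2 \<integral> q\<^sup>2\<close>.  The functions
  \<open>q\<close> are bounded in \<open>L\<^sup>2\<close> by the speed \<open>M\<close> and converge to \<open>F\<close> almost everywhere, hence weakly; strong
  convergence is not required, because the quadratic term carries the factor \<open>h\<close>.\<close>

lemma energy_has_derivative:
  assumes \<delta>: "\<delta> > 0" and L2: "\<And>s. \<bar>s - t\<bar> < \<delta> \<Longrightarrow> L2_on a b (\<lambda>x. w x s)"
    and speed: "\<And>s. \<bar>s - t\<bar> < \<delta> \<Longrightarrow> L2_norm_on a b (\<lambda>x. w x s - w x t) \<le> M * \<bar>s - t\<bar>"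
    and F: "L2_on a b F" and der: "AE x in lebesgue_on {a..b}. ((\<lambda>s. w x s) has_real_derivative F x) (at t)"
  shows "(energy a b w has_real_derivative integral {a..b} (\<lambda>x. w x t * F x)) (at t)"
  unfolding DERIV_def tendsto_at_iff_sequentially
proof (intro allI impI)
  fix X :: "nat \<Rightarrow> real" assume X: "\<forall>i. X i \<in> UNIV - {0}" "X \<longlonglongrightarrow> 0"
  let ?D = "integral {a..b} (\<lambda>x. w x t * F x)"
  obtain N where N: "\<And>n. n \<ge> N \<Longrightarrow> \<bar>X n\<bar> < \<delta>" using LIMSEQ_D[OF X(2) \<delta>] by auto
  define h where "h n = X (n + N)" for n
  have h: "h n \<noteq> 0" "\<bar>h n\<bar> < \<delta>" for n using X(1) N by (auto simp: h_def)
  have h0: "h \<longlonglongrightarrow> 0" unfolding h_def[abs_def] using X(2) by (rule LIMSEQ_ignore_initial_segment)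
  have Lt: "L2_on a b (\<lambda>x. w x t)" using L2[of t] \<delta> by simp
  have Lh: "L2_on a b (\<lambda>x. w x (t + h n))" for n using L2[of "t + h n"] h by simp
  define q where "q n x = 1 / h n * (w x (t + h n) - w x t)" for n x
  have q: "L2_on a b (q n)" for n unfolding q_def by (intro L2_on_cmult L2_on_diff Lh Lt)
  have qM: "L2_norm_on a b (q n) \<le> M" for n
  proof -
    have "L2_norm_on a b (q n) = \<bar>1 / h n\<bar> * L2_norm_on a b (\<lambda>x. w x (t + h n) - w x t)"
      unfolding q_def by (rule L2_norm_on_cmult)
    also have "\<dots> \<le> \<bar>1 / h n\<bar> * (M * \<bar>h n\<bar>)"
      using speed[of "t + h n"] h[of n] by (intro mult_left_mono) auto
    also have "\<dots> = M" using h(1)[of n] by simp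
    finally show ?thesis .
  qed
  have q_eq: "w x (t + h n) = w x t + h n * q n x" for n x using h(1)[of n] by (simp add: q_def)
  define r where "r n x = q n x - F x" for n x
  have r: "L2_on a b (r n)" for n unfolding r_def by (rule L2_on_diff[OF q F])
  have rC: "L2_norm_on a b (r n) \<le> M + L2_norm_on a b F" for n
  proof -
    have "L2_norm_on a b (r n) \<le> L2_norm_on a b (q n) + L2_norm_on a b (\<lambda>x. r n x - q n x)"
      by (rule L2_norm_on_triangle[OF r q])
    also have "L2_norm_on a b (\<lambda>x. r n x - q n x) = L2_norm_on a b F" by (simp add: r_def L2_norm_on_def)
    finally show ?thesis using qM[of n] by linarith
  qed
  have "AE x in lebesgue_on {a..b}. (\<lambda>n. r n x) \<longlonglongrightarrow> 0"
    using der
  proof eventually_elim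
    fix x assume "((\<lambda>s. w x s) has_real_derivative F x) (at t)"
    then have "((\<lambda>k. (w x (t + k) - w x t) / k) \<longlongrightarrow> F x) (at 0)" by (simp add: DERIV_def)
    then have "((\<lambda>k. (w x (t + k) - w x t) / k) \<circ> h) \<longlonglongrightarrow> F x"
      unfolding tendsto_at_iff_sequentially using h h0 by blast
    then have "(\<lambda>n. q n x) \<longlonglongrightarrow> F x" by (simp add: q_def o_def divide_inverse mult.commute)
    then have "(\<lambda>n. q n x - F x) \<longlonglongrightarrow> F x - F x" by (intro tendsto_intros)
    then show "(\<lambda>n. r n x) \<longlonglongrightarrow> 0" by (simp add: r_def)
  qed
  then have wk: "(\<lambda>n. integral {a..b} (\<lambda>x. r n x * w x t)) \<longlonglongrightarrow> 0"
    by (rule L2_bounded_AE_null_imp_weakly_null[OF Lt r rC])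
  have quot: "(energy a b w (t + h n) - energy a b w t) / h n =
      (?D + integral {a..b} (\<lambda>x. r n x * w x t)) + h n / 2 * integral {a..b} (\<lambda>x. (q n x)\<^sup>2)" for n
  proof -
    have "integral {a..b} (\<lambda>x. (w x (t + h n))\<^sup>2) = integral {a..b} (\<lambda>x. (w x t)\<^sup>2)
       + 2 * h n * integral {a..b} (\<lambda>x. w x t * q n x) + (h n)\<^sup>2 * integral {a..b} (\<lambda>x. (q n x)\<^sup>2)"
      unfolding q_eq by (rule integral_square_lincomb[OF Lt q])
    then have "(energy a b w (t + h n) - energy a b w t) / h n =
        integral {a..b} (\<lambda>x. w x t * q n x) + h n / 2 * integral {a..b} (\<lambda>x. (q n x)\<^sup>2)"
      using h(1)[of n] by (simp add: energy_def field_simps power2_eq_square)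
    moreover have "integral {a..b} (\<lambda>x. w x t * F x + r n x * w x t) = ?D + integral {a..b} (\<lambda>x. r n x * w x t)"
      by (intro Henstock_Kurzweil_Integration.integral_add integrable_imp_integrable_on L2_on_integrable_mult Lt F r)
    moreover have "w x t * F x + r n x * w x t = w x t * q n x" for x by (simp add: r_def algebra_simps)
    ultimately show ?thesis by simp
  qed
  have "(\<lambda>n. h n / 2 * integral {a..b} (\<lambda>x. (q n x)\<^sup>2)) \<longlonglongrightarrow> 0"
  proof (rule Lim_null_comparison)
    have "norm (h n / 2 * integral {a..b} (\<lambda>x. (q n x)\<^sup>2)) \<le> \<bar>h n\<bar> * M\<^sup>2" for n
    proof -
      have "0 \<le> L2_norm_on a b (q n)" by (rule L2_norm_on_square(2)[OF q])
      then have "(L2_norm_on a b (q n))\<^sup>2 \<le> M\<^sup>2" using qM by (intro power_mono)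
      then have "\<bar>h n\<bar> / 2 * (L2_norm_on a b (q n))\<^sup>2 \<le> \<bar>h n\<bar> * M\<^sup>2" by (intro mult_mono) auto
      then show ?thesis by (simp add: L2_norm_on_square(1)[OF q, symmetric] abs_mult)
    qed
    then show "eventually (\<lambda>n. norm (h n / 2 * integral {a..b} (\<lambda>x. (q n x)\<^sup>2)) \<le> \<bar>h n\<bar> * M\<^sup>2) sequentially"
      by simp
    have "(\<lambda>n. \<bar>h n\<bar> * M\<^sup>2) \<longlonglongrightarrow> \<bar>0\<bar> * M\<^sup>2" by (intro tendsto_intros h0)
    then show "(\<lambda>n. \<bar>h n\<bar> * M\<^sup>2) \<longlonglongrightarrow> 0" by simp
  qed
  then have "(\<lambda>n. (?D + integral {a..b} (\<lambda>x. r n x * w x t)) + h n / 2 * integral {a..b} (\<lambda>x. (q n x)\<^sup>2)) \<longlonglongrightarrow> (?D + 0) + 0"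
    by (intro tendsto_add wk tendsto_const)
  then have "(\<lambda>n. (energy a b w (t + h n) - energy a b w t) / h n) \<longlonglongrightarrow> ?D" by (simp add: quot)
  then show "((\<lambda>k. (energy a b w (t + k) - energy a b w t) / k) \<circ> X) \<longlonglongrightarrow> ?D"
    unfolding o_def h_def by (rule LIMSEQ_offset)
qed

text \<open>A convex set differs from its interior by a subset of its boundary, which is a null set.\<close>

lemma convex_lebesgue_measurable:
  fixes S :: "'a::euclidean_space set"
  assumes "convex S"
  shows "S \<in> sets lebesgue"
proof -
  have "S - interior S \<subseteq> frontier S" using closure_subset[of S] unfolding frontier_def by blast
  then have "negligible (S - interior S)"
    by (rule negligible_subset[OF negligible_convex_frontier[OF assms]])
  then have "S - interior S \<in> sets lebesgue" by (rule negligible_imp_sets)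
  moreover have "interior S \<in> sets lebesgue" by (intro sets_completionI_sets) simp
  ultimately have "interior S \<union> (S - interior S) \<in> sets lebesgue" by (intro sets.Un)
  moreover have "interior S \<union> (S - interior S) = S" using interior_subset[of S] by blast
  ultimately show ?thesis by simp
qed

text \<open>Fubini's theorem for null sets.  It is applied to a Borel null set that covers the exceptional points,
  since Lebesgue measure on the plane is the completion of a product and not itself a product.\<close>

lemma AE_lebesgue_on_times_section:
  fixes D :: "real set"
  assumes D: "D \<in> sets lebesgue" and AE: "AE (x, t) in lebesgue_on ({a..b} \<times> D). Q x t" and m: "{a..b::real} \<times> D \<in> sets lebesgue"
  shows "negligible {t \<in> D. \<not> (AE x in lebesgue_on {a..b}. Q x t)}"
proof -
  have "AE z in lebesgue. z \<in> {a..b} \<times> D \<longrightarrow> (case z of (x, t) \<Rightarrow> Q x t)"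
    using AE AE_restrict_space_iff[of "{a..b} \<times> D" lebesgue "\<lambda>(x, t). Q x t"] m by simp
  then have "AE z in lborel \<Otimes>\<^sub>M lborel. z \<in> {a..b} \<times> D \<longrightarrow> (case z of (x, t) \<Rightarrow> Q x t)"
    unfolding lborel_prod AE_completion_iff .
  then obtain N where N: "{z \<in> space (lborel \<Otimes>\<^sub>M lborel). \<not> (z \<in> {a..b} \<times> D \<longrightarrow> (case z of (x, t) \<Rightarrow> Q x t))} \<subseteq> N"
      "emeasure (lborel \<Otimes>\<^sub>M lborel) N = 0" "N \<in> sets (lborel \<Otimes>\<^sub>M lborel)"
    by (rule AE_E)
  have sp: "space (lborel \<Otimes>\<^sub>M lborel :: (real \<times> real) measure) = UNIV" by (simp add: space_pair_measure)
  have "AE z in lborel \<Otimes>\<^sub>M lborel. z \<notin> N" using N by (intro AE_not_in) auto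
  then have "AE x in lborel. AE t in lborel. (x, t) \<notin> N" by (rule lborel_pair.AE_pair)
  then have "AE t in lborel. AE x in lborel. (x, t) \<notin> N"
  proof (rule lborel_pair.AE_commute[THEN iffD1, rotated])
    have "{z \<in> space (lborel \<Otimes>\<^sub>M lborel). (fst z, snd z) \<notin> N} = space (lborel \<Otimes>\<^sub>M lborel) - N" by auto
    then show "{z \<in> space (lborel \<Otimes>\<^sub>M lborel). (fst z, snd z) \<notin> N} \<in> sets (lborel \<Otimes>\<^sub>M lborel)"
      using N(3) by (simp only:) (rule sets.compl_sets)
  qed
  then have "AE t in lborel. t \<in> D \<longrightarrow> (AE x in lebesgue_on {a..b}. Q x t)"
  proof eventually_elim
    fix t assume "AE x in lborel. (x, t) \<notin> N"
    then have 1: "AE x in lebesgue. (x, t) \<notin> N" by (rule AE_completion)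
    show "t \<in> D \<longrightarrow> (AE x in lebesgue_on {a..b}. Q x t)"
    proof
      assume t: "t \<in> D"
      from 1 have "AE x in lebesgue. x \<in> {a..b} \<longrightarrow> Q x t"
      proof eventually_elim
        fix x assume nN: "(x, t) \<notin> N"
        show "x \<in> {a..b} \<longrightarrow> Q x t"
        proof (intro impI, rule ccontr)
          assume "x \<in> {a..b}" "\<not> Q x t"
          then have "(x, t) \<in> {z \<in> space (lborel \<Otimes>\<^sub>M lborel). \<not> (z \<in> {a..b} \<times> D \<longrightarrow> (case z of (x, t) \<Rightarrow> Q x t))}"
            by (simp add: sp t)
          then show False using N(1) nN by blast
        qed
      qed
      then show "AE x in lebesgue_on {a..b}. Q x t" by (subst AE_restrict_space_iff) auto
    qed
  qed
  then have "AE t in lebesgue. t \<in> D \<longrightarrow> (AE x in lebesgue_on {a..b}. Q x t)" by (rule AE_completion)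
  then have "AE t in lebesgue_on D. (AE x in lebesgue_on {a..b}. Q x t)"
    using D by (subst AE_restrict_space_iff) auto
  then show ?thesis using D by (simp add: AE_lebesgue_on_iff_negligible)
qed

section \<open>The energy inequality\<close>

text \<open>The nonlinear term is a complete derivative and contributes the cubes.  Of the boundary terms of the linear
  part only those with the third derivative remain, because \<open>f1\<close> vanishes at both ends.\<close>

lemma KS_energy_rate:
  assumes ab: "a < b" and g: "L2_on a b g"
    and f: "\<And>x. x \<in> {a..b} \<Longrightarrow> (f has_real_derivative f1 x) (at x within {a..b})"
    and f1: "\<And>x. x \<in> {a..b} \<Longrightarrow> (f1 has_real_derivative f2 x) (at x within {a..b})"
    and f2: "\<And>x. x \<in> {a..b} \<Longrightarrow> (f2 has_real_derivative f3 x) (at x within {a..b})"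
    and f3: "\<And>x. f3 x = f3 a + integral {a..x} g"
    and bc: "f a = p" "f b = q" "f1 a = 0" "f1 b = 0"
  shows "integral {a..b} (\<lambda>x. f x * (- f x * f1 x - lam * f2 x - g x)) =
     (p ^ 3 - q ^ 3) / 3 + p * f3 a - q * f3 b
     + lam * integral {a..b} (\<lambda>x. (f1 x)\<^sup>2) - integral {a..b} (\<lambda>x. (f2 x)\<^sup>2)"
proof -
  have c: "continuous_on {a..b} f" "continuous_on {a..b} f1" "continuous_on {a..b} f2"
    using f f1 f2 by (meson DERIV_continuous_on)+
  have i1: "((\<lambda>x. g x * f x + f3 x * f1 x) has_integral f3 b * f b - f3 a * f a) {a..b}"
    using L2_integration_by_parts[OF less_imp_le[OF ab] g f c(2), of "f3 a"] unfolding f3[symmetric] .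
  have i2: "((\<lambda>x. f3 x * f1 x + f2 x * f2 x) has_integral f2 b * f1 b - f2 a * f1 a) {a..b}"
    by (rule fundamental_theorem_of_calculus[OF less_imp_le[OF ab]])
       (auto intro!: derivative_eq_intros f1 f2 simp: has_real_derivative_iff_has_vector_derivative[symmetric])
  have i3: "((\<lambda>x. f1 x * f1 x + f x * f2 x) has_integral f b * f1 b - f a * f1 a) {a..b}"
    by (rule fundamental_theorem_of_calculus[OF less_imp_le[OF ab]])
       (auto intro!: derivative_eq_intros f f1 simp: has_real_derivative_iff_has_vector_derivative[symmetric])
  have i4: "((\<lambda>x. (f x)\<^sup>2 * f1 x) has_integral (f b) ^ 3 / 3 - (f a) ^ 3 / 3) {a..b}"
    by (rule fundamental_theorem_of_calculus[OF less_imp_le[OF ab]])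
       (auto intro!: derivative_eq_intros f simp: has_real_derivative_iff_has_vector_derivative[symmetric] power2_eq_square)
  have i5: "((\<lambda>x. (f1 x)\<^sup>2) has_integral integral {a..b} (\<lambda>x. (f1 x)\<^sup>2)) {a..b}"
       "((\<lambda>x. (f2 x)\<^sup>2) has_integral integral {a..b} (\<lambda>x. (f2 x)\<^sup>2)) {a..b}"
    by (intro integrable_integral integrable_continuous_real continuous_intros c)+
  have "((\<lambda>x. - ((f x)\<^sup>2 * f1 x) - lam * (f1 x * f1 x + f x * f2 x) + lam * (f1 x)\<^sup>2 - (g x * f x + f3 x * f1 x)
        + (f3 x * f1 x + f2 x * f2 x) - (f2 x)\<^sup>2) has_integral
     - ((f b) ^ 3 / 3 - (f a) ^ 3 / 3) - lam * (f b * f1 b - f a * f1 a) + lam * integral {a..b} (\<lambda>x. (f1 x)\<^sup>2)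
     - (f3 b * f b - f3 a * f a) + (f2 b * f1 b - f2 a * f1 a) - integral {a..b} (\<lambda>x. (f2 x)\<^sup>2)) {a..b}"
    by (intro has_integral_add has_integral_diff has_integral_neg has_integral_mult_right i1 i2 i3 i4 i5)
  moreover have "- ((f x)\<^sup>2 * f1 x) - lam * (f1 x * f1 x + f x * f2 x) + lam * (f1 x)\<^sup>2 - (g x * f x + f3 x * f1 x)
        + (f3 x * f1 x + f2 x * f2 x) - (f2 x)\<^sup>2 = f x * (- f x * f1 x - lam * f2 x - g x)" for x
    by (simp add: power2_eq_square algebra_simps)
  ultimately have "((\<lambda>x. f x * (- f x * f1 x - lam * f2 x - g x)) has_integral
     - ((f b) ^ 3 / 3 - (f a) ^ 3 / 3) - lam * (f b * f1 b - f a * f1 a) + lam * integral {a..b} (\<lambda>x. (f1 x)\<^sup>2)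
     - (f3 b * f b - f3 a * f a) + (f2 b * f1 b - f2 a * f1 a) - integral {a..b} (\<lambda>x. (f2 x)\<^sup>2)) {a..b}"
    by (simp only:)
  then show ?thesis
    using bc by (simp add: integral_unique field_simps)
qed

definition chi_x :: "real \<Rightarrow> real \<Rightarrow> real \<Rightarrow> real \<Rightarrow> real \<Rightarrow> real" where
  "chi_x a b p q x = 6 * (q - p) * ((x - a) / (b - a) - ((x - a) / (b - a))\<^sup>2) / (b - a)"

definition chi_xx :: "real \<Rightarrow> real \<Rightarrow> real \<Rightarrow> real \<Rightarrow> real \<Rightarrow> real" where
  "chi_xx a b p q x = 6 * (q - p) * (1 - 2 * ((x - a) / (b - a))) / (b - a)\<^sup>2"

lemma chi_derivatives:
  assumes "a < b"
  shows "(chi a b p q has_real_derivative chi_x a b p q x) (at x within S)"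
    "(chi_x a b p q has_real_derivative chi_xx a b p q x) (at x within S)"
proof -
  have s: "((\<lambda>x. (x - a) / (b - a)) has_real_derivative 1 / (b - a)) (at x within S)"
    by (rule DERIV_cdivide) (auto intro!: derivative_eq_intros)
  show "(chi a b p q has_real_derivative chi_x a b p q x) (at x within S)"
    unfolding chi_def[abs_def] chi_x_def
    by (rule derivative_eq_intros s refl)+ (simp add: algebra_simps diff_divide_distrib add_divide_distrib power2_eq_square)
  have "((\<lambda>x. (x - a) / (b - a) - ((x - a) / (b - a))\<^sup>2) has_real_derivative
      1 / (b - a) - 2 * ((x - a) / (b - a)) * (1 / (b - a))) (at x within S)"
    by (rule derivative_eq_intros s refl)+ simp
  from DERIV_cdivide[OF DERIV_cmult[OF this, of "6 * (q - p)"], of "b - a"]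
  show "(chi_x a b p q has_real_derivative chi_xx a b p q x) (at x within S)"
    unfolding chi_x_def[abs_def]
  proof (rule DERIV_cong)
    have "1 / (b - a) - 2 * ((x - a) / (b - a)) * (1 / (b - a)) = (1 - 2 * ((x - a) / (b - a))) / (b - a)"
      by (simp add: diff_divide_distrib)
    then show "6 * (q - p) * (1 / (b - a) - 2 * ((x - a) / (b - a)) * (1 / (b - a))) / (b - a) = chi_xx a b p q x"
      unfolding chi_xx_def by (simp add: power2_eq_square)
  qed
qed

lemma chi_boundary:
  assumes "a < b"
  shows "chi a b p q a = p" "chi a b p q b = q" "chi_x a b p q a = 0" "chi_x a b p q b = 0"
  using assms by (simp_all add: chi_def chi_x_def)

lemma C_eq_chi_integrals:
  assumes "a < b"
  shows "C1 a b p q = 2 * integral {a..b} (\<lambda>x. (chi_xx a b p q x)\<^sup>2)"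
    and "C2 a b p q = integral {a..b} (\<lambda>x. (chi a b p q x)\<^sup>2)"
    and "C3 a b p q = 2 * integral {a..b} (\<lambda>x. (chi_x a b p q x)\<^sup>2)"
proof -
  have 1: "deriv (chi a b p q) = chi_x a b p q"
    using DERIV_imp_deriv[OF chi_derivatives(1)[OF assms]] by blast
  have 2: "deriv (chi_x a b p q) = chi_xx a b p q"
    using DERIV_imp_deriv[OF chi_derivatives(2)[OF assms]] by blast
  show "C1 a b p q = 2 * integral {a..b} (\<lambda>x. (chi_xx a b p q x)\<^sup>2)"
    "C2 a b p q = integral {a..b} (\<lambda>x. (chi a b p q x)\<^sup>2)"
    "C3 a b p q = 2 * integral {a..b} (\<lambda>x. (chi_x a b p q x)\<^sup>2)"
    by (simp_all add: C1_def C2_def C3_def 1 2)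
qed

text \<open>The difference \<open>z\<close> of \<open>f\<close> and the cubic is clamped, so the Rayleigh inequality applies to it.  Passing from
  \<open>f\<close> to \<open>z\<close> in each of the three integrals is an instance of Young's inequality; its weights (\<open>2/3\<close> for the
  second derivative, \<open>2\<close> for the first) are chosen so that the two terms in \<open>z\<close> recombine to
  \<open>\<integral> z\<^sub>x\<^sub>x\<^sup>2 - 3 \<lambda> \<integral> z\<^sub>x\<^sup>2\<close>, and the weights for \<open>z\<close> itself, which depend on the sign of \<open>\<delta>\<close>, are the
  origin of \<open>delta1\<close> and \<open>delta2\<close>.\<close>

lemma lifted_dissipation_bound:
  assumes ab: "a < b" and lam: "lam \<ge> 0" and \<delta>: "\<delta> \<le> delta_o lam a b"
    and f: "\<And>x. x \<in> {a..b} \<Longrightarrow> (f has_real_derivative f1 x) (at x within {a..b})"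
    and f1: "\<And>x. x \<in> {a..b} \<Longrightarrow> (f1 has_real_derivative f2 x) (at x within {a..b})"
    and f2: "continuous_on {a..b} f2"
    and bc: "f a = p" "f b = q" "f1 a = 0" "f1 b = 0"
  shows "lam * integral {a..b} (\<lambda>x. (f1 x)\<^sup>2) - integral {a..b} (\<lambda>x. (f2 x)\<^sup>2)
     \<le> delta1 \<delta> * integral {a..b} (\<lambda>x. (f x)\<^sup>2) + C1 a b p q + delta2 \<delta> * C2 a b p q + lam * C3 a b p q"
proof -
  define X where "X = chi a b p q"
  define X1 where "X1 = chi_x a b p q"
  define X2 where "X2 = chi_xx a b p q"
  define z where "z x = f x - X x" for x
  define z1 where "z1 x = f1 x - X1 x" for x
  define z2 where "z2 x = f2 x - X2 x" for x
  have X: "(X has_real_derivative X1 x) (at x within S)" "(X1 has_real_derivative X2 x) (at x within S)" for x S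
    using chi_derivatives[OF ab] by (simp_all add: X_def X1_def X2_def)
  have X2c: "continuous_on {a..b} X2" unfolding X2_def chi_xx_def[abs_def] by (intro continuous_intros) (use ab in auto)
  have Xc: "continuous_on {a..b} X" "continuous_on {a..b} X1"
    using X by (meson DERIV_continuous_on)+
  have fc: "continuous_on {a..b} f" "continuous_on {a..b} f1"
    using f f1 by (meson DERIV_continuous_on)+
  have z: "clamped a b z z1 z2"
    unfolding clamped_def
  proof (intro conjI ballI)
    show "(z has_real_derivative z1 x) (at x within {a..b})" "(z1 has_real_derivative z2 x) (at x within {a..b})"
      if "x \<in> {a..b}" for x
      unfolding z_def z1_def z2_def by (auto intro!: derivative_eq_intros f[OF that] f1[OF that] X)
    show "continuous_on {a..b} z2" unfolding z2_def by (intro continuous_intros f2 X2c)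
  qed (use chi_boundary[OF ab] bc in \<open>auto simp: z_def z1_def X_def X1_def\<close>)
  note zc = clamped_continuous[OF z]
  define I where "I h = integral {a..b} (\<lambda>x. (h x)\<^sup>2)" for h :: "real \<Rightarrow> real"
  have I: "((\<lambda>x. (h x)\<^sup>2) has_integral I h) {a..b}" if "continuous_on {a..b} h" for h
    unfolding I_def by (intro integrable_integral integrable_continuous_real continuous_intros that)
  have R: "\<delta> * I z \<le> I z2 - 3 * lam * I z1"
    using delta_o_Rayleigh[OF ab lam \<delta> z] by (simp add: I_def)
  have 1: "2 / 3 * I z2 - 2 * I X2 \<le> I f2"
  proof (rule has_integral_le)
    show "((\<lambda>x. 2 / 3 * (z2 x)\<^sup>2 - 2 * (X2 x)\<^sup>2) has_integral 2 / 3 * I z2 - 2 * I X2) {a..b}"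
      by (intro has_integral_diff has_integral_mult_right I zc X2c)
    show "((\<lambda>x. (f2 x)\<^sup>2) has_integral I f2) {a..b}" by (rule I[OF f2])
    fix x
    have "0 \<le> 1 / 3 * (z2 x + 3 * X2 x)\<^sup>2" by simp
    then show "2 / 3 * (z2 x)\<^sup>2 - 2 * (X2 x)\<^sup>2 \<le> (f2 x)\<^sup>2"
      by (simp add: z2_def power2_eq_square algebra_simps)
  qed
  have 2: "I f1 \<le> 2 * I z1 + 2 * I X1"
  proof (rule has_integral_le)
    show "((\<lambda>x. 2 * (z1 x)\<^sup>2 + 2 * (X1 x)\<^sup>2) has_integral 2 * I z1 + 2 * I X1) {a..b}"
      by (intro has_integral_add has_integral_mult_right I zc Xc)
    show "((\<lambda>x. (f1 x)\<^sup>2) has_integral I f1) {a..b}" by (rule I[OF fc(2)])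
    fix x
    have "0 \<le> (z1 x - X1 x)\<^sup>2" by simp
    then show "(f1 x)\<^sup>2 \<le> 2 * (z1 x)\<^sup>2 + 2 * (X1 x)\<^sup>2"
      by (simp add: z1_def power2_eq_square algebra_simps)
  qed
  have 3: "- (2 / 3 * \<delta>) * I z \<le> delta1 \<delta> * I f + delta2 \<delta> * I X"
  proof (rule has_integral_le)
    show "((\<lambda>x. - (2 / 3 * \<delta>) * (z x)\<^sup>2) has_integral - (2 / 3 * \<delta>) * I z) {a..b}"
      by (intro has_integral_mult_right I zc)
    show "((\<lambda>x. delta1 \<delta> * (f x)\<^sup>2 + delta2 \<delta> * (X x)\<^sup>2) has_integral delta1 \<delta> * I f + delta2 \<delta> * I X) {a..b}"
      by (intro has_integral_add has_integral_mult_right I fc Xc)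
    fix x
    show "- (2 / 3 * \<delta>) * (z x)\<^sup>2 \<le> delta1 \<delta> * (f x)\<^sup>2 + delta2 \<delta> * (X x)\<^sup>2"
    proof (cases "\<delta> \<ge> 0")
      case True
      have "0 \<le> \<delta> / 3 * (f x - 2 * X x)\<^sup>2" using True by simp
      then show ?thesis using True
        by (simp add: delta1_def delta2_def z_def power2_eq_square algebra_simps)
    next
      case False
      have "0 \<le> - \<delta> / 3 * (f x + 2 * X x)\<^sup>2" using False by (intro mult_nonneg_nonneg) auto
      then show ?thesis using False
        by (simp add: delta1_def delta2_def z_def power2_eq_square algebra_simps)
    qed
  qed
  have "lam * I f1 \<le> lam * (2 * I z1 + 2 * I X1)" using 2 lam by (rule mult_left_mono)
  then have "lam * I f1 - I f2 \<le> - (2 / 3) * (I z2 - 3 * lam * I z1) + 2 * I X2 + lam * (2 * I X1)"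
    using 1 by (simp add: algebra_simps)
  also have "\<dots> \<le> - (2 / 3) * (\<delta> * I z) + 2 * I X2 + lam * (2 * I X1)" using R by simp
  also have "\<dots> \<le> delta1 \<delta> * I f + delta2 \<delta> * I X + 2 * I X2 + lam * (2 * I X1)" using 3 by simp
  finally show ?thesis
    by (simp add: C_eq_chi_integrals[OF ab] I_def X_def X1_def X2_def algebra_simps)
qed

text \<open>Here \<open>p\<close>, \<open>q\<close> are the boundary values, \<open>\<zeta>a\<close>, \<open>\<zeta>b\<close> the third derivatives at the two ends, and \<open>V\<close> is the
  energy.\<close>

definition energy_rate_bound ::
  "real \<Rightarrow> real \<Rightarrow> real \<Rightarrow> real \<Rightarrow> real \<Rightarrow> real \<Rightarrow> real \<Rightarrow> real \<Rightarrow> real \<Rightarrow> real" where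
  "energy_rate_bound lam \<delta> a b p q \<zeta>a \<zeta>b V =
     (p ^ 3 - q ^ 3) / 3 + p * \<zeta>a - q * \<zeta>b + 2 * delta1 \<delta> * V
     + (C1 a b p q + delta2 \<delta> * C2 a b p q + lam * C3 a b p q)"

text \<open>A time is good if the solution is in \<open>H\<^sup>4\<close> with the right traces, satisfies the equation at almost every
  \<open>x\<close>, and moves with finite speed in \<open>L\<^sup>2\<close>.  Almost all times are good, and there the derivative of the
  energy is the exact rate.\<close>

lemma KS_energy_inequality:
  assumes ab: "a < b" and lam: "lam \<ge> 0" and \<delta>: "\<delta> \<le> delta_o lam a b"
    and KS: "KS_on lam a b D w p q" and D: "is_interval D" and sub: "{\<alpha>..\<beta>} \<subseteq> D"
  obtains N where "negligible N"
    "\<And>t. t \<in> {\<alpha><..<\<beta>} - N \<Longrightarrow> \<exists>V'. (energy a b w has_real_derivative V') (at t) \<and>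
       V' \<le> energy_rate_bound lam \<delta> a b (p t) (q t)
         ((Dx a b ^^ 3) (\<lambda>x. w x t) a) ((Dx a b ^^ 3) (\<lambda>x. w x t) b) (energy a b w t)"
proof -
  have Dm: "D \<in> sets lebesgue" "{a..b} \<times> D \<in> sets lebesgue"
    using is_interval_convex[OF D] by (auto intro!: convex_lebesgue_measurable convex_Times)
  define R where "R t \<longleftrightarrow> Sobolev_H 4 a b (\<lambda>x. w x t) \<and> continuous_on {a..b} (\<lambda>x. w x t) \<and>
        w a t = p t \<and> w b t = q t \<and>
        Dx a b (\<lambda>x. w x t) a = 0 \<and> Dx a b (\<lambda>x. w x t) b = 0" for t
  define F where "F x t = - w x t * Dx a b (\<lambda>y. w y t) x
            - lam * (Dx a b ^^ 2) (\<lambda>y. w y t) x - (Dx a b ^^ 4) (\<lambda>y. w y t) x" for x t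
  define dist2 where "dist2 f g = L2_norm_on a b (\<lambda>x. f x - g x)" for f g :: "real \<Rightarrow> real"
  have KS1: "AE t in lebesgue_on D. R t"
    and L2: "\<And>t. t \<in> D \<Longrightarrow> L2_on a b (\<lambda>x. w x t)"
    and AC: "locally_AC dist2 D (\<lambda>t x. w x t)"
    and KS2: "AE (x, t) in lebesgue_on ({a..b} \<times> D). ((\<lambda>s. w x s) has_real_derivative F x t) (at t within D)"
    using KS unfolding KS_on_def R_def F_def dist2_def by blast+
  define S where "S t \<longleftrightarrow> (AE x in lebesgue_on {a..b}. ((\<lambda>s. w x s) has_real_derivative F x t) (at t within D))" for t
  define U where "U t \<longleftrightarrow> (\<exists>M. \<exists>\<epsilon>>0. \<forall>s. \<bar>s - t\<bar> < \<epsilon> \<longrightarrow> dist2 (\<lambda>x. w x s) (\<lambda>x. w x t) \<le> M * \<bar>s - t\<bar>)" for t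
  have N1: "negligible {t \<in> D. \<not> R t}" using KS1 Dm(1) by (simp add: AE_lebesgue_on_iff_negligible)
  have N2: "negligible {t \<in> D. \<not> S t}"
    unfolding S_def by (rule AE_lebesgue_on_times_section[OF Dm(1) KS2 Dm(2)])
  have N3: "negligible {t \<in> {\<alpha><..<\<beta>}. \<not> U t}"
    unfolding U_def
  proof (rule AC_metric_speed_finite[OF AC sub])
    show "dist2 f g = dist2 g f" for f g unfolding dist2_def by (rule L2_norm_on_minus_commute)
    show "dist2 f f = 0" for f by (simp add: dist2_def L2_norm_on_def)
  qed
  show ?thesis
  proof (rule that)
    show "negligible ({t \<in> D. \<not> R t} \<union> {t \<in> D. \<not> S t} \<union> {t \<in> {\<alpha><..<\<beta>}. \<not> U t})"
      by (intro negligible_Un N1 N2 N3)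
    fix t assume "t \<in> {\<alpha><..<\<beta>} - ({t \<in> D. \<not> R t} \<union> {t \<in> D. \<not> S t} \<union> {t \<in> {\<alpha><..<\<beta>}. \<not> U t})"
    moreover have oD: "{\<alpha><..<\<beta>} \<subseteq> D" using sub by auto
    ultimately have t: "t \<in> {\<alpha><..<\<beta>}" and Rt: "R t" and der: "S t" and sp: "U t" by blast+
    let ?f = "\<lambda>x. w x t"
    have at: "at t within D = at t" by (rule at_within_open_subset[OF t open_greaterThanLessThan oD])
    have H: "Sobolev_H 4 a b ?f" and fc: "continuous_on {a..b} ?f" using Rt by (simp_all add: R_def)
    obtain f1 f2 f3 g where g: "L2_on a b g"
      and f: "\<And>x. x \<in> {a..b} \<Longrightarrow> (?f has_real_derivative f1 x) (at x within {a..b})"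
      and f1: "\<And>x. x \<in> {a..b} \<Longrightarrow> (f1 has_real_derivative f2 x) (at x within {a..b})"
      and f2: "\<And>x. x \<in> {a..b} \<Longrightarrow> (f2 has_real_derivative f3 x) (at x within {a..b})"
      and f3: "\<And>x. f3 x = f3 a + integral {a..x} g"
      by (rule Sobolev_H4_classical[OF ab H fc]) (rule that)
    have Dx1: "Dx a b ?f x = f1 x" if "x \<in> {a..b}" for x
      by (rule Dx_classical(1)[OF ab g f f1 f2 f3 that])
    have Dx2: "(Dx a b ^^ 2) ?f x = f2 x" if "x \<in> {a..b}" for x
      by (rule Dx_classical(2)[OF ab g f f1 f2 f3 that])
    have Dx3: "(Dx a b ^^ 3) ?f x = f3 x" if "x \<in> {a..b}" for x
      by (rule Dx_classical(3)[OF ab g f f1 f2 f3 that])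
    have Dx4: "AE x in lebesgue_on {a..b}. (Dx a b ^^ 4) ?f x = g x"
      by (rule Dx_classical(4)[OF ab g f f1 f2 f3])
    have abm: "a \<in> {a..b}" "b \<in> {a..b}" using ab by auto
    have bc: "?f a = p t" "?f b = q t" "f1 a = 0" "f1 b = 0"
      using Rt Dx1[OF abm(1)] Dx1[OF abm(2)] by (simp_all add: R_def)
    have c: "continuous_on {a..b} f1" "continuous_on {a..b} f2" using f1 f2 by (meson DERIV_continuous_on)+
    let ?F = "\<lambda>x. - w x t * f1 x - lam * f2 x - g x"
    have FL: "L2_on a b ?F"
      by (intro L2_on_diff[OF _ g] L2_on_continuous continuous_intros fc c)
    have "AE x in lebesgue_on {a..b}. ((\<lambda>s. w x s) has_real_derivative ?F x) (at t)"
      using der[unfolded S_def] Dx4 AE_space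
    proof eventually_elim
      fix x assume 1: "((\<lambda>s. w x s) has_real_derivative F x t) (at t within D)"
        and 2: "(Dx a b ^^ 4) ?f x = g x" and 3: "x \<in> space (lebesgue_on {a..b})"
      have x: "x \<in> {a..b}" using 3 by simp
      show "((\<lambda>s. w x s) has_real_derivative ?F x) (at t)"
        using 1 unfolding at F_def 2 Dx1[OF x] Dx2[OF x] .
    qed
    moreover obtain M \<epsilon> where M: "\<epsilon> > 0" "\<And>s. \<bar>s - t\<bar> < \<epsilon> \<Longrightarrow> dist2 (\<lambda>x. w x s) (\<lambda>x. w x t) \<le> M * \<bar>s - t\<bar>"
      using sp unfolding U_def by blast
    define \<rho> where "\<rho> = min \<epsilon> (min (t - \<alpha>) (\<beta> - t))"
    have \<rho>: "\<rho> > 0" "\<And>s. \<bar>s - t\<bar> < \<rho> \<Longrightarrow> s \<in> D" "\<And>s. \<bar>s - t\<bar> < \<rho> \<Longrightarrow> \<bar>s - t\<bar> < \<epsilon>"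
      using M(1) t by (auto simp: \<rho>_def intro!: subsetD[OF oD])
    ultimately have "(energy a b w has_real_derivative integral {a..b} (\<lambda>x. w x t * ?F x)) (at t)"
      by (intro energy_has_derivative[OF \<rho>(1) L2[OF \<rho>(2)] _ FL]) (use M(2) \<rho>(3) in \<open>auto simp: dist2_def\<close>)
    moreover have "integral {a..b} (\<lambda>x. w x t * ?F x) = (p t ^ 3 - q t ^ 3) / 3 + p t * f3 a - q t * f3 b
         + lam * integral {a..b} (\<lambda>x. (f1 x)\<^sup>2) - integral {a..b} (\<lambda>x. (f2 x)\<^sup>2)"
      by (rule KS_energy_rate[OF ab g f f1 f2 f3 bc])
    moreover have "lam * integral {a..b} (\<lambda>x. (f1 x)\<^sup>2) - integral {a..b} (\<lambda>x. (f2 x)\<^sup>2)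
     \<le> delta1 \<delta> * integral {a..b} (\<lambda>x. (w x t)\<^sup>2) + C1 a b (p t) (q t) + delta2 \<delta> * C2 a b (p t) (q t) + lam * C3 a b (p t) (q t)"
      by (rule lifted_dissipation_bound[OF ab lam \<delta> f f1 c(2) bc])
    moreover have "delta1 \<delta> * integral {a..b} (\<lambda>x. (w x t)\<^sup>2) = 2 * delta1 \<delta> * energy a b w t"
      by (simp add: energy_def)
    ultimately show "\<exists>V'. (energy a b w has_real_derivative V') (at t) \<and>
       V' \<le> energy_rate_bound lam \<delta> a b (p t) (q t)
         ((Dx a b ^^ 3) (\<lambda>x. w x t) a) ((Dx a b ^^ 3) (\<lambda>x. w x t) b) (energy a b w t)"
      unfolding Dx3[OF abm(1)] Dx3[OF abm(2)] energy_rate_bound_def by (intro exI conjI) (assumption, linarith)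
  qed
qed

text \<open>The energy is half the square of the norm, and the norm is bounded on compact time intervals.\<close>

lemma energy_locally_AC:
  assumes L2: "\<And>t. t \<in> D \<Longrightarrow> L2_on a b (\<lambda>x. w x t)"
    and AC: "locally_AC (\<lambda>f g. L2_norm_on a b (\<lambda>x. f x - g x)) D (\<lambda>t x. w x t)" and sub: "{\<alpha>..\<beta>} \<subseteq> D"
  shows "locally_AC dist {\<alpha>..\<beta>} (energy a b w)"
proof -
  define n where "n t = L2_norm_on a b (\<lambda>x. w x t)" for t
  have tri: "\<bar>n r - n s\<bar> \<le> L2_norm_on a b (\<lambda>x. w x r - w x s)" if "r \<in> {\<alpha>..\<beta>}" "s \<in> {\<alpha>..\<beta>}" for r s
    using L2_norm_on_triangle[of a b "\<lambda>x. w x r" "\<lambda>x. w x s"] L2_norm_on_triangle[of a b "\<lambda>x. w x s" "\<lambda>x. w x r"]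
      L2_norm_on_minus_commute[of a b "\<lambda>x. w x r" "\<lambda>x. w x s"] L2[of r] L2[of s] that sub
    unfolding n_def by fastforce
  have "locally_AC dist {\<alpha>..\<beta>} n"
    by (rule locally_AC_comparison[OF AC sub, of 1]) (use tri in \<open>auto simp: dist_real_def intro: add_increasing2\<close>)
  then obtain B where B: "B \<ge> 0" "\<And>t. t \<in> {\<alpha>..\<beta>} \<Longrightarrow> \<bar>n t\<bar> \<le> B"
    using continuous_on_interval_bounded[OF locally_AC_imp_continuous_on] by blast
  have V: "energy a b w t = (n t)\<^sup>2 / 2" if "t \<in> {\<alpha>..\<beta>}" for t
    using L2_norm_on_square(1)[OF L2[of t]] that sub by (auto simp: energy_def n_def)
  show ?thesis
  proof (rule locally_AC_comparison[OF AC sub B(1)])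
    fix r s assume rs: "\<alpha> \<le> r" "r \<le> s" "s \<le> \<beta>"
    then have m: "r \<in> {\<alpha>..\<beta>}" "s \<in> {\<alpha>..\<beta>}" by auto
    have "energy a b w r - energy a b w s = (n r - n s) * ((n r + n s) / 2)"
      unfolding V[OF m(1)] V[OF m(2)] by (simp add: power2_eq_square algebra_simps diff_divide_distrib add_divide_distrib)
    then have "dist (energy a b w r) (energy a b w s) = \<bar>n r - n s\<bar> * \<bar>(n r + n s) / 2\<bar>"
      by (simp only: dist_real_def abs_mult)
    also have "\<dots> \<le> L2_norm_on a b (\<lambda>x. w x r - w x s) * B"
      using tri[OF m] B(2)[OF m(1)] B(2)[OF m(2)] by (intro mult_mono) auto
    also have "\<dots> \<le> B * L2_norm_on a b (\<lambda>x. w x r - w x s) + B * (s - r)" using B(1) rs by (simp add: mult.commute)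
    finally show "dist (energy a b w r) (energy a b w s) \<le> B * L2_norm_on a b (\<lambda>x. w x r - w x s) + B * (s - r)" .
  qed
qed

section \<open>Integrating the energy inequality\<close>

lemma exp_diff_bound: "\<bar>exp x - exp y\<bar> \<le> exp (max x y) * \<bar>x - y\<bar>" for x y :: real
proof -
  have *: "exp v - exp u \<le> exp v * (v - u)" for u v :: real
  proof -
    have "exp v * (1 + (u - v)) \<le> exp v * exp (u - v)" by (intro mult_left_mono exp_ge_add_one_self) auto
    also have "\<dots> = exp u" by (simp add: exp_diff)
    finally show ?thesis by (simp add: algebra_simps)
  qed
  show ?thesis using *[of x y] *[of y x] by (cases "x \<le> y") (auto simp: max_def)
qed

text \<open>The function \<open>V exp (- \<phi>)\<close> is absolutely continuous with nonpositive derivative almost everywhere.  The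
  exponent \<open>\<phi>\<close> is merely Lipschitz because its slope jumps at the switching times.\<close>

lemma Gronwall_AC:
  fixes V \<phi> :: "real \<Rightarrow> real"
  assumes le: "\<alpha> \<le> \<beta>" and AC: "locally_AC dist {\<alpha>..\<beta>} V" and N: "negligible N"
    and lip: "\<And>r s. \<bar>\<phi> r - \<phi> s\<bar> \<le> C * \<bar>r - s\<bar>"
    and rate: "\<And>t. t \<in> {\<alpha><..<\<beta>} - N \<Longrightarrow>
        \<exists>V' c. (V has_real_derivative V') (at t) \<and> (\<phi> has_real_derivative c) (at t) \<and> V' \<le> c * V t"
  shows "V \<beta> \<le> V \<alpha> * exp (\<phi> \<beta> - \<phi> \<alpha>)"
proof -
  define E where "E t = exp (- \<phi> t)" for t
  define W where "W t = V t * E t" for t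
  have C0: "C \<ge> 0" using lip[of 0 1] by simp
  define B2 where "B2 = exp (- \<phi> \<alpha> + C * (\<beta> - \<alpha>))"
  have E: "0 < E t" "E t \<le> B2" if "t \<in> {\<alpha>..\<beta>}" for t
  proof -
    have "\<bar>\<phi> t - \<phi> \<alpha>\<bar> \<le> C * (\<beta> - \<alpha>)"
      using lip[of t \<alpha>] mult_left_mono[OF _ C0, of "\<bar>t - \<alpha>\<bar>" "\<beta> - \<alpha>"] that by force
    then show "0 < E t" "E t \<le> B2" by (auto simp: E_def B2_def)
  qed
  have ACW: "locally_AC dist {\<alpha>..\<beta>} W"
    unfolding W_def[abs_def]
  proof (rule locally_AC_mult_Lipschitz[OF AC, of "B2 * C"])
    show "0 \<le> B2 * C" using C0 by (simp add: B2_def)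
    fix r s assume m: "r \<in> {\<alpha>..\<beta>}" "s \<in> {\<alpha>..\<beta>}"
    have "\<bar>E r - E s\<bar> \<le> exp (max (- \<phi> r) (- \<phi> s)) * \<bar>\<phi> r - \<phi> s\<bar>"
      using exp_diff_bound[of "- \<phi> r" "- \<phi> s"] by (simp add: E_def abs_minus_commute)
    also have "\<dots> \<le> B2 * (C * \<bar>r - s\<bar>)"
      using E[OF m(1)] E[OF m(2)] lip[of r s] by (intro mult_mono) (auto simp: E_def max_def B2_def)
    finally show "\<bar>E r - E s\<bar> \<le> B2 * C * \<bar>r - s\<bar>" by (simp add: mult.assoc)
  qed
  obtain V' c where d: "\<And>t. t \<in> {\<alpha><..<\<beta>} - N \<Longrightarrow> (V has_real_derivative V' t) (at t)"
      "\<And>t. t \<in> {\<alpha><..<\<beta>} - N \<Longrightarrow> (\<phi> has_real_derivative c t) (at t)"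
      "\<And>t. t \<in> {\<alpha><..<\<beta>} - N \<Longrightarrow> V' t \<le> c t * V t"
    using rate by metis
  define W' where "W' t = (if t \<in> {\<alpha><..<\<beta>} - N then (V' t - c t * V t) * E t else 0)" for t
  have h: "(W' has_integral W \<beta> - W \<alpha>) {\<alpha>..\<beta>}"
  proof (rule fundamental_theorem_of_calculus_AC[OF le ACW])
    show "negligible (N \<union> {\<alpha>, \<beta>})" using N by simp
    fix t assume "t \<in> {\<alpha>..\<beta>} - (N \<union> {\<alpha>, \<beta>})"
    then have t: "t \<in> {\<alpha><..<\<beta>} - N" by auto
    have "(W has_real_derivative V' t * E t + V t * (E t * - c t)) (at t)"
      unfolding W_def[abs_def] E_def by (rule derivative_eq_intros d(1)[OF t] d(2)[OF t] refl)+ simp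
    then have "(W has_real_derivative W' t) (at t)" using t by (simp add: W'_def algebra_simps)
    then show "(W has_real_derivative W' t) (at t within {\<alpha>..\<beta>})" by (rule has_field_derivative_at_within)
  qed
  have "W' t \<le> 0" for t
    using d(3)[of t] by (auto simp: W'_def E_def mult_le_0_iff)
  then have "W \<beta> - W \<alpha> \<le> 0" by (intro has_integral_le[OF h has_integral_0])
  then have "V \<beta> * exp (- \<phi> \<beta>) * exp (\<phi> \<beta>) \<le> V \<alpha> * exp (- \<phi> \<alpha>) * exp (\<phi> \<beta>)"
    by (intro mult_right_mono) (auto simp: W_def E_def)
  then show ?thesis by (simp add: mult.assoc exp_add[symmetric])
qed

section \<open>The feedback laws\<close>

text \<open>If the measurement \<open>\<zeta>\<close> is large, the input opposes it and \<open>p \<zeta> = - |\<zeta>| V \<le> - l(V) V\<close>; the threshold \<open>l\<close> is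
  what cancels all other terms.  If \<open>\<zeta>\<close> is small, then \<open>p \<zeta> \<le> p\<^sup>2 + l(V)\<^sup>2\<close>, and the cubic term of a
  sufficiently negative input dominates, which is the condition on \<open>k\<close>.\<close>

lemma feedback_decay:
  fixes V G \<alpha> d \<zeta> :: real and k l :: "real \<Rightarrow> real"
  assumes V: "V \<ge> 0" and G: "G \<ge> 0" and l: "l V = V\<^sup>2 / 3 + G * V + (\<alpha> + 2 * d)"
    and k: "k V ^ 3 + 3 * (G + 1) * (k V)\<^sup>2 + 3 * (l V)\<^sup>2 \<le> - 3 * (\<alpha> + 2 * d) * V"
  defines "p \<equiv> kappa1 l k V \<zeta>"
  shows "p ^ 3 / 3 + p * \<zeta> + 2 * d * V + G * p\<^sup>2 \<le> - \<alpha> * V"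
proof (cases "\<bar>\<zeta>\<bar> \<ge> l V")
  case True
  have p: "p = - sgn \<zeta> * V" using True by (simp add: p_def kappa1_def)
  show ?thesis
  proof (cases "\<zeta> = 0")
    \<comment> \<open>Here \<open>sgn \<zeta> = 0\<close>, so there is no input; but the threshold is then nonpositive.\<close>
    case z: True
    have "0 \<le> V\<^sup>2 / 3 + G * V" using V G by simp
    then have "\<alpha> + 2 * d \<le> 0" using True z l by simp
    then have "(\<alpha> + 2 * d) * V \<le> 0" using V by (rule mult_nonpos_nonneg)
    then show ?thesis using z p by (simp add: algebra_simps)
  next
    case False
    have 1: "p * \<zeta> = - (\<bar>\<zeta>\<bar> * V)" unfolding p using False by (cases "\<zeta> > 0") auto
    have 2: "p\<^sup>2 = V\<^sup>2" unfolding p using False by (cases "\<zeta> > 0") (auto simp: sgn_if)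
    have "\<bar>p\<bar> = V" unfolding p using False V by (cases "\<zeta> > 0") (auto simp: sgn_if)
    then have 3: "p ^ 3 \<le> V ^ 3" by (metis abs_ge_self power_abs)
    have 4: "l V * V \<le> \<bar>\<zeta>\<bar> * V" using True V by (rule mult_right_mono)
    have "p ^ 3 / 3 + p * \<zeta> + 2 * d * V + G * p\<^sup>2 \<le> V ^ 3 / 3 - l V * V + 2 * d * V + G * V\<^sup>2"
      using 1 2 3 4 by simp
    also have "\<dots> = - \<alpha> * V" unfolding l by (simp add: power2_eq_square power3_eq_cube algebra_simps)
    finally show ?thesis .
  qed
next
  case False
  have p: "p = k V" using False by (simp add: p_def kappa1_def)
  have "p * \<zeta> \<le> \<bar>p\<bar> * \<bar>\<zeta>\<bar>" by (metis abs_ge_self abs_mult)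
  also have "\<dots> \<le> \<bar>p\<bar> * l V" using False by (intro mult_left_mono) auto
  also have "\<dots> \<le> p\<^sup>2 + (l V)\<^sup>2"
  proof -
    have "2 * \<bar>p\<bar> * l V \<le> p\<^sup>2 + (l V)\<^sup>2" using sum_squares_bound[of "\<bar>p\<bar>" "l V"] by simp
    moreover have "0 \<le> p\<^sup>2 + (l V)\<^sup>2" by simp
    ultimately show ?thesis by linarith
  qed
  finally have "p * \<zeta> \<le> p\<^sup>2 + (l V)\<^sup>2" .
  moreover have "p ^ 3 + 3 * (G + 1) * p\<^sup>2 + 3 * (l V)\<^sup>2 \<le> - 3 * (\<alpha> + 2 * d) * V" using k p by simp
  ultimately show ?thesis by (simp add: algebra_simps)
qed

lemma kappa3_eq: "kappa3 l k V \<zeta> = - kappa1 l k V \<zeta>"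
  by (simp add: kappa1_def kappa3_def)

lemma quadratic_coeff_unique:
  fixes Q :: "real \<Rightarrow> real"
  assumes "\<And>p. Q p = c * p\<^sup>2"
  shows "(THE c. \<forall>p. Q p = c * p\<^sup>2) = c"
proof (rule the_equality)
  fix c' assume "\<forall>p. Q p = c' * p\<^sup>2"
  then have "Q 1 = c' * 1\<^sup>2" by blast
  then show "c' = c" using assms[of 1] by simp
qed (use assms in blast)

lemma chi_homogeneous:
  "chi a b (r * p) (r * q) x = r * chi a b p q x"
  "chi_x a b (r * p) (r * q) x = r * chi_x a b p q x"
  "chi_xx a b (r * p) (r * q) x = r * chi_xx a b p q x"
proof -
  have e: "r * q - r * p = r * (q - p)" by (simp add: right_diff_distrib)
  show "chi a b (r * p) (r * q) x = r * chi a b p q x"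
    unfolding chi_def by (simp add: algebra_simps)
  show "chi_x a b (r * p) (r * q) x = r * chi_x a b p q x"
    unfolding chi_x_def e by (simp add: mult.assoc mult.left_commute)
  show "chi_xx a b (r * p) (r * q) x = r * chi_xx a b p q x"
    unfolding chi_xx_def e by (simp add: mult.assoc mult.left_commute)
qed

lemma C_homogeneous:
  assumes "a < b"
  shows "C1 a b (r * p) (r * q) = C1 a b p q * r\<^sup>2" "C2 a b (r * p) (r * q) = C2 a b p q * r\<^sup>2"
    "C3 a b (r * p) (r * q) = C3 a b p q * r\<^sup>2"
  by (simp_all add: C_eq_chi_integrals[OF assms] chi_homogeneous power_mult_distrib)

lemma C_nonneg:
  assumes "a < b"
  shows "0 \<le> C1 a b p q" "0 \<le> C2 a b p q" "0 \<le> C3 a b p q"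
proof -
  have "continuous_on {a..b} (chi a b p q)" "continuous_on {a..b} (chi_x a b p q)"
    using chi_derivatives[OF assms] by (meson DERIV_continuous_on)+
  moreover have "continuous_on {a..b} (chi_xx a b p q)"
    unfolding chi_xx_def[abs_def] by (intro continuous_intros) (use assms in auto)
  ultimately show "0 \<le> C1 a b p q" "0 \<le> C2 a b p q" "0 \<le> C3 a b p q"
    unfolding C_eq_chi_integrals[OF assms]
    by (auto intro!: integral_nonneg integrable_continuous_real continuous_intros)
qed

text \<open>Together these allow \<open>2 \<delta>\<^sub>2\<close> as a nonnegative growth rate without input, where \<open>2 \<delta>\<^sub>1\<close> is what the energy
  inequality gives.\<close>

lemma delta2_nonneg_and_ge_delta1: "0 \<le> delta2 \<delta>" "delta1 \<delta> \<le> delta2 \<delta>"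
  by (auto simp: delta1_def delta2_def abs_if field_simps)

lemma left_coeff_C:
  assumes "a < b"
  shows "left_coeff (C1 a b) = C1 a b 1 0" "left_coeff (C2 a b) = C2 a b 1 0" "left_coeff (C3 a b) = C3 a b 1 0"
proof -
  note h = C_homogeneous[OF assms, where p = 1 and q = 0, simplified]
  show "left_coeff (C1 a b) = C1 a b 1 0"
    unfolding left_coeff_def by (rule quadratic_coeff_unique) (rule h)
  show "left_coeff (C2 a b) = C2 a b 1 0"
    unfolding left_coeff_def by (rule quadratic_coeff_unique) (rule h)
  show "left_coeff (C3 a b) = C3 a b 1 0"
    unfolding left_coeff_def by (rule quadratic_coeff_unique) (rule h)
qed

lemma right_coeff_C:
  assumes "a < b"
  shows "right_coeff (C1 a b) = C1 a b 0 1" "right_coeff (C2 a b) = C2 a b 0 1" "right_coeff (C3 a b) = C3 a b 0 1"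
proof -
  note h = C_homogeneous[OF assms, where p = 0 and q = 1, simplified]
  show "right_coeff (C1 a b) = C1 a b 0 1"
    unfolding right_coeff_def by (rule quadratic_coeff_unique) (rule h)
  show "right_coeff (C2 a b) = C2 a b 0 1"
    unfolding right_coeff_def by (rule quadratic_coeff_unique) (rule h)
  show "right_coeff (C3 a b) = C3 a b 0 1"
    unfolding right_coeff_def by (rule quadratic_coeff_unique) (rule h)
qed

lemma gain_w_form_nonneg:
  assumes "0 < Y" "lam \<ge> 0"
  shows "C1 0 Y p 0 + delta2 \<delta> * C2 0 Y p 0 + lam * C3 0 Y p 0 = gain_w lam Y \<delta> * p\<^sup>2" "0 \<le> gain_w lam Y \<delta>"
proof -
  show "C1 0 Y p 0 + delta2 \<delta> * C2 0 Y p 0 + lam * C3 0 Y p 0 = gain_w lam Y \<delta> * p\<^sup>2"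
    using C_homogeneous[OF assms(1), of p 1 0] by (simp add: gain_w_def left_coeff_C[OF assms(1)] algebra_simps)
  show "0 \<le> gain_w lam Y \<delta>"
    using C_nonneg[OF assms(1)] delta2_nonneg_and_ge_delta1(1) assms(2) by (simp add: gain_w_def left_coeff_C[OF assms(1)])
qed

lemma gain_v_form_nonneg:
  assumes "Y < L" "lam \<ge> 0"
  shows "C1 Y L 0 q + delta2 \<delta> * C2 Y L 0 q + lam * C3 Y L 0 q = gain_v lam Y L \<delta> * q\<^sup>2" "0 \<le> gain_v lam Y L \<delta>"
proof -
  show "C1 Y L 0 q + delta2 \<delta> * C2 Y L 0 q + lam * C3 Y L 0 q = gain_v lam Y L \<delta> * q\<^sup>2"
    using C_homogeneous[OF assms(1), of q 0 1] by (simp add: gain_v_def right_coeff_C[OF assms(1)] algebra_simps)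
  show "0 \<le> gain_v lam Y L \<delta>"
    using C_nonneg[OF assms(1)] delta2_nonneg_and_ge_delta1(1) assms(2) by (simp add: gain_v_def right_coeff_C[OF assms(1)])
qed

section \<open>Decay along solutions\<close>

lemma is_interval_subset_Icc:
  fixes D :: "real set"
  assumes "is_interval D" "s \<in> D" "t \<in> D"
  shows "{s..t} \<subseteq> D"
  by (auto intro: mem_is_interval_1_I[OF assms])

lemma KS_Gronwall:
  assumes ab: "a < b" and lam: "lam \<ge> 0" and \<delta>: "\<delta> \<le> delta_o lam a b"
    and KS: "KS_on lam a b D w p q" and D: "is_interval D" and sub: "{t0..t1} \<subseteq> D" and le: "t0 \<le> t1"
    and lip: "\<And>r s. \<bar>\<phi> r - \<phi> s\<bar> \<le> C * \<bar>r - s\<bar>" and N: "negligible N"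
    and rate: "\<And>t. t \<in> {t0<..<t1} - N \<Longrightarrow> \<exists>c. (\<phi> has_real_derivative c) (at t) \<and>
       energy_rate_bound lam \<delta> a b (p t) (q t)
         ((Dx a b ^^ 3) (\<lambda>x. w x t) a) ((Dx a b ^^ 3) (\<lambda>x. w x t) b) (energy a b w t) \<le> c * energy a b w t"
  shows "energy a b w t1 \<le> energy a b w t0 * exp (\<phi> t1 - \<phi> t0)"
proof -
  have L2: "\<And>t. t \<in> D \<Longrightarrow> L2_on a b (\<lambda>x. w x t)"
    and AC: "locally_AC (\<lambda>f g. L2_norm_on a b (\<lambda>x. f x - g x)) D (\<lambda>t x. w x t)"
    using KS unfolding KS_on_def by blast+
  obtain N' where N': "negligible N'"
    "\<And>t. t \<in> {t0<..<t1} - N' \<Longrightarrow> \<exists>V'. (energy a b w has_real_derivative V') (at t) \<and>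
       V' \<le> energy_rate_bound lam \<delta> a b (p t) (q t)
         ((Dx a b ^^ 3) (\<lambda>x. w x t) a) ((Dx a b ^^ 3) (\<lambda>x. w x t) b) (energy a b w t)"
    using KS_energy_inequality[OF ab lam \<delta> KS D sub] by metis
  show ?thesis
  proof (rule Gronwall_AC[OF le energy_locally_AC[OF L2 AC sub] negligible_Un[OF N N'(1)] lip])
    fix t assume "t \<in> {t0<..<t1} - (N \<union> N')"
    then have t: "t \<in> {t0<..<t1} - N" "t \<in> {t0<..<t1} - N'" by blast+
    from rate[OF t(1)] N'(2)[OF t(2)]
    show "\<exists>V' c. (energy a b w has_real_derivative V') (at t) \<and> (\<phi> has_real_derivative c) (at t) \<and> V' \<le> c * energy a b w t"
      using order_trans by blast
  qed
qed

lemma energy_rate_bound_unforced: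
  assumes "a < b" and V: "0 \<le> V"
  shows "energy_rate_bound lam \<delta> a b 0 0 \<zeta>a \<zeta>b V \<le> 2 * delta2 \<delta> * V"
proof -
  have "C1 a b 0 0 = 0" "C2 a b 0 0 = 0" "C3 a b 0 0 = 0"
    using C_homogeneous[OF assms(1), of 0 0 0] by simp_all
  then show ?thesis using mult_right_mono[OF delta2_nonneg_and_ge_delta1(2) V] by (simp add: energy_rate_bound_def)
qed

lemma energy_rate_bound_left_feedback:
  assumes "0 < Y" "lam \<ge> 0" "0 \<le> V"
    and "k V ^ 3 + 3 * (gain_w lam Y \<delta> + 1) * (k V)\<^sup>2 + 3 * (l1 lam Y \<delta> \<alpha> V)\<^sup>2 \<le> - 3 * (\<alpha> + 2 * delta1 \<delta>) * V"
  shows "energy_rate_bound lam \<delta> 0 Y (kappa1 (l1 lam Y \<delta> \<alpha>) k V \<zeta>) 0 \<zeta> \<zeta>' V \<le> - \<alpha> * V"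
proof -
  let ?p = "kappa1 (l1 lam Y \<delta> \<alpha>) k V \<zeta>"
  have "energy_rate_bound lam \<delta> 0 Y ?p 0 \<zeta> \<zeta>' V
      = ?p ^ 3 / 3 + ?p * \<zeta> + 2 * delta1 \<delta> * V + gain_w lam Y \<delta> * ?p\<^sup>2"
    by (simp add: energy_rate_bound_def gain_w_form_nonneg(1)[OF assms(1,2)])
  also have "\<dots> \<le> - \<alpha> * V"
    by (rule feedback_decay[where l = "l1 lam Y \<delta> \<alpha>" and k = k and d = "delta1 \<delta>", OF assms(3) gain_w_form_nonneg(2)[OF assms(1,2)] l1_def assms(4)])
  finally show ?thesis .
qed

text \<open>At the right end the boundary terms have the opposite sign, which the sign in \<open>kappa3\<close> compensates.\<close>

lemma energy_rate_bound_right_feedback: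
  assumes "Y < L" "lam \<ge> 0" "0 \<le> V"
    and "k V ^ 3 + 3 * (gain_v lam Y L \<delta> + 1) * (k V)\<^sup>2 + 3 * (l3 lam Y L \<delta> \<alpha> V)\<^sup>2 \<le> - 3 * (\<alpha> + 2 * delta1 \<delta>) * V"
  shows "energy_rate_bound lam \<delta> Y L 0 (kappa3 (l3 lam Y L \<delta> \<alpha>) k V \<zeta>) \<zeta>' \<zeta> V \<le> - \<alpha> * V"
proof -
  let ?p = "kappa1 (l3 lam Y L \<delta> \<alpha>) k V \<zeta>"
  have "energy_rate_bound lam \<delta> Y L 0 (- ?p) \<zeta>' \<zeta> V
      = ?p ^ 3 / 3 + ?p * \<zeta> + 2 * delta1 \<delta> * V + gain_v lam Y L \<delta> * ?p\<^sup>2"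
    by (simp add: energy_rate_bound_def gain_v_form_nonneg(1)[OF assms(1,2)])
  also have "\<dots> \<le> - \<alpha> * V"
    by (rule feedback_decay[where l = "l3 lam Y L \<delta> \<alpha>" and k = k and d = "delta1 \<delta>", OF assms(3) gain_v_form_nonneg(2)[OF assms(1,2)] l3_def assms(4)])
  finally show ?thesis unfolding kappa3_eq .
qed

section \<open>The switching schedule\<close>

text \<open>For \<open>t \<ge> 0\<close>, the measure of \<open>I1 \<inter> [0, t]\<close> for the schedule of period \<open>P\<close> whose first phase has length \<open>T1\<close>.\<close>

definition first_phase_time :: "real \<Rightarrow> real \<Rightarrow> real \<Rightarrow> real" where
  "first_phase_time T1 P t = of_int \<lfloor>t / P\<rfloor> * T1 + min (t - P * of_int \<lfloor>t / P\<rfloor>) T1"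

lemma floor_period:
  fixes t P :: real
  assumes "P > 0"
  shows "0 \<le> t - P * of_int \<lfloor>t / P\<rfloor>" "t - P * of_int \<lfloor>t / P\<rfloor> < P"
proof -
  have "of_int \<lfloor>t / P\<rfloor> * P \<le> t"
    using of_int_floor_le[of "t / P"] unfolding pos_le_divide_eq[OF assms] .
  moreover have "t < (of_int \<lfloor>t / P\<rfloor> + 1) * P"
    using real_of_int_floor_add_one_gt[of "t / P"] unfolding pos_divide_less_eq[OF assms] .
  ultimately show "0 \<le> t - P * of_int \<lfloor>t / P\<rfloor>" "t - P * of_int \<lfloor>t / P\<rfloor> < P"
    by (simp_all add: algebra_simps)
qed

lemma first_phase_time_lipschitz:
  assumes T: "0 < T1" "T1 < P" and st: "s \<le> t"
  shows "0 \<le> first_phase_time T1 P t - first_phase_time T1 P s"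
    "first_phase_time T1 P t - first_phase_time T1 P s \<le> t - s"
proof -
  define n where "n = \<lfloor>s / P\<rfloor>"
  define m where "m = \<lfloor>t / P\<rfloor>"
  define rs where "rs = s - P * of_int n"
  define rt where "rt = t - P * of_int m"
  have P: "P > 0" using T by simp
  have r: "0 \<le> rs" "rs < P" "0 \<le> rt" "rt < P"
    using floor_period[OF P] by (simp_all add: rs_def rt_def n_def m_def)
  have nm: "n \<le> m" unfolding n_def m_def using st P by (intro floor_mono divide_right_mono) auto
  have f: "first_phase_time T1 P t - first_phase_time T1 P s = of_int (m - n) * T1 + min rt T1 - min rs T1"
    by (simp add: first_phase_time_def n_def m_def rs_def rt_def algebra_simps)
  have ts: "t - s = of_int (m - n) * P + rt - rs" by (simp add: rs_def rt_def algebra_simps)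
  have "0 \<le> of_int (m - n) * T1 + min rt T1 - min rs T1 \<and>
    of_int (m - n) * T1 + min rt T1 - min rs T1 \<le> of_int (m - n) * P + rt - rs"
  proof (cases "m = n")
    case True
    then have "rs \<le> rt" using ts st by simp
    then show ?thesis using True by (auto simp: min_def)
  next
    case False
    then have k: "1 \<le> (of_int (m - n) :: real)" using nm by linarith
    define A where "A = of_int (m - n) * T1"
    define B where "B = of_int (m - n) * P"
    have "1 * T1 \<le> A" unfolding A_def using k T by (intro mult_right_mono) auto
    moreover have "1 * (P - T1) \<le> of_int (m - n) * (P - T1)" using k T by (intro mult_right_mono) auto
    then have "P - T1 \<le> B - A" unfolding A_def B_def by (simp only: right_diff_distrib mult_1)
    ultimately show ?thesis using r T unfolding A_def[symmetric] B_def[symmetric] by (auto simp: min_def)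
  qed
  then show "0 \<le> first_phase_time T1 P t - first_phase_time T1 P s"
    "first_phase_time T1 P t - first_phase_time T1 P s \<le> t - s"
    unfolding f ts by blast+
qed

text \<open>Over complete periods the mean is exact, so the deviation comes from the current period alone.\<close>

lemma first_phase_time_mean:
  assumes T: "0 < T1" "T1 < P"
  shows "\<bar>first_phase_time T1 P t - T1 / P * t\<bar> \<le> P"
proof -
  define n where "n = (of_int \<lfloor>t / P\<rfloor> :: real)"
  define r where "r = t - P * n"
  have P: "P > 0" using T by simp
  have r: "0 \<le> r" "r < P" using floor_period[OF P] by (simp_all add: r_def n_def)
  define q where "q = T1 / P * r"
  have "T1 / P * t = n * T1 + q" using P by (simp add: r_def q_def field_simps)
  then have e: "first_phase_time T1 P t - T1 / P * t = min r T1 - q"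
    by (simp add: first_phase_time_def n_def r_def)
  have "T1 / P * r \<le> 1 * r" using T r by (intro mult_right_mono) auto
  moreover have "0 \<le> T1 / P * r" using T r by simp
  ultimately have "0 \<le> q" "q \<le> r" by (simp_all add: q_def)
  then show ?thesis unfolding e using r T by (auto simp: min_def)
qed

lemma first_phase_time_deriv:
  assumes T: "0 < T1" "T1 < P" and n: "of_int n * P < t" "t < (of_int n + 1) * P"
  shows "t < of_int n * P + T1 \<Longrightarrow> (first_phase_time T1 P has_real_derivative 1) (at t)"
    and "of_int n * P + T1 < t \<Longrightarrow> (first_phase_time T1 P has_real_derivative 0) (at t)"
proof -
  have P: "P > 0" using T by simp
  have fl: "\<lfloor>s / P\<rfloor> = n" if "of_int n * P < s" "s < (of_int n + 1) * P" for s
    using that P by (intro floor_unique) (simp_all add: field_simps)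
  show "(first_phase_time T1 P has_real_derivative 1) (at t)" if t: "t < of_int n * P + T1"
  proof (rule has_field_derivative_transform_within_open)
    show "((\<lambda>s. of_int n * T1 + (s - P * of_int n)) has_real_derivative 1) (at t)"
      by (auto intro!: derivative_eq_intros)
    show "open {of_int n * P<..<of_int n * P + T1}" "t \<in> {of_int n * P<..<of_int n * P + T1}" using n t by auto
    fix s assume s: "s \<in> {of_int n * P<..<of_int n * P + T1}"
    then have "\<lfloor>s / P\<rfloor> = n" using T by (intro fl) (auto simp: algebra_simps)
    then show "of_int n * T1 + (s - P * of_int n) = first_phase_time T1 P s"
      using s by (simp add: first_phase_time_def min_def algebra_simps)
  qed
  show "(first_phase_time T1 P has_real_derivative 0) (at t)" if t: "of_int n * P + T1 < t"
  proof (rule has_field_derivative_transform_within_open)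
    show "((\<lambda>s. of_int n * T1 + T1) has_real_derivative 0) (at t)" by simp
    show "open {of_int n * P + T1<..<(of_int n + 1) * P}" "t \<in> {of_int n * P + T1<..<(of_int n + 1) * P}"
      using n t by auto
    fix s assume s: "s \<in> {of_int n * P + T1<..<(of_int n + 1) * P}"
    then have "\<lfloor>s / P\<rfloor> = n" using T by (intro fl) auto
    then show "of_int n * T1 + T1 = first_phase_time T1 P s"
      using s by (simp add: first_phase_time_def min_def algebra_simps)
  qed
qed

lemma switching_times:
  fixes \<tau> :: "nat \<Rightarrow> real"
  assumes "\<tau> 1 = 0"
    and "\<And>k. k \<ge> 1 \<Longrightarrow> \<tau> (2 * k) - \<tau> (2 * k - 1) = T1"
    and "\<And>k. k \<ge> 1 \<Longrightarrow> \<tau> (2 * k + 1) - \<tau> (2 * k) = T2"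
  shows "\<tau> (2 * n + 1) = real n * (T1 + T2)" "\<tau> (2 * n + 2) = real n * (T1 + T2) + T1"
proof -
  show o: "\<tau> (2 * n + 1) = real n * (T1 + T2)" for n
  proof (induction n)
    case (Suc n)
    then show ?case using assms(2)[of "Suc n"] assms(3)[of "Suc n"] by (simp add: algebra_simps)
  qed (use assms(1) in simp)
  show "\<tau> (2 * n + 2) = real n * (T1 + T2) + T1"
    using assms(2)[of "Suc n"] o[of n] by simp
qed

text \<open>The switching times are excluded because \<open>first_phase_time\<close> has a corner there.\<close>

lemma switching_phase:
  fixes \<tau> :: "nat \<Rightarrow> real"
  assumes T: "T1 > 0" "T2 > 0" and \<tau>: "\<tau> 1 = 0"
    "\<And>k. k \<ge> 1 \<Longrightarrow> \<tau> (2 * k) - \<tau> (2 * k - 1) = T1"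
    "\<And>k. k \<ge> 1 \<Longrightarrow> \<tau> (2 * k + 1) - \<tau> (2 * k) = T2"
    and t: "t \<ge> 0" "t \<notin> range \<tau>"
  shows "(t \<in> I1 \<tau> \<and> (first_phase_time T1 (T1 + T2) has_real_derivative 1) (at t)) \<or>
         (t \<in> I2 \<tau> \<and> (first_phase_time T1 (T1 + T2) has_real_derivative 0) (at t))"
proof -
  define P where "P = T1 + T2"
  have P: "0 < P" "T1 < P" using T by (auto simp: P_def)
  define n where "n = nat \<lfloor>t / P\<rfloor>"
  have n0: "0 \<le> \<lfloor>t / P\<rfloor>" using t P by simp
  then have n: "of_int \<lfloor>t / P\<rfloor> = real n" by (simp add: n_def)
  note s = switching_times[OF \<tau>, folded P_def]
  have b: "real n * P \<le> t" "t < (real n + 1) * P"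
    using floor_period[OF P(1), of t] unfolding n by (simp_all add: algebra_simps)
  have ne: "t \<noteq> real n * P" "t \<noteq> real n * P + T1"
    using t(2) s[of n] by (metis rangeI)+
  have e1: "\<tau> (2 * Suc n - 1) = real n * P" using s(1)[of n] by simp
  have e2: "\<tau> (2 * Suc n) = real n * P + T1" using s(2)[of n] by simp
  have e3: "\<tau> (2 * Suc n + 1) = (real n + 1) * P" using s(1)[of "Suc n"] by (simp add: algebra_simps)
  have b': "of_int (int n) * P < t" "t < (of_int (int n) + 1) * P" using b ne by auto
  note d = first_phase_time_deriv[OF T(1) P(2) b']
  show ?thesis
  proof (cases "t < real n * P + T1")
    case True
    have "t \<in> {\<tau> (2 * Suc n - 1)..<\<tau> (2 * Suc n)}" unfolding e1 e2 using b True by simp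
    then have "t \<in> I1 \<tau>" unfolding I1_def by (intro UN_I[of "Suc n"]) auto
    then show ?thesis using d(1) True by (simp add: P_def)
  next
    case False
    then have "t \<in> {\<tau> (2 * Suc n)..<\<tau> (2 * Suc n + 1)}" unfolding e3 e2 using b by simp
    then have "t \<in> I2 \<tau>" unfolding I2_def by (intro UN_I[of "Suc n"]) auto
    then show ?thesis using d(2) False ne by (simp add: P_def)
  qed
qed

section \<open>Exponential stability\<close>

lemma L2_norm_split:
  assumes Y: "0 < Y" "Y < L" and w: "L2_on 0 Y (\<lambda>x. w x t)" and v: "L2_on Y L (\<lambda>x. v x t)"
    and u: "\<And>x. x \<in> {0..Y} \<Longrightarrow> u x t = w x t" "\<And>x. x \<in> {Y..L} \<Longrightarrow> u x t = v x t"
  shows "L2_norm_on 0 L (\<lambda>x. u x t) = sqrt (2 * (energy 0 Y w t + energy Y L v t))"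
proof -
  have "((\<lambda>x. (u x t)\<^sup>2) has_integral integral {0..Y} (\<lambda>x. (w x t)\<^sup>2)) {0..Y}"
    using L2_on_subinterval_integrable(2)[OF w order_refl order_refl]
    by (intro has_integral_eq[OF _ integrable_integral]) (use u in auto)
  moreover have "((\<lambda>x. (u x t)\<^sup>2) has_integral integral {Y..L} (\<lambda>x. (v x t)\<^sup>2)) {Y..L}"
    using L2_on_subinterval_integrable(2)[OF v order_refl order_refl]
    by (intro has_integral_eq[OF _ integrable_integral]) (use u in auto)
  ultimately have "((\<lambda>x. (u x t)\<^sup>2) has_integral
      integral {0..Y} (\<lambda>x. (w x t)\<^sup>2) + integral {Y..L} (\<lambda>x. (v x t)\<^sup>2)) {0..L}"
    using Y by (intro has_integral_combine[of 0 Y L]) auto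
  then show ?thesis by (simp add: L2_norm_on_def energy_def integral_unique algebra_simps)
qed

lemma energy_nonneg:
  assumes "L2_on a b (\<lambda>x. w x t)"
  shows "0 \<le> energy a b w t"
  using L2_norm_on_square(1)[OF assms] by (metis energy_def zero_le_power2 mult_nonneg_nonneg zero_le_divide_1_iff zero_le_numeral)

theorem theorem1:
  fixes L Y lam \<alpha>1 \<alpha>2 T1 T2 \<delta> :: real
    and \<tau> :: "nat \<Rightarrow> real"
    and k1 k3 :: "real \<Rightarrow> real"
  assumes "L > 0" and "0 < Y" and "Y < L" and "lam \<ge> 0"
    and "\<tau> 1 = 0" and "\<And>i. i \<ge> 1 \<Longrightarrow> \<tau> i < \<tau> (i + 1)"
    and "T1 > 0" and "T2 > 0"
    and "\<And>k. k \<ge> 1 \<Longrightarrow> \<tau> (2 * k) - \<tau> (2 * k - 1) = T1"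
    and "\<And>k. k \<ge> 1 \<Longrightarrow> \<tau> (2 * k + 1) - \<tau> (2 * k) = T2"
    and "\<delta> \<le> delta_o lam 0 Y" and "\<delta> \<le> delta_o lam Y L"
    and "\<alpha>1 > 0" and "\<alpha>2 > 0"
    and "\<And>V. V \<ge> 0 \<Longrightarrow>
           k1 V ^ 3 + 3 * (gain_w lam Y \<delta> + 1) * (k1 V)\<^sup>2 + 3 * (l1 lam Y \<delta> \<alpha>1 V)\<^sup>2
             \<le> - 3 * (\<alpha>1 + 2 * delta1 \<delta>) * V"
    and "\<And>V. V \<ge> 0 \<Longrightarrow>
           k3 V ^ 3 + 3 * (gain_v lam Y L \<delta> + 1) * (k3 V)\<^sup>2 + 3 * (l3 lam Y L \<delta> \<alpha>2 V)\<^sup>2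
             \<le> - 3 * (\<alpha>2 + 2 * delta1 \<delta>) * V"
    and "\<alpha>1 > 2 * delta2 \<delta> * T2 / T1"
    and "\<alpha>2 > 2 * delta2 \<delta> * T1 / T2"
  shows "\<exists>\<gamma>>0. \<exists>\<kappa>>0. \<forall>D u.
           closed_loop_solution lam Y L \<tau>
             (kappa1 (l1 lam Y \<delta> \<alpha>1) k1) (kappa3 (l3 lam Y L \<delta> \<alpha>2) k3) D u \<longrightarrow>
           (\<forall>t\<^sub>o\<ge>0. \<forall>t\<ge>0. t\<^sub>o \<in> D \<and> t\<^sub>o + t \<in> D \<longrightarrow>
              L2_norm_on 0 L (\<lambda>x. u x (t\<^sub>o + t))
                \<le> \<kappa> * exp (- \<gamma> * t) * L2_norm_on 0 L (\<lambda>x. u x t\<^sub>o))"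
proof -
  note Y = assms(2,3) and lam = assms(4) and T = assms(7,8)
  define P where "P = T1 + T2"
  have P: "0 < P" "T1 < P" using T by (auto simp: P_def)
  define m where "m = first_phase_time T1 P"
  define d where "d = 2 * delta2 \<delta>"
  have d0: "d \<ge> 0" using delta2_nonneg_and_ge_delta1(1) by (simp add: d_def)
  \<comment> \<open>Exponents with slope \<open>- \<alpha>\<close> while the half is observed and \<open>d\<close> otherwise.\<close>
  define \<phi>1 where "\<phi>1 t = d * t - (\<alpha>1 + d) * m t" for t
  define \<phi>2 where "\<phi>2 t = d * t - (\<alpha>2 + d) * (t - m t)" for t
  \<comment> \<open>The mean decay rates over one period; the assumptions on \<open>\<alpha>1\<close> and \<open>\<alpha>2\<close> make them positive.\<close>
  define r1 where "r1 = (\<alpha>1 * T1 - d * T2) / P"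
  define r2 where "r2 = (\<alpha>2 * T2 - d * T1) / P"
  have r: "r1 > 0" "r2 > 0"
    using assms(17,18) T P by (simp_all add: r1_def r2_def d_def field_simps)
  \<comment> \<open>Bounds the deviation of both exponents from their means, each value of \<open>m\<close> being off by at most \<open>P\<close>.\<close>
  define K where "K = 2 * P * (\<alpha>1 + \<alpha>2 + d)"
  \<comment> \<open>The rates belong to the energy, that is, to the square of the norm.\<close>
  define \<gamma> where "\<gamma> = min r1 r2 / 2"
  have m_lip: "\<bar>m s - m t\<bar> \<le> \<bar>s - t\<bar>" "\<bar>(s - m s) - (t - m t)\<bar> \<le> \<bar>s - t\<bar>" for s t
    using first_phase_time_lipschitz[OF T(1) P(2), of s t] first_phase_time_lipschitz[OF T(1) P(2), of t s]
    unfolding m_def by (cases "s \<le> t"; force)+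
  have lip: "\<bar>\<phi>1 s - \<phi>1 t\<bar> \<le> (d + (\<alpha>1 + d)) * \<bar>s - t\<bar>" "\<bar>\<phi>2 s - \<phi>2 t\<bar> \<le> (d + (\<alpha>2 + d)) * \<bar>s - t\<bar>" for s t
  proof -
    have *: "\<bar>d * (s - t) - c * y\<bar> \<le> (d + c) * \<bar>s - t\<bar>" if "\<bar>y\<bar> \<le> \<bar>s - t\<bar>" "0 \<le> c" for c y
    proof -
      have "\<bar>d * (s - t) - c * y\<bar> \<le> \<bar>d * (s - t)\<bar> + \<bar>c * y\<bar>" by (rule abs_triangle_ineq4)
      also have "\<dots> \<le> d * \<bar>s - t\<bar> + c * \<bar>s - t\<bar>"
        using d0 that mult_left_mono[OF that] by (simp add: abs_mult)
      finally show ?thesis by (simp add: distrib_right)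
    qed
    show "\<bar>\<phi>1 s - \<phi>1 t\<bar> \<le> (d + (\<alpha>1 + d)) * \<bar>s - t\<bar>"
      using *[OF m_lip(1), of "\<alpha>1 + d"] d0 assms(13) by (simp add: \<phi>1_def algebra_simps)
    show "\<bar>\<phi>2 s - \<phi>2 t\<bar> \<le> (d + (\<alpha>2 + d)) * \<bar>s - t\<bar>"
      using *[OF m_lip(2), of "\<alpha>2 + d"] d0 assms(14) by (simp add: \<phi>2_def algebra_simps)
  qed
  have decay: "\<phi>1 (s + t) - \<phi>1 s \<le> K - 2 * \<gamma> * t" "\<phi>2 (s + t) - \<phi>2 s \<le> K - 2 * \<gamma> * t" if t: "t \<ge> 0" for s t
  proof -
    have ms: "\<bar>m (s + t) - m s - T1 / P * t\<bar> \<le> 2 * P"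
      using first_phase_time_mean[OF T(1) P(2), of "s + t"] first_phase_time_mean[OF T(1) P(2), of s]
        distrib_left[of "T1 / P" s t]
      unfolding m_def abs_le_iff by linarith
    have g: "2 * \<gamma> * t \<le> r1 * t" "2 * \<gamma> * t \<le> r2 * t" using t by (auto simp: \<gamma>_def intro!: mult_right_mono)
    have "(\<alpha>1 + d) * (T1 / P * t - (m (s + t) - m s)) \<le> (\<alpha>1 + d) * (2 * P)"
      using ms d0 assms(13) by (intro mult_left_mono) auto
    also have "\<dots> \<le> K" using P assms(14) by (simp add: K_def algebra_simps)
    finally have 1: "(\<alpha>1 + d) * (T1 / P * t - (m (s + t) - m s)) \<le> K" .
    have "(\<alpha>2 + d) * ((m (s + t) - m s) - T1 / P * t) \<le> (\<alpha>2 + d) * (2 * P)"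
      using ms d0 assms(14) by (intro mult_left_mono) auto
    also have "\<dots> \<le> K" using P assms(13) by (simp add: K_def algebra_simps)
    finally have 2: "(\<alpha>2 + d) * ((m (s + t) - m s) - T1 / P * t) \<le> K" .
    have T2: "1 - T1 / P = T2 / P" using P(1) by (simp add: P_def field_simps)
    have e1: "\<phi>1 (s + t) - \<phi>1 s = (\<alpha>1 + d) * (\<theta> * t - (m (s + t) - m s)) + (d * (1 - \<theta>) - \<alpha>1 * \<theta>) * t" for \<theta>
      by (simp add: \<phi>1_def algebra_simps)
    have e2: "\<phi>2 (s + t) - \<phi>2 s = (\<alpha>2 + d) * ((m (s + t) - m s) - \<theta> * t) + (d * \<theta> - \<alpha>2 * (1 - \<theta>)) * t" for \<theta>
      by (simp add: \<phi>2_def algebra_simps)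
    have "d * (1 - T1 / P) - \<alpha>1 * (T1 / P) = - r1" "d * (T1 / P) - \<alpha>2 * (1 - T1 / P) = - r2"
      unfolding T2 by (simp_all add: r1_def r2_def diff_divide_distrib)
    then show "\<phi>1 (s + t) - \<phi>1 s \<le> K - 2 * \<gamma> * t" "\<phi>2 (s + t) - \<phi>2 s \<le> K - 2 * \<gamma> * t"
      using 1 2 g unfolding e1[of "T1 / P"] e2[of "T1 / P"] by simp_all
  qed
  have N: "negligible (range \<tau>)" by (simp add: negligible_iff_null_sets null_sets_completionI countable_imp_null_set_lborel)
  show ?thesis
  proof (intro exI conjI allI impI)
    show "\<gamma> > 0" using r by (simp add: \<gamma>_def)
    show "exp (K / 2) > 0" by simp
    fix D u and t\<^sub>o t :: real
    assume cl: "closed_loop_solution lam Y L \<tau> (kappa1 (l1 lam Y \<delta> \<alpha>1) k1) (kappa3 (l3 lam Y L \<delta> \<alpha>2) k3) D u"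
      and t0: "0 \<le> t\<^sub>o" and t: "0 \<le> t" and mem: "t\<^sub>o \<in> D \<and> t\<^sub>o + t \<in> D"
    obtain w v u1 u2 u3 where split: "split_solution lam Y L D w v u1 u2 u3"
      and u: "\<And>s. s \<in> D \<Longrightarrow> (\<forall>x\<in>{0..Y}. u x s = w x s) \<and> (\<forall>x\<in>{Y..L}. u x s = v x s)"
      and u2: "\<And>s. s \<in> D \<Longrightarrow> u2 s = 0"
      and i1: "\<And>s. s \<in> D \<inter> I1 \<tau> \<Longrightarrow>
           u1 s = kappa1 (l1 lam Y \<delta> \<alpha>1) k1 (energy 0 Y w s) ((Dx 0 Y ^^ 3) (\<lambda>x. w x s) 0) \<and> u3 s = 0"
      and i2: "\<And>s. s \<in> D \<inter> I2 \<tau> \<Longrightarrow>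
           u1 s = 0 \<and> u3 s = kappa3 (l3 lam Y L \<delta> \<alpha>2) k3 (energy Y L v s) ((Dx Y L ^^ 3) (\<lambda>x. v x s) L)"
      using cl unfolding closed_loop_solution_def by blast
    have D: "is_interval D" and KSw: "KS_on lam 0 Y D w u1 u2" and KSv: "KS_on lam Y L D v u2 u3"
      using split unfolding split_solution_def by blast+
    have sub: "{t\<^sub>o..t\<^sub>o + t} \<subseteq> D" using is_interval_subset_Icc[OF D] mem by blast
    have L2: "L2_on 0 Y (\<lambda>x. w x s)" "L2_on Y L (\<lambda>x. v x s)" if "s \<in> D" for s
      using KSw KSv that unfolding KS_on_def by blast+
    have En: "0 \<le> energy 0 Y w s" "0 \<le> energy Y L v s" if "s \<in> D" for s
      using L2[OF that] by (auto intro: energy_nonneg)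
    have phase: "(s \<in> I1 \<tau> \<and> (m has_real_derivative 1) (at s)) \<or> (s \<in> I2 \<tau> \<and> (m has_real_derivative 0) (at s))"
      if "s \<in> {t\<^sub>o<..<t\<^sub>o + t} - range \<tau>" for s
      unfolding m_def P_def using that t0 by (intro switching_phase[OF T assms(5,9,10)]) auto
    have le: "t\<^sub>o \<le> t\<^sub>o + t" using t by simp
    have Vw: "energy 0 Y w (t\<^sub>o + t) \<le> energy 0 Y w t\<^sub>o * exp (\<phi>1 (t\<^sub>o + t) - \<phi>1 t\<^sub>o)"
    proof (rule KS_Gronwall[OF Y(1) lam assms(11) KSw D sub le lip(1) N])
      fix s assume s: "s \<in> {t\<^sub>o<..<t\<^sub>o + t} - range \<tau>"
      have sD: "s \<in> D" using s sub by auto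
      have dm: "(\<phi>1 has_real_derivative d - (\<alpha>1 + d) * c) (at s)" if "(m has_real_derivative c) (at s)" for c
        unfolding \<phi>1_def[abs_def] by (rule derivative_eq_intros that refl)+ simp
      show "\<exists>c. (\<phi>1 has_real_derivative c) (at s) \<and> energy_rate_bound lam \<delta> 0 Y (u1 s) (u2 s)
          ((Dx 0 Y ^^ 3) (\<lambda>x. w x s) 0) ((Dx 0 Y ^^ 3) (\<lambda>x. w x s) Y) (energy 0 Y w s)
          \<le> c * energy 0 Y w s"
        using phase[OF s]
      proof (elim disjE conjE)
        assume "s \<in> I1 \<tau>" and "(m has_real_derivative 1) (at s)"
        then show ?thesis
          using dm[of 1] u2[OF sD] i1[of s] sD energy_rate_bound_left_feedback[where k = k1 and \<alpha> = \<alpha>1, OF Y(1) lam En(1)[OF sD] assms(15)[OF En(1)[OF sD]]]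
          by (intro exI[of _ "- \<alpha>1"]) simp
      next
        assume "s \<in> I2 \<tau>" and "(m has_real_derivative 0) (at s)"
        then show ?thesis
          using dm[of 0] u2[OF sD] i2[of s] sD energy_rate_bound_unforced[OF Y(1) En(1)[OF sD]]
          by (intro exI[of _ d]) (simp add: d_def)
      qed
    qed
    have Vv: "energy Y L v (t\<^sub>o + t) \<le> energy Y L v t\<^sub>o * exp (\<phi>2 (t\<^sub>o + t) - \<phi>2 t\<^sub>o)"
    proof (rule KS_Gronwall[OF Y(2) lam assms(12) KSv D sub le lip(2) N])
      fix s assume s: "s \<in> {t\<^sub>o<..<t\<^sub>o + t} - range \<tau>"
      have sD: "s \<in> D" using s sub by auto
      have dm: "(\<phi>2 has_real_derivative d - (\<alpha>2 + d) * (1 - c)) (at s)" if "(m has_real_derivative c) (at s)" for c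
        unfolding \<phi>2_def[abs_def] by (rule derivative_eq_intros that refl)+ simp
      show "\<exists>c. (\<phi>2 has_real_derivative c) (at s) \<and> energy_rate_bound lam \<delta> Y L (u2 s) (u3 s)
          ((Dx Y L ^^ 3) (\<lambda>x. v x s) Y) ((Dx Y L ^^ 3) (\<lambda>x. v x s) L) (energy Y L v s)
          \<le> c * energy Y L v s"
        using phase[OF s]
      proof (elim disjE conjE)
        assume "s \<in> I2 \<tau>" and "(m has_real_derivative 0) (at s)"
        then show ?thesis
          using dm[of 0] u2[OF sD] i2[of s] sD energy_rate_bound_right_feedback[where k = k3 and \<alpha> = \<alpha>2, OF Y(2) lam En(2)[OF sD] assms(16)[OF En(2)[OF sD]]]
          by (intro exI[of _ "- \<alpha>2"]) simp
      next
        assume "s \<in> I1 \<tau>" and "(m has_real_derivative 1) (at s)"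
        then show ?thesis
          using dm[of 1] u2[OF sD] i1[of s] sD energy_rate_bound_unforced[OF Y(2) En(2)[OF sD]]
          by (intro exI[of _ d]) (simp add: d_def)
      qed
    qed
    let ?q = "exp (K - 2 * \<gamma> * t)"
    have mem': "t\<^sub>o \<in> D" "t\<^sub>o + t \<in> D" using mem by auto
    have "energy 0 Y w (t\<^sub>o + t) \<le> energy 0 Y w t\<^sub>o * ?q"
      using Vw mult_left_mono[OF _ En(1)[OF mem'(1)], of "exp (\<phi>1 (t\<^sub>o + t) - \<phi>1 t\<^sub>o)" ?q] decay(1)[OF t, of t\<^sub>o] by simp
    moreover have "energy Y L v (t\<^sub>o + t) \<le> energy Y L v t\<^sub>o * ?q"
      using Vv mult_left_mono[OF _ En(2)[OF mem'(1)], of "exp (\<phi>2 (t\<^sub>o + t) - \<phi>2 t\<^sub>o)" ?q] decay(2)[OF t, of t\<^sub>o] by simp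
    ultimately have "2 * (energy 0 Y w (t\<^sub>o + t) + energy Y L v (t\<^sub>o + t)) \<le> ?q * (2 * (energy 0 Y w t\<^sub>o + energy Y L v t\<^sub>o))"
      by (simp add: algebra_simps)
    then have "sqrt (2 * (energy 0 Y w (t\<^sub>o + t) + energy Y L v (t\<^sub>o + t)))
        \<le> sqrt ?q * sqrt (2 * (energy 0 Y w t\<^sub>o + energy Y L v t\<^sub>o))"
      unfolding real_sqrt_mult[symmetric] by (rule real_sqrt_le_mono)
    moreover have "sqrt ?q = exp (K / 2) * exp (- \<gamma> * t)"
    proof -
      have "?q = (exp (K / 2) * exp (- \<gamma> * t))\<^sup>2"
        by (simp add: power2_eq_square exp_add[symmetric])
      then show ?thesis by simp
    qed
    moreover have "L2_norm_on 0 L (\<lambda>x. u x s) = sqrt (2 * (energy 0 Y w s + energy Y L v s))" if "s \<in> D" for s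
      using u[OF that] by (intro L2_norm_split[where w = w and v = v and u = u and t = s, OF Y L2[OF that]]) auto
    ultimately show "L2_norm_on 0 L (\<lambda>x. u x (t\<^sub>o + t)) \<le> exp (K / 2) * exp (- \<gamma> * t) * L2_norm_on 0 L (\<lambda>x. u x t\<^sub>o)"
      using mem' by simp
  qed
qed

end
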